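(* Let $(M,g)$ be a connected and complete Riemannian manifold with Riemannian distance $\rho$, and let $D\subset M$ be an open subset. Let $b:\mathbb R\times D\to TM$ be a time-dependent vector field, i.e. $b(t,x)\in T_xM$ for every $(t,x)\in\mathbb R\times D$. Assume: (1) for every $x\in D$, the map $t\mapsto b(t,x)$ is measurable; (2) for a.e. $t\in\mathbb R$, the map $x\mapsto b(t,x)$ is continuous; (3) for every compact set $J\subset\mathbb R\times D$ there exists $I_J\in L^1_{\mathrm{loc}}(\mathbb R)$ such that $|b(t,x)|_g\le I_J(t)$ for a.e. $t\in\mathbb R$ and all $x\in D$ with $(t,x)\in J$. Let $t_0\in\mathbb R$ and $x_0\in D$, and consider the initial value problem $$\dot x(t)=b(t,x(t))\ \text{ for a.e. }t,\qquad x(t_0)=x_0. \qquad ( * )$$ For an interval $I\subset\mathbb R$ containing $t_0$, a map $x:I\to D$ is called a solution of $( * )$ on $I$ if it is locally absolutely continuous, $x(t_0)=x_0$, and $\dot x(t)=b(t,x(t))$ for a.e. $t\in I$. Then: (i) There exists $\delta>0$ such that $( * )$ admits at least one solution on $(t_0-\delta,t_0+\delta)$. (ii) Let $c_2\in(t_0,+\infty]$ and let $x:[t_0,c_2)\to D$ be a solution of $( * )$. Suppose that $c_2<+\infty$ and that $x(\cdot)$ cannot be extended beyond $c_2$, in the sense that there do not exist $c_2'>c_2$ and a solution $\widetilde x:[t_0,c_2')\to D$ of $( * )$ which coincides with $x(\cdot)$ on $[t_0,c_2)$. Then for every compact set $K\subset D$ there exists $\tau_K\in[t_0,c_2)$ such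 that $x(t)\notin K$ for all $t\in(\tau_K,c_2)$. Similarly, let $c_1\in[-\infty,t_0)$ and let $x:(c_1,t_0]\to D$ be a solution of $( * )$. Suppose that $c_1>-\infty$ and that $x(\cdot)$ cannot be extended beyond $c_1$ to the left, in the sense that there do not exist $c_1'<c_1$ and a solution $\widetilde x:(c_1',t_0]\to D$ of $( * )$ which coincides with $x(\cdot)$ on $(c_1,t_0]$. Then for every compact set $K\subset D$ there exists $\widetilde\tau_K\in(c_1,t_0]$ such that $x(t)\notin K$ for all $t\in(c_1,\widetilde\tau_K)$.
   Context: $|\cdot|_g$ denotes the norm on tangent vectors induced by $g$, and $\rho$ is the distance on $M$ induced by $g$. A map $x:[a,b]\to M$ is absolutely continuous if there is $m\in L^1(a,b)$ with $\rho(x(s),x(t))\le\int_s^t m(\tau)\,d\tau$ for all $a\le s\le t\le b$. A curve on an open or half-open interval is locally absolutely continuous if its restriction to every compact subinterval is absolutely continuous. The velocity vector $\dot x(t)\in T_{x(t)}M$ is defined, at an interior time $t$ at which the coordinate representation $\varphi\circ x$ in a chart $\varphi$ about $x(t)$ is differentiable, by $\dot x(t)=d(\varphi^{-1})_{\varphi(x(t))}\bigl((\varphi\circ x)'(t)\bigr)$ (this is independent of the chart). *)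

theory Defs
  imports "HOL-Analysis.Analysis"
begin

text \<open>
  A manifold is a whole type \<open>'m\<close> (Hausdorff and second countable by its sort) together with a
  maximal smooth atlas of charts into the Euclidean space \<open>'e\<close>.
\<close>

subsection \<open>Smooth maps between Euclidean spaces\<close>

text \<open>Class \<open>C^k\<close> on an open set \<open>S\<close>. Since the domain has finite dimension, \<open>f\<close> is of class
  \<open>C^(k+1)\<close> iff it is differentiable and all its directional derivatives are of class \<open>C^k\<close>.\<close>

primrec Ck_on :: "nat \<Rightarrow> ('a::euclidean_space \<Rightarrow> 'b::real_normed_vector) \<Rightarrow> 'a set \<Rightarrow> bool" where
  "Ck_on 0 f S \<longleftrightarrow> continuous_on S f"
| "Ck_on (Suc k) f S \<longleftrightarrow>
     (\<forall>y\<in>S. f differentiable (at y)) \<and> (\<forall>v. Ck_on k (\<lambda>y. frechet_derivative f (at y) v) S)"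

definition smooth_on :: "('a::euclidean_space \<Rightarrow> 'b::real_normed_vector) \<Rightarrow> 'a set \<Rightarrow> bool" where
  "smooth_on f S \<longleftrightarrow> (\<forall>k. Ck_on k f S)"


subsection \<open>Smooth manifolds\<close>

text \<open>A chart is a pair of its domain and its coordinate map; only the values of the map on the
  domain matter.\<close>

type_synonym ('m, 'e) chart = "'m set \<times> ('m \<Rightarrow> 'e)"

definition chart_inv :: "('m, 'e) chart \<Rightarrow> 'e \<Rightarrow> 'm" where
  "chart_inv c = inv_into (fst c) (snd c)"

definition is_chart :: "('m::topological_space, 'e::euclidean_space) chart \<Rightarrow> bool" where
  "is_chart c \<longleftrightarrow> open (fst c) \<and> open (snd c ` fst c) \<and>
     homeomorphism (fst c) (snd c ` fst c) (snd c) (chart_inv c)"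

definition transition :: "('m, 'e) chart \<Rightarrow> ('m, 'e) chart \<Rightarrow> 'e \<Rightarrow> 'e" where
  "transition c c' = snd c' \<circ> chart_inv c"

definition smoothly_compatible ::
    "('m, 'e::euclidean_space) chart \<Rightarrow> ('m, 'e) chart \<Rightarrow> bool" where
  "smoothly_compatible c c' \<longleftrightarrow>
     smooth_on (transition c c') (snd c ` (fst c \<inter> fst c')) \<and>
     smooth_on (transition c' c) (snd c' ` (fst c \<inter> fst c'))"

definition smooth_structure ::
    "('m::{t2_space, second_countable_topology}, 'e::euclidean_space) chart set \<Rightarrow> bool" where
  "smooth_structure A \<longleftrightarrow>
     (\<forall>c\<in>A. is_chart c) \<and> (\<Union>c\<in>A. fst c) = UNIV \<and>
     (\<forall>c\<in>A. \<forall>c'\<in>A. smoothly_compatible c c') \<and>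
     (\<forall>c. is_chart c \<and> (\<forall>c'\<in>A. smoothly_compatible c c') \<longrightarrow> c \<in> A)"

definition charts_at :: "('m, 'e) chart set \<Rightarrow> 'm \<Rightarrow> ('m, 'e) chart set" where
  "charts_at A p = {c \<in> A. p \<in> fst c}"


subsection \<open>Tangent vectors\<close>

text \<open>A tangent vector at \<open>p\<close> is the family of its coordinate vectors in all charts about \<open>p\<close>, which
  transform by the derivative of the coordinate changes: \<open>v c\<close> is the image of \<open>v\<close> under the
  differential of \<open>snd c\<close> at \<open>p\<close>. Families are \<open>0\<close> at the other charts, and the vector space
  operations are pointwise.\<close>

type_synonym ('m, 'e) tvector = "('m, 'e) chart \<Rightarrow> 'e"

definition tangent_space ::
    "('m, 'e::euclidean_space) chart set \<Rightarrow> 'm \<Rightarrow> ('m, 'e) tvector set" where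
  "tangent_space A p = {v.
     (\<forall>c\<in>charts_at A p. \<forall>c'\<in>charts_at A p.
        v c' = frechet_derivative (transition c c') (at (snd c p)) (v c)) \<and>
     (\<forall>c. c \<notin> charts_at A p \<longrightarrow> v c = 0)}"

text \<open>The differential of \<open>chart_inv c\<close> at \<open>snd c p\<close>, applied to \<open>\<xi>\<close>.\<close>

definition coord_vector ::
    "('m, 'e::euclidean_space) chart set \<Rightarrow> ('m, 'e) chart \<Rightarrow> 'm \<Rightarrow> 'e \<Rightarrow> ('m, 'e) tvector" where
  "coord_vector A c p \<xi> = (\<lambda>c'. if c' \<in> charts_at A p
     then frechet_derivative (transition c c') (at (snd c p)) \<xi> else 0)"

text \<open>The velocity is defined at \<open>t\<close> only if the curve is differentiable there (from both sides) in
  a chart; the one chosen does not matter.\<close>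

definition has_velocity ::
    "('m, 'e::euclidean_space) chart set \<Rightarrow> (real \<Rightarrow> 'm) \<Rightarrow> real \<Rightarrow> ('m, 'e) tvector \<Rightarrow> bool" where
  "has_velocity A x t v \<longleftrightarrow> (\<exists>c\<in>charts_at A (x t). \<exists>\<xi>.
     ((snd c \<circ> x) has_vector_derivative \<xi>) (at t) \<and> v = coord_vector A c (x t) \<xi>)"

definition velocity ::
    "('m, 'e::euclidean_space) chart set \<Rightarrow> (real \<Rightarrow> 'm) \<Rightarrow> real \<Rightarrow> ('m, 'e) tvector" where
  "velocity A x t = (SOME v. has_velocity A x t v)"


subsection \<open>Riemannian metrics and the Riemannian distance\<close>

type_synonym ('m, 'e) metric_tensor = "'m \<Rightarrow> ('m, 'e) tvector \<Rightarrow> ('m, 'e) tvector \<Rightarrow> real"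

definition riemannian_metric ::
    "('m, 'e::euclidean_space) chart set \<Rightarrow> ('m, 'e) metric_tensor \<Rightarrow> bool" where
  "riemannian_metric A g \<longleftrightarrow>
     (\<forall>p. \<forall>u\<in>tangent_space A p. \<forall>v\<in>tangent_space A p. g p u v = g p v u) \<and>
     (\<forall>p. \<forall>u\<in>tangent_space A p. \<forall>v\<in>tangent_space A p. \<forall>w\<in>tangent_space A p. \<forall>r s.
        g p (\<lambda>c. r *\<^sub>R u c + s *\<^sub>R v c) w = r * g p u w + s * g p v w) \<and>
     (\<forall>p. \<forall>u\<in>tangent_space A p. u \<noteq> (\<lambda>c. 0) \<longrightarrow> 0 < g p u u) \<and>
     (\<forall>c\<in>A. \<forall>\<xi> \<eta>. smooth_on
        (\<lambda>y. g (chart_inv c y) (coord_vector A c (chart_inv c y) \<xi>)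
                               (coord_vector A c (chart_inv c y) \<eta>))
        (snd c ` fst c))"

definition tnorm :: "('m, 'e) metric_tensor \<Rightarrow> 'm \<Rightarrow> ('m, 'e) tvector \<Rightarrow> real" where
  "tnorm g p v = sqrt (g p v v)"

text \<open>Derivatives at the endpoints are one-sided.\<close>

definition C1_curve_on ::
    "('m::topological_space, 'e::euclidean_space) chart set \<Rightarrow> real \<Rightarrow> real \<Rightarrow> (real \<Rightarrow> 'm) \<Rightarrow> bool" where
  "C1_curve_on A a b \<gamma> \<longleftrightarrow> continuous_on {a..b} \<gamma> \<and>
     (\<forall>c\<in>A. \<exists>\<gamma>'.
        (\<forall>t\<in>{t \<in> {a..b}. \<gamma> t \<in> fst c}.
           ((snd c \<circ> \<gamma>) has_vector_derivative \<gamma>' t) (at t within {a..b})) \<and>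
        continuous_on {t \<in> {a..b}. \<gamma> t \<in> fst c} \<gamma>')"

text \<open>\<open>P\<close> is the set of nodes of a partition of \<open>{a..b}\<close>. In contrast to
  \<^const>\<open>piecewise_C1_differentiable_on\<close>, the derivative has one-sided limits at the nodes.\<close>

definition piecewise_C1_curve_on ::
    "('m::topological_space, 'e::euclidean_space) chart set \<Rightarrow> real \<Rightarrow> real \<Rightarrow> (real \<Rightarrow> 'm) \<Rightarrow> bool" where
  "piecewise_C1_curve_on A a b \<gamma> \<longleftrightarrow> (\<exists>P. finite P \<and> {a, b} \<subseteq> P \<and> P \<subseteq> {a..b} \<and>
     (\<forall>s\<in>P. \<forall>t\<in>P. s < t \<and> {s<..<t} \<inter> P = {} \<longrightarrow> C1_curve_on A s t \<gamma>))"

definition curve_length ::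
    "('m, 'e::euclidean_space) chart set \<Rightarrow> ('m, 'e) metric_tensor \<Rightarrow> real \<Rightarrow> real \<Rightarrow>
     (real \<Rightarrow> 'm) \<Rightarrow> real" where
  "curve_length A g a b \<gamma> = (LINT t:{a..b}|lebesgue. tnorm g (\<gamma> t) (velocity A \<gamma> t))"

definition riem_dist ::
    "('m::topological_space, 'e::euclidean_space) chart set \<Rightarrow> ('m, 'e) metric_tensor \<Rightarrow>
     'm \<Rightarrow> 'm \<Rightarrow> real" where
  "riem_dist A g p q =
     Inf {curve_length A g 0 1 \<gamma> |\<gamma>. piecewise_C1_curve_on A 0 1 \<gamma> \<and> \<gamma> 0 = p \<and> \<gamma> 1 = q}"


subsection \<open>Absolutely continuous curves\<close>

definition abs_continuous_on ::
    "('m::topological_space, 'e::euclidean_space) chart set \<Rightarrow> ('m, 'e) metric_tensor \<Rightarrow>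
     real \<Rightarrow> real \<Rightarrow> (real \<Rightarrow> 'm) \<Rightarrow> bool" where
  "abs_continuous_on A g a b x \<longleftrightarrow> (\<exists>m :: real \<Rightarrow> real. set_integrable lebesgue {a..b} m \<and>
     (\<forall>s t. a \<le> s \<and> s \<le> t \<and> t \<le> b \<longrightarrow>
        riem_dist A g (x s) (x t) \<le> (LINT \<tau>:{s..t}|lebesgue. m \<tau>)))"

definition locally_abs_continuous_on ::
    "('m::topological_space, 'e::euclidean_space) chart set \<Rightarrow> ('m, 'e) metric_tensor \<Rightarrow>
     real set \<Rightarrow> (real \<Rightarrow> 'm) \<Rightarrow> bool" where
  "locally_abs_continuous_on A g I x \<longleftrightarrow>
     (\<forall>a b. a \<le> b \<and> {a..b} \<subseteq> I \<longrightarrow> abs_continuous_on A g a b x)"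

definition locally_integrable :: "(real \<Rightarrow> real) \<Rightarrow> bool" where
  "locally_integrable h \<longleftrightarrow> (\<forall>a b. set_integrable lebesgue {a..b} h)"


subsection \<open>Time-dependent vector fields and their integral curves\<close>

definition time_dependent_field_on ::
    "('m, 'e::euclidean_space) chart set \<Rightarrow> 'm set \<Rightarrow> (real \<Rightarrow> 'm \<Rightarrow> ('m, 'e) tvector) \<Rightarrow> bool" where
  "time_dependent_field_on A D b \<longleftrightarrow> (\<forall>t. \<forall>x\<in>D. b t x \<in> tangent_space A x)"

text \<open>A map into the vector space \<open>tangent_space A p\<close> is (Lebesgue) measurable iff its
  coordinate vectors are.\<close>

definition tangent_measurable ::
    "('m, 'e::euclidean_space) chart set \<Rightarrow> 'm \<Rightarrow> (real \<Rightarrow> ('m, 'e) tvector) \<Rightarrow> bool" where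
  "tangent_measurable A p f \<longleftrightarrow>
     (\<forall>c\<in>charts_at A p. (\<lambda>t. f t c) \<in> borel_measurable lebesgue)"

text \<open>Continuity of a section of the tangent bundle: the charts of \<open>A\<close> trivialise the bundle.\<close>

definition continuous_field_on ::
    "('m::topological_space, 'e::euclidean_space) chart set \<Rightarrow> 'm set \<Rightarrow>
     ('m \<Rightarrow> ('m, 'e) tvector) \<Rightarrow> bool" where
  "continuous_field_on A D X \<longleftrightarrow> (\<forall>c\<in>A. continuous_on (D \<inter> fst c) (\<lambda>x. X x c))"

text \<open>The endpoints of \<open>I\<close>, a null set, are excluded since velocities are two-sided.\<close>

definition is_solution ::
    "('m::topological_space, 'e::euclidean_space) chart set \<Rightarrow> ('m, 'e) metric_tensor \<Rightarrow> 'm set \<Rightarrow>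
     (real \<Rightarrow> 'm \<Rightarrow> ('m, 'e) tvector) \<Rightarrow> real \<Rightarrow> 'm \<Rightarrow> real set \<Rightarrow> (real \<Rightarrow> 'm) \<Rightarrow> bool" where
  "is_solution A g D b t0 x0 I x \<longleftrightarrow> is_interval I \<and> t0 \<in> I \<and> x ` I \<subseteq> D \<and>
     locally_abs_continuous_on A g I x \<and> x t0 = x0 \<and>
     (AE t in lebesgue. t \<in> interior I \<longrightarrow> has_velocity A x t (b t (x t)))"

end

theory Submission
  imports Defs "HOL-Complex_Analysis.Great_Picard"
begin

text \<open>
  Local existence is Caratheodory's theorem in a chart. Euler polygons whose state is frozen on the
  cells of a grid have integrands that are measurable for trivial reasons; Arzela-Ascoli gives a
  limit, dominated convergence its integral equation, and Lebesgue differentiation the velocity.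

  For (ii), suppose that \<open>x\<close> returns arbitrarily late to every neighbourhood of some \<open>p \<in> D\<close>. In a chart
  ball about \<open>p\<close> whose closure lies in \<open>D\<close>, the coordinate speed is bounded by a function that is
  integrable up to the end time \<open>c\<close>. Once the integral of this function over the remaining time is
  small, a return near \<open>p\<close> traps \<open>x\<close> in the ball, so the coordinates are uniformly continuous
  and converge; a local solution issuing from the limit at time \<open>c\<close> then extends \<open>x\<close>. Hence in the
  maximal case every point of \<open>K\<close> has a neighbourhood that \<open>x\<close> eventually avoids, and finitely many
  of these cover \<open>K\<close>. The statement on the left endpoint follows by time reversal.

  Absolute continuity refers to \<open>\<rho>\<close>, so both parts need that \<open>\<rho>\<close> is locally comparable to
  coordinate distance: segments bound it from above, and a curve leaving a chart ball is at least as
  long as the (rescaled) radius. The triangle inequality is what allows curves to be glued.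
\<close>

section \<open>Integration on the real line\<close>

text \<open>The analysis is done with the gauge integral because a velocity known only almost
  everywhere comes without any integrability: a bound on the increments of the curve is enough for
  that velocity to integrate to the increment. On the manifold the main obstacle is that chart maps
  are total functions with arbitrary values off their domains. Differentiability of
  \<open>snd c \<circ> x\<close> therefore does not tell whether \<open>x\<close> stays in the
  chart, so continuity of \<open>x\<close> has to be carried along. For the same reason a curve may
  have no meaningful coordinates at the moment when it leaves a coordinate ball; distances are
  measured slightly before that moment, at any radius below the full one. Existence is proved to the
  right on closed intervals. Such an interval contains its end, so a solution can be restarted there
  and glued, and the junction is a single time, hence null.\<close>

lemma AE_lebesgue_iff_negligible: "(AE t in lebesgue. P t) \<longleftrightarrow> negligible {t. \<not> P t}"
  by (simp add: completion.AE_iff_null_sets negligible_iff_null_sets)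

text \<open>For time reversal: reflection is differentiable and hence maps negligible sets to
  negligible sets.\<close>

lemma AE_lebesgue_reflect: "(AE t in lebesgue. P t) \<Longrightarrow> (AE t in lebesgue. P (- t :: real))"
  unfolding AE_lebesgue_iff_negligible
proof -
  assume "negligible {t. \<not> P t}"
  then have "negligible (uminus ` {t. \<not> P t})"
    by (intro negligible_differentiable_image_negligible) (auto simp: differentiable_on_def)
  moreover have "uminus ` {t. \<not> P t} = {t. \<not> P (- t)}" by force
  ultimately show "negligible {t. \<not> P (- t)}" by simp
qed

lemma uminus_lebesgue_measurable: "uminus \<in> measurable lebesgue (lebesgue :: real measure)"
  using lebesgue_affine_measurable[of "\<lambda>_::real. -1" 0] by (simp add: fun_eq_iff cong: measurable_cong)

text \<open>Setting both functions to \<open>0\<close> on \<open>N\<close> changes neither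
  integrability nor integrals, and makes the bound hold everywhere.\<close>

lemma integral_norm_bound_off_negligible:
  fixes f :: "real \<Rightarrow> 'a::euclidean_space"
  assumes N: "negligible N" and f: "f integrable_on S" "h integrable_on S"
    and le: "\<And>t. t \<in> S - N \<Longrightarrow> norm (f t) \<le> h t"
  shows "norm (integral S f) \<le> integral S h"
proof -
  have "norm (integral S (\<lambda>t. if t \<in> N then 0 else f t)) \<le> integral S (\<lambda>t. if t \<in> N then 0 else h t)"
    using le
    by (intro integral_norm_bound_integral integrable_spike[OF f(1) N] integrable_spike[OF f(2) N]) auto
  moreover have "integral S (\<lambda>t. if t \<in> N then 0 else f t) = integral S f"
    "integral S (\<lambda>t. if t \<in> N then 0 else h t) = integral S h"
    by (rule integral_spike[OF N]; simp)+
  ultimately show ?thesis by simp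
qed

text \<open>The errors of the linear approximation at \<open>u\<close> and \<open>v\<close> are at
  most \<open>e * (x - u)\<close> and \<open>e * (v - x)\<close>. They add up to
  \<open>e * (v - u)\<close> because \<open>x\<close> lies between; a tag lies in its cell in just
  this way.\<close>

lemma norm_diff_vector_derivative_straddle:
  fixes F :: "real \<Rightarrow> 'a::real_normed_vector"
  assumes "(F has_vector_derivative l) (at x within S)" "e > 0"
  obtains d where "d > 0"
    "\<And>u v. \<lbrakk>u \<in> S; v \<in> S; u \<le> x; x \<le> v; dist x u < d; dist x v < d\<rbrakk> \<Longrightarrow>
       norm ((v - u) *\<^sub>R l - (F v - F u)) \<le> e * (v - u)"
proof -
  obtain d where d: "d > 0"
    "\<And>y. \<lbrakk>y \<in> S; norm (y - x) < d\<rbrakk> \<Longrightarrow> norm (F y - F x - (y - x) *\<^sub>R l) \<le> e * norm (y - x)"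
    using assms unfolding has_vector_derivative_def has_derivative_within_alt by blast
  show ?thesis
  proof
    fix u v assume uv: "u \<in> S" "v \<in> S" "u \<le> x" "x \<le> v" "dist x u < d" "dist x v < d"
    have "norm ((v - u) *\<^sub>R l - (F v - F u))
        = norm ((F u - F x - (u - x) *\<^sub>R l) - (F v - F x - (v - x) *\<^sub>R l))"
      by (simp add: algebra_simps)
    also have "\<dots> \<le> e * norm (u - x) + e * norm (v - x)"
    proof (rule order_trans[OF norm_triangle_ineq4 add_mono])
      show "norm (F u - F x - (u - x) *\<^sub>R l) \<le> e * norm (u - x)"
        using uv by (intro d(2)) (auto simp: dist_norm)
      show "norm (F v - F x - (v - x) *\<^sub>R l) \<le> e * norm (v - x)"
        using uv by (intro d(2)) (auto simp: dist_norm)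
    qed
    also have "\<dots> = e * (v - u)" using uv by (simp add: algebra_simps)
    finally show "norm ((v - u) *\<^sub>R l - (F v - F u)) \<le> e * (v - u)" .
  qed (fact d(1))
qed

text \<open>The tags in \<open>N\<close> are dealt with by Henstock's lemma for \<open>m\<close> with its values on \<open>N\<close> replaced by \<open>0\<close>:
  on the cells with such tags it compares the integral of \<open>m\<close> with \<open>0\<close>.\<close>

lemma has_integral_absolutely_continuous:
  fixes F f :: "real \<Rightarrow> 'a::euclidean_space" and m :: "real \<Rightarrow> real"
  assumes ab: "a \<le> b" and m: "m integrable_on {a..b}"
    and ac: "\<And>s t. \<lbrakk>a \<le> s; s \<le> t; t \<le> b\<rbrakk> \<Longrightarrow> norm (F t - F s) \<le> integral {s..t} m"
    and N: "negligible N"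
    and der: "\<And>t. t \<in> {a..b} - N \<Longrightarrow> (F has_vector_derivative f t) (at t within {a..b})"
  shows "(f has_integral F b - F a) {a..b}"
proof -
  define f0 where "f0 t = (if t \<in> N then 0 else f t)" for t
  define m0 where "m0 t = (if t \<in> N then 0 else m t)" for t
  have m0: "m0 integrable_on cbox a b"
    unfolding box_real by (rule integrable_spike[OF m N]) (auto simp: m0_def)
  have m0eq: "integral K m0 = integral K m" for K
    by (rule integral_spike[OF N]) (auto simp: m0_def)
  have "(f0 has_integral F b - F a) {a..b}"
    unfolding has_integral box_real[symmetric]
  proof (intro allI impI)
    fix e :: real assume e: "e > 0"
    \<comment> \<open>Half of \<open>e\<close> pays for an error \<open>c\<close> per unit length
      over \<open>{a..b}\<close>, the other half is left to Henstock's lemma. The \<open>+ 1\<close>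
      keeps the denominator positive when \<open>a = b\<close>.\<close>
    define c where "c = e / (2 * (b - a + 1))"
    have c: "c > 0" "c * (b - a) < e / 2" using e ab unfolding c_def by (auto simp: field_simps)
    have "\<exists>d>0. \<forall>u v. t \<in> {a..b} - N \<longrightarrow> u \<in> {a..b} \<longrightarrow> v \<in> {a..b} \<longrightarrow> u \<le> t \<longrightarrow> t \<le> v \<longrightarrow>
        dist t u < d \<longrightarrow> dist t v < d \<longrightarrow> norm ((v - u) *\<^sub>R f t - (F v - F u)) \<le> c * (v - u)" for t
    proof (cases "t \<in> {a..b} - N")
      case True
      from norm_diff_vector_derivative_straddle[OF der[OF True] c(1)] show ?thesis by metis
    qed (auto intro: exI[of _ 1])
    then have "\<exists>d. \<forall>t. d t > 0 \<and> (\<forall>u v. t \<in> {a..b} - N \<longrightarrow> u \<in> {a..b} \<longrightarrow> v \<in> {a..b} \<longrightarrow> u \<le> t \<longrightarrow> t \<le> v \<longrightarrow>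
        dist t u < d t \<longrightarrow> dist t v < d t \<longrightarrow> norm ((v - u) *\<^sub>R f t - (F v - F u)) \<le> c * (v - u))"
      by (intro choice allI)
    then obtain d where d: "\<And>t. d t > 0"
      "\<And>t u v. \<lbrakk>t \<in> {a..b} - N; u \<in> {a..b}; v \<in> {a..b}; u \<le> t; t \<le> v; dist t u < d t; dist t v < d t\<rbrakk>
         \<Longrightarrow> norm ((v - u) *\<^sub>R f t - (F v - F u)) \<le> c * (v - u)"
      by blast
    obtain G where G: "gauge G"
      "\<And>p. \<lbrakk>p tagged_partial_division_of cbox a b; G fine p\<rbrakk> \<Longrightarrow>
         (\<Sum>(x,K)\<in>p. norm (measure lborel K *\<^sub>R m0 x - integral K m0)) < e / 2"
      using Henstock_lemma[OF m0 half_gt_zero[OF e]] by blast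
    define H where "H t = G t \<inter> ball t (d t)" for t
    show "\<exists>H. gauge H \<and> (\<forall>p. p tagged_division_of cbox a b \<and> H fine p \<longrightarrow>
        norm ((\<Sum>(x,K)\<in>p. measure lborel K *\<^sub>R f0 x) - (F b - F a)) < e)"
    proof (intro exI conjI allI impI)
      show "gauge H" unfolding H_def using G(1) d(1) by (intro gauge_Int gauge_ball_dependent) auto
      fix p assume p: "p tagged_division_of cbox a b \<and> H fine p"
      then have ptag: "p tagged_division_of cbox a b" and fine: "G fine p" "(\<lambda>t. ball t (d t)) fine p"
        unfolding H_def fine_Int by auto
      note ptd = tagged_division_ofD[OF ptag]
      have ba: "b - a = (\<Sum>(x,K)\<in>p. Sup K - Inf K)" "F b - F a = (\<Sum>(x,K)\<in>p. F (Sup K) - F (Inf K))"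
        using additive_tagged_division_1[where f= "\<lambda>x. x"] additive_tagged_division_1[where f= F] ab ptag
        by auto
      have pw: "norm (measure lborel K *\<^sub>R f0 x - (F (Sup K) - F (Inf K)))
          \<le> c * (Sup K - Inf K) + norm (measure lborel K *\<^sub>R m0 x - integral K m0)" if xK: "(x,K) \<in> p" for x K
      proof -
        obtain u v where K: "K = {u..v}" using ptd(4)[OF xK] by (auto)
        have x: "u \<le> x" "x \<le> v" "a \<le> u" "v \<le> b" using ptd(2,3)[OF xK] K by (auto)
        have cK: "measure lborel K = v - u" "Sup K = v" "Inf K = u" using x K by auto
        show ?thesis
        proof (cases "x \<in> N")
          case False
          have "K \<subseteq> ball x (d x)" using fine(2) xK by (auto simp: fine_def)
          moreover have "u \<in> K" "v \<in> K" using x K by auto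
          ultimately have "dist x u < d x" "dist x v < d x" using mem_ball by blast+
          then have "norm ((v - u) *\<^sub>R f x - (F v - F u)) \<le> c * (v - u)"
            using d(2)[of x u v] x False by auto
          then show ?thesis unfolding cK f0_def using False by (simp add: add_increasing2)
        next
          case True
          have "norm (F v - F u) \<le> integral K m0" unfolding m0eq K using ac x by auto
          moreover have "0 \<le> c * (v - u)" using c x by auto
          ultimately have "norm (F v - F u) \<le> c * (v - u) + norm (0 - integral K m0)" by simp
          moreover have "f0 x = 0" "m0 x = 0" using True by (simp_all add: f0_def m0_def)
          ultimately show ?thesis unfolding cK by (simp add: norm_minus_commute)
        qed
      qed
      have "norm ((\<Sum>(x,K)\<in>p. measure lborel K *\<^sub>R f0 x) - (F b - F a))
          = norm (\<Sum>(x,K)\<in>p. measure lborel K *\<^sub>R f0 x - (F (Sup K) - F (Inf K)))"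
        unfolding ba(2) by (simp add: sum_subtractf case_prod_unfold)
      also have "\<dots> \<le> (\<Sum>(x,K)\<in>p. c * (Sup K - Inf K) + norm (measure lborel K *\<^sub>R m0 x - integral K m0))"
        by (rule sum_norm_le) (use pw in auto)
      also have "\<dots> = c * (b - a) + (\<Sum>(x,K)\<in>p. norm (measure lborel K *\<^sub>R m0 x - integral K m0))"
        unfolding ba(1) by (simp add: sum.distrib sum_distrib_left case_prod_unfold)
      also have "\<dots> < e / 2 + e / 2"
        using c(2) G(2)[OF _ fine(1)] ptag
        by (intro add_strict_mono) (auto simp: tagged_division_of_def)
      finally show "norm ((\<Sum>(x,K)\<in>p. measure lborel K *\<^sub>R f0 x) - (F b - F a)) < e" by simp
    qed
  qed
  then show ?thesis by (rule has_integral_spike[OF N, rotated]) (auto simp: f0_def)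
qed

text \<open>Where the difference quotients do not converge there are arbitrarily small intervals \<open>{u..v}\<close> with a
  large Henstock defect \<open>norm ((v - u) *\<^sub>R f t - integral {u..v} f)\<close>. By Henstock's lemma a disjoint
  Vitali subfamily of them has small total length.\<close>

lemma indefinite_integral_has_vector_derivative_ae:
  fixes f :: "real \<Rightarrow> 'a::euclidean_space"
  assumes f: "f integrable_on {a..b}"
  obtains N where "negligible N"
    "\<And>t. t \<in> {a<..<b} - N \<Longrightarrow> ((\<lambda>u. integral {a..u} f) has_vector_derivative f t) (at t)"
proof -
  define E where "E e = {t \<in> {a<..<b}. \<forall>d>0. \<exists>u v. a < u \<and> u \<le> t \<and> t \<le> v \<and> v < b \<and> u < v \<and> v - u < d \<and>
      e * (v - u) < norm ((v - u) *\<^sub>R f t - integral {u..v} f)}" for e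
  have negE: "negligible (E e)" if e: "e > 0" for e
    unfolding negligible_outer_le
  proof (intro allI impI)
    fix \<eta> :: real assume \<eta>: "\<eta> > 0"
    \<comment> \<open>The intervals collected in \<open>K\<close> are shorter than
      \<open>1 / e\<close> times their defect, so the tolerance \<open>e * \<eta>\<close> bounds
      their total length by \<open>\<eta>\<close>.\<close>
    obtain G where G: "gauge G"
      "\<And>p. \<lbrakk>p tagged_partial_division_of cbox a b; G fine p\<rbrakk> \<Longrightarrow>
         (\<Sum>(x,K)\<in>p. norm (measure lborel K *\<^sub>R f x - integral K f)) < e * \<eta>"
      using Henstock_lemma[OF f[folded box_real(2)] mult_pos_pos[OF e \<eta>]] by blast
    define K where "K = {(t,u,v). t \<in> E e \<and> a < u \<and> u \<le> t \<and> t \<le> v \<and> v < b \<and> u < v \<and> {u..v} \<subseteq> G t \<and>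
      e * (v - u) < norm ((v - u) *\<^sub>R f t - integral {u..v} f)}"
    \<comment> \<open>Vitali's theorem speaks of closed balls, so intervals are presented by centre
      and radius. The indices are triples in order to remember the tag \<open>t\<close>.\<close>
    define c r where "c = (\<lambda>(t::real,u::real,v::real). (u + v) / 2)"
      and "r = (\<lambda>(t::real,u::real,v::real). (v - u) / 2)"
    have cb: "cball (c (t,u,v)) (r (t,u,v)) = {u..v}" for t u v
      by (simp add: c_def r_def cball_eq_atLeastAtMost field_simps)
    obtain C where C: "countable C" "C \<subseteq> K"
      "pairwise (\<lambda>i j. disjnt (cball (c i) (r i)) (cball (c j) (r j))) C"
      "negligible (E e - (\<Union>i\<in>C. cball (c i) (r i)))"
    proof (rule Vitali_covering_theorem_cballs[of K r "E e" c])
      show "0 < r i" if "i \<in> K" for i using that by (auto simp: K_def r_def)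
      fix x d :: real assume x: "x \<in> E e" and d: "0 < d"
      obtain d' where d': "d' > 0" "ball x d' \<subseteq> G x"
        using gaugeD[OF G(1), of x] openE by metis
      obtain u v where uv: "a < u" "u \<le> x" "x \<le> v" "v < b" "u < v" "v - u < min d d'"
        "e * (v - u) < norm ((v - u) *\<^sub>R f x - integral {u..v} f)"
        using x d d' unfolding E_def by (auto dest!: spec[of _ "min d d'"])
      have "{u..v} \<subseteq> ball x d'" using uv by (auto simp: dist_real_def)
      then have "(x,u,v) \<in> K" using uv d' x unfolding K_def by auto
      moreover have "x \<in> cball (c (x,u,v)) (r (x,u,v))" "r (x,u,v) < d"
        using uv unfolding cb by (auto simp: r_def)
      ultimately show "\<exists>i. i \<in> K \<and> x \<in> cball (c i) (r i) \<and> r i < d" by blast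
    qed
    \<comment> \<open>Finite subfamilies give tagged partial divisions, to which Henstock's lemma
      applies; the uniform bound then passes to the countable union.\<close>
    have fin: "measure lebesgue (\<Union>i\<in>C'. cball (c i) (r i)) \<le> \<eta>" if C': "finite C'" "C' \<subseteq> C" for C'
    proof -
      define p where "p = (\<lambda>(t,u,v). (t, {u..v})) ` C'"
      have inj: "inj_on (\<lambda>(t,u,v). (t, {u..v})) C'"
        using C'(2) C(2) by (auto simp: inj_on_def K_def)
      have p: "p tagged_partial_division_of cbox a b"
        unfolding tagged_partial_division_of_def
      proof (intro conjI allI impI)
        show "finite p" using C' by (auto simp: p_def)
        fix x1 K1 assume 1: "(x1,K1) \<in> p"
        then obtain u1 v1 where i1: "(x1,u1,v1) \<in> C'" "K1 = {u1..v1}" by (auto simp: p_def)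
        then show "x1 \<in> K1" "K1 \<subseteq> cbox a b" "\<exists>a b. K1 = cbox a b"
          using C' C(2) by (fastforce simp: K_def)+
      next
        fix x1 K1 x2 K2 assume 2: "(x1,K1) \<in> p \<and> (x2,K2) \<in> p \<and> (x1,K1) \<noteq> (x2,K2)"
        then obtain u1 v1 u2 v2
          where i: "(x1,u1,v1) \<in> C'" "K1 = {u1..v1}" "(x2,u2,v2) \<in> C'" "K2 = {u2..v2}"
          by (auto simp: p_def)
        have "disjnt K1 K2"
          using pairwiseD[OF C(3), of "(x1,u1,v1)" "(x2,u2,v2)"] i 2 C' unfolding cb by auto
        then show "interior K1 \<inter> interior K2 = {}"
          by (meson disjnt_def disjoint_iff interior_subset subsetD)
      qed
      have "G fine p" using C' C(2) by (auto simp: fine_def p_def K_def)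
      have "measure lebesgue (\<Union>i\<in>C'. cball (c i) (r i)) \<le> (\<Sum>i\<in>C'. measure lebesgue (cball (c i) (r i)))"
        using C' by (intro measure_UNION_le) auto
      also have "\<dots> \<le> (\<Sum>(t,u,v)\<in>C'. (1/e) * norm (measure lborel {u..v} *\<^sub>R f t - integral {u..v} f))"
      proof (rule sum_mono)
        fix i assume "i \<in> C'"
        moreover obtain t u v where i: "i = (t,u,v)" by (cases i)
        ultimately have "(t,u,v) \<in> K" using C' C by auto
        then show "measure lebesgue (cball (c i) (r i))
           \<le> (case i of (t,u,v) \<Rightarrow> (1/e) * norm (measure lborel {u..v} *\<^sub>R f t - integral {u..v} f))"
          unfolding i cb using e by (simp add: K_def field_simps)
      qed
      also have "\<dots> = (1/e) * (\<Sum>(x,K)\<in>p. norm (measure lborel K *\<^sub>R f x - integral K f))"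
        unfolding p_def sum.reindex[OF inj] by (simp add: sum_distrib_left case_prod_unfold)
      also have "\<dots> \<le> (1/e) * (e * \<eta>)"
        using G(2)[OF p \<open>G fine p\<close>] e by (intro mult_left_mono) auto
      finally show ?thesis using e by simp
    qed
    define U where "U = (\<Union>i\<in>C. cball (c i) (r i))"
    have U: "U \<in> lmeasurable" "measure lebesgue U \<le> \<eta>"
      unfolding U_def
      using fmeasurable_UN_bound[OF C(1), of "\<lambda>i. cball (c i) (r i)" lebesgue \<eta>]
        measure_UN_bound[OF C(1), of "\<lambda>i. cball (c i) (r i)" lebesgue \<eta>] fin
      by auto
    have neg: "negligible (E e - U)" using C(4) by (simp add: U_def)
    have "E e \<subseteq> U \<union> (E e - U)" by auto
    moreover have "U \<union> (E e - U) \<in> lmeasurable"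
      by (intro fmeasurable.Un U(1) negligible_imp_measurable neg)
    moreover have "measure lebesgue (U \<union> (E e - U)) \<le> \<eta>"
      using U measure_Un_le[of U lebesgue "E e - U"] negligible_imp_measure0[OF neg]
        negligible_imp_measurable[OF neg] by (auto dest: fmeasurableD)
    ultimately show "\<exists>T. E e \<subseteq> T \<and> T \<in> lmeasurable \<and> measure lebesgue T \<le> \<eta>" by blast
  qed
  define N where "N = (\<Union>n. E (1 / real (Suc n)))"
  have "negligible N" unfolding N_def by (intro negligible_countable_Union negligible_Union) (auto intro!: negE)
  moreover have "((\<lambda>u. integral {a..u} f) has_vector_derivative f t) (at t)" if t: "t \<in> {a<..<b} - N" for t
    unfolding has_vector_derivative_def has_derivative_at_alt
  proof (intro conjI allI impI)
    show "bounded_linear (\<lambda>h. h *\<^sub>R f t)" by (rule bounded_linear_scaleR_left)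
    fix e :: real assume "e > 0"
    then obtain n where n: "1 / real (Suc n) < e" using nat_approx_posE by blast
    from t have "t \<notin> E (1 / real (Suc n))" by (auto simp: N_def)
    then obtain d where d: "d > 0" and dd: "\<And>u v. \<lbrakk>a < u; u \<le> t; t \<le> v; v < b; u < v; v - u < d\<rbrakk> \<Longrightarrow>
      norm ((v - u) *\<^sub>R f t - integral {u..v} f) \<le> 1 / real (Suc n) * (v - u)"
      using t unfolding E_def by (force simp: not_less)
    have int: "f integrable_on {u..v}" if "a \<le> u" "v \<le> b" for u v
      using f that by (meson atLeastatMost_subset_iff integrable_on_subinterval)
    \<comment> \<open>The intervals in \<open>E\<close> lie strictly inside \<open>(a, b)\<close>,
      so \<open>y\<close> is kept away from both ends. The increment from \<open>t\<close> to
      \<open>y\<close> is the straddling interval that has \<open>t\<close> as an endpoint.\<close>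
    define d' where "d' = min d (min (t - a) (b - t))"
    have "d' > 0" using d t by (auto simp: d'_def)
    moreover have "norm (integral {a..y} f - integral {a..t} f - (y - t) *\<^sub>R f t) \<le> e * norm (y - t)"
      if y: "norm (y - t) < d'" for y
    proof -
      have yab: "a < y" "y < b" "\<bar>y - t\<bar> < d" using y unfolding d'_def by auto
      have le: "1 / real (Suc n) * \<bar>y - t\<bar> \<le> e * \<bar>y - t\<bar>"
        using n by (intro mult_right_mono) auto
      consider "y = t" | "t < y" | "y < t" by linarith
      then show ?thesis
      proof cases
        case 2
        have "integral {a..t} f + integral {t..y} f = integral {a..y} f"
          using t 2 yab by (intro Henstock_Kurzweil_Integration.integral_combine int) auto
        then have "norm (integral {a..y} f - integral {a..t} f - (y - t) *\<^sub>R f t)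
            = norm ((y - t) *\<^sub>R f t - integral {t..y} f)"
          by (metis add_diff_cancel_left' norm_minus_commute)
        then show ?thesis using dd[of t y] 2 yab t le by auto
      next
        case 3
        have "integral {a..y} f + integral {y..t} f = integral {a..t} f"
          using t 3 yab by (intro Henstock_Kurzweil_Integration.integral_combine int) auto
        then have "integral {a..y} f - integral {a..t} f - (y - t) *\<^sub>R f t
            = (t - y) *\<^sub>R f t - integral {y..t} f"
          by (simp add: algebra_simps)
        then show ?thesis using dd[of y t] 3 yab t le by auto
      qed auto
    qed
    ultimately show "\<exists>d>0. \<forall>y. norm (y - t) < d \<longrightarrow>
        norm (integral {a..y} f - integral {a..t} f - (y - t) *\<^sub>R f t) \<le> e * norm (y - t)" by blast
  qed
  ultimately show thesis by (rule that)
qed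

section \<open>Caratheodory's existence theorem in Euclidean space\<close>

text \<open>\<open>Y n i\<close> is the state of the \<open>n\<close>-th Euler polygon \<open>X n\<close> at the \<open>i\<close>-th grid point. Only countably many states
  occur in \<open>F n\<close>, whence its measurability; the limit \<open>\<lambda>s. f s (y s)\<close> inherits integrability from
  dominated convergence.\<close>

lemma caratheodory_existence_bounded:
  fixes f :: "real \<Rightarrow> 'e::euclidean_space \<Rightarrow> 'e" and h :: "real \<Rightarrow> real"
  assumes ab: "a < b"
    and meas: "\<And>y. (\<lambda>t. f t y) \<in> borel_measurable lebesgue"
    and cont: "\<And>t. continuous_on UNIV (f t)"
    and bd: "\<And>t y. norm (f t y) \<le> h t"
    and h: "h integrable_on {a..b}"
  obtains y where "continuous_on {a..b} y" "(\<lambda>t. f t (y t)) integrable_on {a..b}"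
    "\<And>t. t \<in> {a..b} \<Longrightarrow> y t = y0 + integral {a..t} (\<lambda>s. f s (y s))"
proof -
  \<comment> \<open>There are \<open>Suc n\<close> cells, which keeps the denominator nonzero. The
    final point \<open>b\<close> gets the index \<open>Suc n\<close>, hence the bounds
    \<open>i \<le> Suc n\<close> below.\<close>
  define grid where "grid n i = a + (b - a) * real i / real (Suc n)" for n i
  define idx where "idx n s = nat \<lfloor>(s - a) * real (Suc n) / (b - a)\<rfloor>" for n and s :: real
  define Y where "Y n = rec_nat y0 (\<lambda>i y. y + integral {grid n i..grid n (Suc i)} (\<lambda>s. f s y))" for n
  define F where "F n s = f s (Y n (idx n s))" for n s
  define X where "X n t = y0 + integral {a..t} (F n)" for n t
  define H where "H t = integral {a..t} h" for t
  have h0: "0 \<le> h t" for t using order_trans[OF norm_ge_zero bd] .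
  have hint: "h integrable_on {s..t}" if "a \<le> s" "t \<le> b" for s t
    using h that by (meson atLeastatMost_subset_iff integrable_on_subinterval)
  have Fmeas: "F n \<in> borel_measurable lebesgue" for n
    unfolding F_def
  proof (rule measurable_compose_countable)
    show "(\<lambda>s. f s (Y n i)) \<in> borel_measurable lebesgue" for i by (rule meas)
    have "idx n \<in> borel \<rightarrow>\<^sub>M count_space UNIV" unfolding idx_def by measurable
    then show "idx n \<in> lebesgue \<rightarrow>\<^sub>M count_space UNIV"
      by (intro measurable_completion) simp
  qed
  have Fint: "F n integrable_on {s..t}" if "a \<le> s" "t \<le> b" for n s t
    using measurable_bounded_by_integrable_imp_integrable[OF measurable_restrict_space1[OF Fmeas] hint[OF that]]
      bd by (auto simp: F_def)
  \<comment> \<open>The increments of \<open>H\<close> are a modulus of continuity common to all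
    polygons. Both the equicontinuity and the uniform bound for Arzela-Ascoli come from it.\<close>
  have Xinc: "norm (X n t - X n s) \<le> H t - H s" if "a \<le> s" "s \<le> t" "t \<le> b" for n s t
  proof -
    have "integral {a..s} (F n) + integral {s..t} (F n) = integral {a..t} (F n)"
      using that by (intro Henstock_Kurzweil_Integration.integral_combine Fint) auto
    moreover have "integral {a..s} h + integral {s..t} h = integral {a..t} h"
      using that by (intro Henstock_Kurzweil_Integration.integral_combine hint) auto
    moreover have "norm (integral {s..t} (F n)) \<le> integral {s..t} h"
      using that bd by (intro integral_norm_bound_integral Fint hint) (auto simp: F_def)
    ultimately show ?thesis unfolding X_def H_def by (smt (verit) add_diff_cancel_left' add_diff_cancel_left)
  qed
  have grid0: "grid n 0 = a" for n by (simp add: grid_def)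
  have grid_mono: "grid n i < grid n (Suc i)" for n i
    unfolding grid_def using ab by (simp add: divide_strict_right_mono)
  have grid_le: "grid n i \<le> b" if "i \<le> Suc n" for n i
  proof -
    have "(b - a) * real i / real (Suc n) \<le> (b - a) * 1"
      using that ab by (simp add: divide_le_eq del: of_nat_Suc)
    then show ?thesis unfolding grid_def by simp
  qed
  have grid_ge: "a \<le> grid n i" for n i unfolding grid_def using ab by simp
  have idx_eq: "idx n s = i" if "grid n i \<le> s" "s < grid n (Suc i)" for n s i
  proof -
    have "real i \<le> (s - a) * real (Suc n) / (b - a)" "(s - a) * real (Suc n) / (b - a) < real i + 1"
      using that ab unfolding grid_def by (simp_all add: field_simps)
    then have "\<lfloor>(s - a) * real (Suc n) / (b - a)\<rfloor> = int i" by (simp add: floor_eq_iff)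
    then show ?thesis by (simp add: idx_def)
  qed
  have idx_le: "grid n (idx n s) \<le> s" "s - (b - a) / real (Suc n) \<le> grid n (idx n s)"
    if "a \<le> s" for n s
  proof -
    define q where "q = (s - a) * real (Suc n) / (b - a)"
    have "q \<ge> 0" using that ab by (simp add: q_def)
    then have "real (idx n s) \<le> q" "q - 1 \<le> real (idx n s)"
      unfolding idx_def q_def[symmetric] by linarith+
    then have "(b - a) * real (idx n s) \<le> (b - a) * q" "(b - a) * (q - 1) \<le> (b - a) * real (idx n s)"
      using ab by simp_all
    moreover have "(b - a) * q = (s - a) * real (Suc n)" using ab by (simp add: q_def)
    ultimately have "(b - a) * real (idx n s) / real (Suc n) \<le> (s - a) * real (Suc n) / real (Suc n)"
      "((s - a) * real (Suc n) - (b - a)) / real (Suc n) \<le> (b - a) * real (idx n s) / real (Suc n)"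
      by (simp_all add: divide_right_mono algebra_simps del: of_nat_Suc)
    then show "grid n (idx n s) \<le> s" "s - (b - a) / real (Suc n) \<le> grid n (idx n s)"
      unfolding grid_def by (simp_all add: diff_divide_distrib del: of_nat_Suc)
  qed
  have idx_le_n: "idx n s \<le> Suc n" if "a \<le> s" "s \<le> b" for n s
  proof -
    have "(s - a) * real (Suc n) / (b - a) \<le> 1 * real (Suc n)"
      using that ab by (simp add: divide_le_eq del: of_nat_Suc)
    then have "\<lfloor>(s - a) * real (Suc n) / (b - a)\<rfloor> \<le> \<lfloor>real (Suc n)\<rfloor>" by (intro floor_mono) simp
    then show ?thesis unfolding idx_def floor_of_nat by (simp only: nat_le_iff)
  qed
  have XY: "X n (grid n i) = Y n i" if "i \<le> Suc n" for n i
    using that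
  proof (induction i)
    case 0 then show ?case by (simp add: X_def Y_def grid0)
  next
    case (Suc i)
    \<comment> \<open>At the right end of the cell the index has already jumped to
      \<open>Suc i\<close>; this one point is discarded as negligible.\<close>
    have "integral {grid n i..grid n (Suc i)} (F n) = integral {grid n i..grid n (Suc i)} (\<lambda>s. f s (Y n i))"
      by (rule integral_spike[of "{grid n (Suc i)}"]) (auto simp: F_def idx_eq)
    moreover have "integral {a..grid n i} (F n) + integral {grid n i..grid n (Suc i)} (F n) =
        integral {a..grid n (Suc i)} (F n)"
      using grid_ge grid_mono[of n i] grid_le[OF Suc.prems]
      by (intro Henstock_Kurzweil_Integration.integral_combine Fint) (auto intro: less_imp_le)
    moreover have "Y n (Suc i) = Y n i + integral {grid n i..grid n (Suc i)} (\<lambda>s. f s (Y n i))"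
      by (simp add: Y_def)
    moreover have "Y n i = y0 + integral {a..grid n i} (F n)"
      using Suc by (simp add: X_def)
    ultimately show ?case unfolding X_def by (metis add.assoc)
  qed
  have Hcont: "continuous_on {a..b} H"
    unfolding H_def by (rule indefinite_integral_continuous_1[OF h])
  have Hdist: "norm (X n s - X n t) \<le> \<bar>H s - H t\<bar>" if "s \<in> {a..b}" "t \<in> {a..b}" for n s t
    using Xinc[of s t n] Xinc[of t s n] that by (cases "s \<le> t") (auto simp: norm_minus_commute)
  obtain y k where yk: "continuous_on {a..b} y" "strict_mono (k :: nat \<Rightarrow> nat)"
    "\<And>e. 0 < e \<Longrightarrow> \<exists>N. \<forall>n x. n \<ge> N \<and> x \<in> {a..b} \<longrightarrow> norm (X (k n) x - y x) < e"
  proof (rule Arzela_Ascoli[of "{a..b}" X "norm y0 + H b"])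
    show "norm (X n x) \<le> norm y0 + H b" if "x \<in> {a..b}" for n x
    proof -
      have "norm (X n x) \<le> norm y0 + norm (X n x - X n a)"
        by (simp add: X_def norm_triangle_ineq)
      moreover have "norm (X n x - X n a) \<le> H x - H a" "0 \<le> H b - H x"
        using Xinc[of a x n] order_trans[OF norm_ge_zero Xinc[of x b n]] that by auto
      ultimately show ?thesis by (simp add: H_def)
    qed
    show "\<exists>d. 0 < d \<and> (\<forall>n y. y \<in> {a..b} \<and> norm (x - y) < d \<longrightarrow> norm (X n x - X n y) < e)"
      if x: "x \<in> {a..b}" "0 < e" for x e
    proof -
      obtain d where d: "d > 0" "\<forall>y\<in>{a..b}. dist y x < d \<longrightarrow> dist (H y) (H x) < e"
        using Hcont[unfolded continuous_on_iff, rule_format, OF x] by blast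
      have "norm (X n x - X n y) < e" if y: "y \<in> {a..b}" "norm (x - y) < d" for n y
      proof -
        have "dist (H y) (H x) < e" using d(2) y by (simp add: dist_norm norm_minus_commute)
        then show ?thesis using Hdist[OF x(1) y(1), of n] by (simp add: dist_real_def)
      qed
      then show ?thesis using d(1) by blast
    qed
  qed auto
  have Xlim: "(\<lambda>n. X (k n) s) \<longlonglongrightarrow> y s" if "s \<in> {a..b}" for s
    using yk(3) that unfolding LIMSEQ_iff by meson
  have Flim: "(\<lambda>n. F (k n) s) \<longlonglongrightarrow> f s (y s)" if s: "s \<in> {a..b}" for s
  proof -
    define \<tau> where "\<tau> n = grid (k n) (idx (k n) s)" for n
    have \<tau>: "\<tau> n \<in> {a..b}" for n
      unfolding \<tau>_def using s idx_le_n grid_le grid_ge by auto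
    have "(\<lambda>n. (b - a) * inverse (real (Suc n))) \<longlonglongrightarrow> (b - a) * 0"
      by (intro tendsto_mult tendsto_const LIMSEQ_inverse_real_of_nat)
    from tendsto_diff[OF tendsto_const[of s] LIMSEQ_subseq_LIMSEQ[OF this yk(2)]]
    have "(\<lambda>n. s - (b - a) / real (Suc (k n))) \<longlonglongrightarrow> s" by (simp add: o_def divide_inverse)
    note lower = this
    have "\<tau> \<longlonglongrightarrow> s"
    proof (rule real_tendsto_sandwich[OF _ _ lower tendsto_const])
      show "\<forall>\<^sub>F n in sequentially. s - (b - a) / real (Suc (k n)) \<le> \<tau> n"
        "\<forall>\<^sub>F n in sequentially. \<tau> n \<le> s"
        using idx_le[of s] s unfolding \<tau>_def by (intro always_eventually allI; simp)+
    qed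
    then have "(\<lambda>n. H (\<tau> n)) \<longlonglongrightarrow> H s"
      by (rule continuous_on_tendsto_compose[OF Hcont _ s]) (use \<tau> in auto)
    then have "(\<lambda>n. \<bar>H (\<tau> n) - H s\<bar>) \<longlonglongrightarrow> 0"
      by (intro tendsto_rabs_zero LIM_zero)
    then have "(\<lambda>n. X (k n) (\<tau> n) - X (k n) s) \<longlonglongrightarrow> 0"
      by (rule Lim_null_comparison[OF always_eventually, rotated]) (intro allI Hdist[OF \<tau> s])
    from tendsto_add[OF this Xlim[OF s]] have "(\<lambda>n. X (k n) (\<tau> n)) \<longlonglongrightarrow> y s" by simp
    moreover have "X (k n) (\<tau> n) = Y (k n) (idx (k n) s)" for n
      unfolding \<tau>_def using s by (intro XY idx_le_n) auto
    ultimately show ?thesis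
      unfolding F_def by (intro continuous_on_tendsto_compose[OF cont]) auto
  qed
  have conv: "(\<lambda>s. f s (y s)) integrable_on {a..t}"
    "(\<lambda>n. integral {a..t} (F (k n))) \<longlonglongrightarrow> integral {a..t} (\<lambda>s. f s (y s))" if "t \<in> {a..b}" for t
  proof -
    have 1: "F (k n) integrable_on {a..t}" for n using that by (intro Fint) auto
    have 2: "h integrable_on {a..t}" using that by (intro hint) auto
    have 3: "norm (F (k n) x) \<le> h x" for n x unfolding F_def by (rule bd)
    have 4: "(\<lambda>n. F (k n) s) \<longlonglongrightarrow> f s (y s)" if "s \<in> {a..t}" for s
      using that \<open>t \<in> {a..b}\<close> by (intro Flim) auto
    show "(\<lambda>s. f s (y s)) integrable_on {a..t}"
      by (rule dominated_convergence(1)[OF 1 2 3 4])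
    show "(\<lambda>n. integral {a..t} (F (k n))) \<longlonglongrightarrow> integral {a..t} (\<lambda>s. f s (y s))"
      by (rule dominated_convergence(2)[OF 1 2 3 4])
  qed
  show thesis
  proof
    show "continuous_on {a..b} y" by (rule yk)
    show "(\<lambda>t. f t (y t)) integrable_on {a..b}" using conv(1)[of b] ab by auto
    fix t assume t: "t \<in> {a..b}"
    from tendsto_add[OF tendsto_const[of y0] conv(2)[OF t]]
    have "(\<lambda>n. X (k n) t) \<longlonglongrightarrow> y0 + integral {a..t} (\<lambda>s. f s (y s))" unfolding X_def .
    with Xlim[OF t] show "y t = y0 + integral {a..t} (\<lambda>s. f s (y s))" by (rule LIMSEQ_unique)
  qed
qed

text \<open>Composing the field with the nearest-point projection onto the ball, and setting it to
  \<open>0\<close> at exceptional times, gives a field on the whole space that is good at every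
  time. Its solution moves by at most the integral of \<open>h\<close>, hence by at most
  \<open>r\<close>; so it never leaves the ball, and the projection acts as the identity along
  it.\<close>

lemma caratheodory_existence_cball:
  fixes f :: "real \<Rightarrow> 'e::euclidean_space \<Rightarrow> 'e" and h :: "real \<Rightarrow> real"
  assumes ab: "a < b" and r: "0 \<le> r"
    and meas: "\<And>y. y \<in> cball y0 r \<Longrightarrow> (\<lambda>t. f t y) \<in> borel_measurable lebesgue"
    and cont: "AE t in lebesgue. t \<in> {a..b} \<longrightarrow> continuous_on (cball y0 r) (f t)"
    and bd: "AE t in lebesgue. t \<in> {a..b} \<longrightarrow> (\<forall>y\<in>cball y0 r. norm (f t y) \<le> h t)"
    and h: "h integrable_on {a..b}" "integral {a..b} h \<le> r"
  obtains y where "continuous_on {a..b} y" "(\<lambda>t. f t (y t)) integrable_on {a..b}"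
    "\<And>t. t \<in> {a..b} \<Longrightarrow> y t \<in> cball y0 r"
    "\<And>t. t \<in> {a..b} \<Longrightarrow> y t = y0 + integral {a..t} (\<lambda>s. f s (y s))"
proof -
  define G where "G = {t. (t \<in> {a..b} \<longrightarrow> continuous_on (cball y0 r) (f t)) \<and>
    (t \<in> {a..b} \<longrightarrow> (\<forall>y\<in>cball y0 r. norm (f t y) \<le> h t))}"
  have "AE t in lebesgue. t \<in> G" using cont bd by eventually_elim (auto simp: G_def)
  then have null: "- G \<in> null_sets lebesgue"
    by (simp add: completion.AE_iff_null_sets Compl_eq)
  then have neg: "negligible (- G)" by (simp add: negligible_iff_null_sets)
  \<comment> \<open>No measurability of \<open>G\<close> is known beforehand; it follows from
    completeness of Lebesgue measure, the complement being null.\<close>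
  have GS: "G \<inter> {a..b} \<in> sets lebesgue"
    using null_setsD2[OF null] by (metis Compl_in_sets_lebesgue double_complement lebesgue_closedin
      sets.Int sets_completionI_sets atLeastAtMost_borel sets_lborel)
  define P where "P = closest_point (cball y0 r)"
  have P: "P y \<in> cball y0 r" for y unfolding P_def using r by (intro closest_point_in_set) auto
  have Pid: "P y = y" if "y \<in> cball y0 r" for y unfolding P_def using that by (rule closest_point_self)
  have Pcont: "continuous_on UNIV P" unfolding P_def using r by (intro continuous_on_closest_point) auto
  define f' where "f' t y = (if t \<in> G \<inter> {a..b} then f t (P y) else 0)" for t y
  define h' where "h' t = (if t \<in> G \<inter> {a..b} then h t else 0)" for t
  have spike: "integral {s..t} h' = integral {s..t} h" if "a \<le> s" "t \<le> b" for s t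
    by (rule integral_spike[OF neg]) (use that in \<open>auto simp: h'_def\<close>)
  obtain y where y: "continuous_on {a..b} y" "(\<lambda>t. f' t (y t)) integrable_on {a..b}"
    "\<And>t. t \<in> {a..b} \<Longrightarrow> y t = y0 + integral {a..t} (\<lambda>s. f' s (y s))"
  proof (rule caratheodory_existence_bounded[OF ab, of f' h'])
    show "(\<lambda>t. f' t y) \<in> borel_measurable lebesgue" for y
      unfolding f'_def using GS meas[OF P] by (intro measurable_If_set) auto
    show "continuous_on UNIV (f' t)" for t
    proof (cases "t \<in> G \<inter> {a..b}")
      case True
      then have "continuous_on (cball y0 r) (f t)" by (auto simp: G_def)
      then have "continuous_on UNIV (f t \<circ> P)"
        using P by (intro continuous_on_compose Pcont) (auto elim: continuous_on_subset)
      then show ?thesis using True by (simp add: f'_def o_def cong: if_cong)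
    next
      case False
      then have "f' t = (\<lambda>y. 0)" by (auto simp: f'_def)
      then show ?thesis by simp
    qed
    show "norm (f' t y) \<le> h' t" for t y using P by (auto simp: f'_def h'_def G_def)
    show "h' integrable_on {a..b}" by (rule integrable_spike[OF h(1) neg]) (auto simp: h'_def)
  qed blast
  have h'int: "h' integrable_on {a..b}" by (rule integrable_spike[OF h(1) neg]) (auto simp: h'_def)
  have h'0: "0 \<le> h' t" and f'h': "norm (f' t u) \<le> h' t" for t u
  proof -
    show "norm (f' t u) \<le> h' t" for u using P by (auto simp: f'_def h'_def G_def)
    then show "0 \<le> h' t" using order_trans norm_ge_zero by blast
  qed
  have yball: "y t \<in> cball y0 r" if t: "t \<in> {a..b}" for t
  proof -
    have sub: "g integrable_on {a..t}" if "g integrable_on {a..b}" for g :: "real \<Rightarrow> 'b::euclidean_space"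
      using that t by (meson atLeastatMost_subset_iff atLeastAtMost_iff order_refl integrable_on_subinterval)
    have "norm (integral {a..t} (\<lambda>s. f' s (y s))) \<le> integral {a..t} h'"
      using f'h' by (intro integral_norm_bound_integral sub y h'int) auto
    also have "\<dots> \<le> integral {a..b} h'"
      using t h'0 h'int sub[OF h'int] by (intro integral_subset_le) auto
    also have "\<dots> \<le> r" using spike[of a b] h by simp
    finally show ?thesis using y(3)[OF t] by (simp add: dist_norm)
  qed
  have Py: "P (y t) = y t" if "t \<in> {a..b}" for t by (rule Pid[OF yball[OF that]])
  show thesis
  proof (rule that[of y])
    show "(\<lambda>t. f t (y t)) integrable_on {a..b}"
      by (rule integrable_spike[OF y(2) neg]) (auto simp: f'_def Py)
    show "y t = y0 + integral {a..t} (\<lambda>s. f s (y s))" if "t \<in> {a..b}" for t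
      unfolding y(3)[OF that]
      by (intro arg_cong[of _ _ "(+) y0"] integral_spike[OF neg]) (use that in \<open>auto simp: f'_def Py\<close>)
  qed (use y yball in auto)
qed

section \<open>Charts, tangent vectors and velocities\<close>

locale smooth_manifold =
  fixes A :: "('m::{t2_space, second_countable_topology}, 'e::euclidean_space) chart set"
  assumes smooth_structure: "smooth_structure A"
begin

lemma charts_atD: "c \<in> charts_at A p \<Longrightarrow> c \<in> A" "c \<in> charts_at A p \<Longrightarrow> p \<in> fst c"
  by (auto simp: charts_at_def)

lemma charts_atI: "c \<in> A \<Longrightarrow> p \<in> fst c \<Longrightarrow> c \<in> charts_at A p"
  by (auto simp: charts_at_def)

lemma ex_chart_at: obtains c where "c \<in> charts_at A p"
  using smooth_structure unfolding smooth_structure_def charts_at_def by blast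

context
  fixes c assumes c: "c \<in> A"
begin

lemma open_chart_domain: "open (fst c)" and open_chart_image: "open (snd c ` fst c)"
  and chart_homeomorphism: "homeomorphism (fst c) (snd c ` fst c) (snd c) (chart_inv c)"
  using smooth_structure c unfolding smooth_structure_def is_chart_def by auto

lemma chart_inv_chart [simp]: "p \<in> fst c \<Longrightarrow> chart_inv c (snd c p) = p"
  using chart_homeomorphism by (auto simp: homeomorphism_def)

lemma chart_chart_inv [simp]: "y \<in> snd c ` fst c \<Longrightarrow> snd c (chart_inv c y) = y"
  and chart_inv_in_domain: "y \<in> snd c ` fst c \<Longrightarrow> chart_inv c y \<in> fst c"
  using chart_homeomorphism by (auto simp: homeomorphism_def)

lemma continuous_on_chart: "continuous_on (fst c) (snd c)"
  and continuous_on_chart_inv: "continuous_on (snd c ` fst c) (chart_inv c)"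
  using chart_homeomorphism by (auto simp: homeomorphism_def)

lemma open_chart_image_of: "open U \<Longrightarrow> open (snd c ` (fst c \<inter> U))"
  using homeomorphism_imp_open_map[OF chart_homeomorphism, of "fst c \<inter> U"]
  by (metis Int_commute openin_open_Int openin_open_eq open_chart_image)

lemma open_chart_vimage: "open V \<Longrightarrow> open {p \<in> fst c. snd c p \<in> V}"
  using continuous_on_open_vimage[OF open_chart_domain, of "snd c"] continuous_on_chart
  by (auto simp: vimage_def Int_def conj_commute)

lemma chart_vimage_eq: "V \<subseteq> snd c ` fst c \<Longrightarrow> {p \<in> fst c. snd c p \<in> V} = chart_inv c ` V"
  by (auto simp: chart_inv_in_domain subset_iff) (metis chart_inv_chart image_eqI)

lemma compact_chart_vimage:
  assumes "compact K" "K \<subseteq> snd c ` fst c" shows "compact {p \<in> fst c. snd c p \<in> K}"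
  unfolding chart_vimage_eq[OF assms(2)]
  using assms by (intro compact_continuous_image continuous_on_subset[OF continuous_on_chart_inv])

lemma chart_ball:
  assumes "p \<in> fst c" "open U" "p \<in> U"
  obtains r where "r > 0" "cball (snd c p) r \<subseteq> snd c ` (fst c \<inter> U)"
proof -
  have "snd c p \<in> snd c ` (fst c \<inter> U)" using assms by blast
  then show ?thesis
    using that open_chart_image_of[OF assms(2)] unfolding open_contains_cball by blast
qed

end

section \<open>Coordinate changes and their differentials\<close>

lemma smoothly_compatible_charts:
  "c \<in> A \<Longrightarrow> c' \<in> A \<Longrightarrow> smooth_on (transition c c') (snd c ` (fst c \<inter> fst c'))"
  using smooth_structure unfolding smooth_structure_def smoothly_compatible_def by blast

abbreviation tmap where "tmap c c' p \<equiv> frechet_derivative (transition c c') (at (snd c p))"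

lemma tmap_has_derivative:
  assumes "c \<in> charts_at A p" "c' \<in> charts_at A p"
  shows "(transition c c' has_derivative tmap c c' p) (at (snd c p))"
proof -
  have "Ck_on (Suc 0) (transition c c') (snd c ` (fst c \<inter> fst c'))"
    using smoothly_compatible_charts[of c c'] assms unfolding smooth_on_def charts_at_def by blast
  then have "transition c c' differentiable (at (snd c p))"
    using assms by (auto simp: charts_at_def)
  then show ?thesis by (simp add: frechet_derivative_works)
qed

lemma linear_tmap: "c \<in> charts_at A p \<Longrightarrow> c' \<in> charts_at A p \<Longrightarrow> linear (tmap c c' p)"
  using tmap_has_derivative has_derivative_linear by blast

lemma continuous_on_tmap:
  assumes "c \<in> A" "c' \<in> A"
  shows "continuous_on (snd c ` (fst c \<inter> fst c')) (\<lambda>y. frechet_derivative (transition c c') (at y) v)"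
proof -
  have "Ck_on (Suc 0) (transition c c') (snd c ` (fst c \<inter> fst c'))"
    using smoothly_compatible_charts[of c c'] assms unfolding smooth_on_def by blast
  then show ?thesis by simp
qed

lemma transition_chart: "c \<in> A \<Longrightarrow> p \<in> fst c \<Longrightarrow> transition c c' (snd c p) = snd c' p"
  by (simp add: transition_def)

text \<open>The chain rule. The composite agrees with \<open>transition c c''\<close> on the image
  of the overlap of \<open>c\<close> and \<open>c'\<close>, an open set about
  \<open>snd c p\<close>, and this determines the derivative.\<close>

lemma tmap_cocycle:
  assumes "c \<in> charts_at A p" "c' \<in> charts_at A p" "c'' \<in> charts_at A p"
  shows "tmap c c'' p \<xi> = tmap c' c'' p (tmap c c' p \<xi>)"
proof -
  have c: "c \<in> A" "c' \<in> A" "p \<in> fst c" "p \<in> fst c'" using assms by (auto dest: charts_atD)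
  have p: "transition c c' (snd c p) = snd c' p" using c by (simp add: transition_chart)
  have "(transition c' c'' \<circ> transition c c' has_derivative tmap c' c'' p \<circ> tmap c c' p) (at (snd c p))"
    using diff_chain_at[OF tmap_has_derivative[OF assms(1,2)]] tmap_has_derivative[OF assms(2,3)] p by simp
  then have "(transition c c'' has_derivative tmap c' c'' p \<circ> tmap c c' p) (at (snd c p))"
  proof (rule has_derivative_transform_within_open)
    show "open (snd c ` (fst c \<inter> fst c'))" using c by (intro open_chart_image_of open_chart_domain)
    show "snd c p \<in> snd c ` (fst c \<inter> fst c')" using c by blast
    fix y assume "y \<in> snd c ` (fst c \<inter> fst c')"
    then obtain q where "y = snd c q" "q \<in> fst c" "q \<in> fst c'" by blast
    then show "(transition c' c'' \<circ> transition c c') y = transition c c'' y"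
      using c by (simp add: transition_def)
  qed
  from has_derivative_unique[OF tmap_has_derivative[OF assms(1,3)] this] show ?thesis by simp
qed

lemma tmap_same:
  assumes "c \<in> charts_at A p" shows "tmap c c p \<xi> = \<xi>"
proof -
  have c: "c \<in> A" "p \<in> fst c" using assms charts_atD by auto
  have "((\<lambda>y. y) has_derivative (\<lambda>h. h)) (at (snd c p))" by (rule has_derivative_ident)
  then have "(transition c c has_derivative (\<lambda>h. h)) (at (snd c p))"
    by (rule has_derivative_transform_within_open[OF _ open_chart_image[OF c(1)]])
      (use c in \<open>auto simp: transition_def\<close>)
  from has_derivative_unique[OF tmap_has_derivative[OF assms assms] this] show ?thesis by metis
qed

section \<open>Tangent vectors and velocities in coordinates\<close>

lemma coord_vector_self: "c \<in> charts_at A p \<Longrightarrow> coord_vector A c p \<xi> c = \<xi>"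
  by (simp add: coord_vector_def tmap_same)

lemma coord_vector_in_tangent_space: "c \<in> charts_at A p \<Longrightarrow> coord_vector A c p \<xi> \<in> tangent_space A p"
  by (auto simp: tangent_space_def coord_vector_def intro: tmap_cocycle)

lemma tangent_spaceD:
  assumes "v \<in> tangent_space A p"
  shows "c \<in> charts_at A p \<Longrightarrow> c' \<in> charts_at A p \<Longrightarrow> v c' = tmap c c' p (v c)"
    and "c \<notin> charts_at A p \<Longrightarrow> v c = 0"
  using assms unfolding tangent_space_def by blast+

lemma coord_vector_tangent:
  assumes "c \<in> charts_at A p" "v \<in> tangent_space A p" shows "coord_vector A c p (v c) = v"
proof
  show "coord_vector A c p (v c) c' = v c'" for c'
    using tangent_spaceD(1)[OF assms(2,1), of c'] tangent_spaceD(2)[OF assms(2), of c']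
    unfolding coord_vector_def by (metis (full_types))
qed

lemma coord_vector_linear:
  assumes "c \<in> charts_at A p"
  shows "coord_vector A c p (r *\<^sub>R \<xi> + s *\<^sub>R \<eta>)
    = (\<lambda>c'. r *\<^sub>R coord_vector A c p \<xi> c' + s *\<^sub>R coord_vector A c p \<eta> c')"
  using linear_tmap[OF assms] by (auto simp: coord_vector_def fun_eq_iff linear_add linear_scale)

lemma tangent_space_scale:
  assumes "v \<in> tangent_space A p" shows "(\<lambda>c. r *\<^sub>R v c) \<in> tangent_space A p"
  unfolding tangent_space_def
proof (intro CollectI conjI ballI allI impI)
  fix c c' assume c: "c \<in> charts_at A p" "c' \<in> charts_at A p"
  show "r *\<^sub>R v c' = tmap c c' p (r *\<^sub>R v c)"
    unfolding linear_scale[OF linear_tmap[OF c]] tangent_spaceD(1)[OF assms c, symmetric] ..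
qed (simp add: tangent_spaceD(2)[OF assms])

text \<open>The chain rule again. Since \<open>snd c\<close> is arbitrary off its domain, it is
  continuity of \<open>\<gamma>\<close> that keeps the curve in the chart near \<open>t\<close>,
  where the two coordinate curves are related by the transition. The set \<open>S\<close> admits
  one-sided derivatives.\<close>

lemma chart_change_derivative:
  assumes c: "c \<in> charts_at A (\<gamma> t)" "c' \<in> charts_at A (\<gamma> t)"
    and t: "t \<in> S" and cont: "continuous (at t within S) \<gamma>"
    and der: "((snd c \<circ> \<gamma>) has_vector_derivative \<xi>) (at t within S)"
  shows "((snd c' \<circ> \<gamma>) has_vector_derivative coord_vector A c (\<gamma> t) \<xi> c') (at t within S)"
proof -
  have "((transition c c' \<circ> (snd c \<circ> \<gamma>)) has_vector_derivative tmap c c' (\<gamma> t) \<xi>) (at t within S)"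
    by (rule vector_derivative_diff_chain_within[OF der])
      (use tmap_has_derivative[OF c] in \<open>auto intro: has_derivative_at_withinI\<close>)
  moreover have "\<forall>\<^sub>F s in at t within S. \<gamma> s \<in> fst c"
    using cont c open_chart_domain[of c] unfolding continuous_within
    by (auto simp: charts_at_def dest: topological_tendstoD)
  then have "\<forall>\<^sub>F s in at t within S. (transition c c' \<circ> (snd c \<circ> \<gamma>)) s = (snd c' \<circ> \<gamma>) s"
    by eventually_elim (use c in \<open>simp add: transition_chart charts_at_def\<close>)
  ultimately show ?thesis
    unfolding has_vector_derivative_def using c t
    by (auto simp: coord_vector_def transition_chart charts_at_def
        elim!: has_derivative_transform_eventually)
qed

text \<open>Chart independence: the existential chart in \<open>has_velocity\<close> may be
  exchanged for any chart about \<open>x t\<close>, once \<open>x\<close> is known to be continuous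
  at \<open>t\<close>.\<close>

lemma has_velocity_iff_chart:
  assumes "isCont x t" "c \<in> charts_at A (x t)"
  shows "has_velocity A x t v \<longleftrightarrow>
    ((snd c \<circ> x) has_vector_derivative v c) (at t) \<and> v \<in> tangent_space A (x t)"
proof
  assume "has_velocity A x t v"
  then obtain c' \<xi> where "c' \<in> charts_at A (x t)" "((snd c' \<circ> x) has_vector_derivative \<xi>) (at t)"
    "v = coord_vector A c' (x t) \<xi>" unfolding has_velocity_def by blast
  then show "((snd c \<circ> x) has_vector_derivative v c) (at t) \<and> v \<in> tangent_space A (x t)"
    using chart_change_derivative[of c' x t c UNIV \<xi>] assms coord_vector_in_tangent_space by auto
next
  assume "((snd c \<circ> x) has_vector_derivative v c) (at t) \<and> v \<in> tangent_space A (x t)"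
  then show "has_velocity A x t v"
    unfolding has_velocity_def using assms coord_vector_tangent by metis
qed

lemma has_velocity_unique:
  assumes "isCont x t" "has_velocity A x t v" "has_velocity A x t w" shows "v = w"
proof -
  obtain c where c: "c \<in> charts_at A (x t)" by (rule ex_chart_at)
  have "v c = w c" using assms has_velocity_iff_chart[OF assms(1) c] vector_derivative_unique_at by blast
  then show ?thesis
    using assms has_velocity_iff_chart[OF assms(1) c] coord_vector_tangent[OF c] by metis
qed

lemma velocity_eq: "isCont x t \<Longrightarrow> has_velocity A x t v \<Longrightarrow> velocity A x t = v"
  unfolding velocity_def by (rule some_equality) (auto dest: has_velocity_unique)

lemma has_velocity_transform:
  assumes "has_velocity A x t v" "open S" "t \<in> S" "\<And>s. s \<in> S \<Longrightarrow> y s = x s"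
  shows "has_velocity A y t v"
proof -
  obtain c \<xi> where c: "c \<in> charts_at A (x t)" "((snd c \<circ> x) has_vector_derivative \<xi>) (at t)"
    "v = coord_vector A c (x t) \<xi>" using assms(1) unfolding has_velocity_def by blast
  have "((snd c \<circ> y) has_vector_derivative \<xi>) (at t)"
    using has_vector_derivative_transform_within_open[OF c(2) assms(2,3)] assms(4) by auto
  then show ?thesis unfolding has_velocity_def using c assms by auto
qed

lemma has_velocity_affine:
  assumes "has_velocity A x (m * t + k) v"
  shows "has_velocity A (\<lambda>s. x (m * s + k)) t (\<lambda>c. m *\<^sub>R v c)"
proof -
  let ?x = "\<lambda>s. x (m * s + k)"
  obtain c \<xi> where c: "c \<in> charts_at A (?x t)" "((snd c \<circ> x) has_vector_derivative \<xi>) (at (m * t + k))"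
    "v = coord_vector A c (?x t) \<xi>" using assms(1) unfolding has_velocity_def by blast
  have "((\<lambda>s. m * s + k) has_vector_derivative m) (at t)"
    by (auto intro!: derivative_eq_intros simp flip: has_real_derivative_iff_has_vector_derivative)
  from vector_diff_chain_at[OF this c(2)]
  have "((snd c \<circ> ?x) has_vector_derivative m *\<^sub>R \<xi>) (at t)" by (simp add: o_def)
  moreover have "(\<lambda>c. m *\<^sub>R v c) = coord_vector A c (?x t) (m *\<^sub>R \<xi>)"
    using coord_vector_linear[OF c(1), of m \<xi> 0 0] c(3) by simp
  ultimately show ?thesis unfolding has_velocity_def using c(1) by auto
qed

end

section \<open>Riemannian metrics in charts\<close>

text \<open>Finite exceptional sets are needed because the velocity of a piecewise smooth curve is arbitrary at
  the nodes, where even its \<^const>\<open>tnorm\<close> may be negative (\<^const>\<open>sqrt\<close> is odd).\<close>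

lemma integral_nonneg_off_finite:
  fixes f :: "real \<Rightarrow> real"
  assumes "finite P" "\<And>t. t \<in> {a<..<b} - P \<Longrightarrow> 0 \<le> f t"
  shows "0 \<le> integral {a..b} f"
proof -
  have "integral {a..b} f = integral {a..b} (\<lambda>t. if t \<in> P \<union> {a, b} then 0 else f t)"
    using assms(1) by (intro integral_spike[of "P \<union> {a, b}"]) auto
  also have "\<dots> \<ge> 0"
  proof (cases "(\<lambda>t. if t \<in> P \<union> {a, b} then 0 else f t) integrable_on {a..b}")
    case True
    then show ?thesis using assms(2) by (intro integral_nonneg) auto
  qed (simp add: not_integrable_integral)
  finally show ?thesis .
qed

text \<open>Induction along the nodes: the largest node \<open>m\<close> with \<open>Q a m\<close>
  is \<open>b\<close>, for otherwise the cell from \<open>m\<close> to the next node could be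
  appended.\<close>

lemma partition_chain:
  fixes P :: "real set"
  assumes P: "finite P" "{a, b} \<subseteq> P" "P \<subseteq> {a..b}"
    and step: "\<And>s t. \<lbrakk>s \<in> P; t \<in> P; s < t; {s<..<t} \<inter> P = {}\<rbrakk> \<Longrightarrow> Q s t"
    and refl: "\<And>s. Q s s"
    and trans: "\<And>s t u. \<lbrakk>s \<le> t; t \<le> u; Q s t; Q t u\<rbrakk> \<Longrightarrow> Q s u"
  shows "Q a b"
proof -
  define m where "m = Max {t \<in> P. Q a t}"
  have m: "m \<in> P" "Q a m" and mmax: "\<And>t. t \<in> P \<Longrightarrow> Q a t \<Longrightarrow> t \<le> m"
  proof -
    have fin: "finite {t \<in> P. Q a t}" and ne: "{t \<in> P. Q a t} \<noteq> {}" using P refl by auto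
    show "m \<in> P" "Q a m" using Max_in[OF fin ne] by (auto simp: m_def)
    show "t \<le> m" if "t \<in> P" "Q a t" for t using Max_ge[OF fin, of t] that by (auto simp: m_def)
  qed
  have "m = b"
  proof (rule ccontr)
    assume "m \<noteq> b"
    then have "m < b" using m P by force
    define n where "n = Min {t \<in> P. m < t}"
    have n: "n \<in> P" "m < n" and nmin: "\<And>t. t \<in> P \<Longrightarrow> m < t \<Longrightarrow> n \<le> t"
    proof -
      have fin: "finite {t \<in> P. m < t}" and ne: "{t \<in> P. m < t} \<noteq> {}" using P \<open>m < b\<close> by auto
      show "n \<in> P" "m < n" using Min_in[OF fin ne] by (auto simp: n_def)
      show "n \<le> t" if "t \<in> P" "m < t" for t using Min_le[OF fin, of t] that by (auto simp: n_def)
    qed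
    have "{m<..<n} \<inter> P = {}" using nmin by force
    then have "Q m n" using m n by (intro step)
    then have "Q a n" using trans[of a m n] m n P by auto
    then show False using mmax[OF n(1)] n by auto
  qed
  then show ?thesis using m by simp
qed

lemma partition_cell:
  fixes P :: "real set"
  assumes P: "finite P" "{a, b} \<subseteq> P" and t: "t \<in> {a<..<b} - P"
  obtains s u where "s \<in> P" "u \<in> P" "s < t" "t < u" "{s<..<u} \<inter> P = {}"
proof -
  define s u where "s = Max {r \<in> P. r < t}" and "u = Min {r \<in> P. t < r}"
  have fin: "finite {r \<in> P. r < t}" "finite {r \<in> P. t < r}"
    and ne: "{r \<in> P. r < t} \<noteq> {}" "{r \<in> P. t < r} \<noteq> {}" using P t by auto
  have s: "s \<in> P" "s < t" using Max_in[OF fin(1) ne(1)] by (auto simp: s_def)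
  have u: "u \<in> P" "t < u" using Min_in[OF fin(2) ne(2)] by (auto simp: u_def)
  have "r \<notin> {s<..<u}" if "r \<in> P" for r
    using Max_ge[OF fin(1), of r] Min_le[OF fin(2), of r] that t unfolding s_def u_def by (cases "r < t") force+
  then show ?thesis using s u by (intro that[of s u]) auto
qed

locale riemannian_manifold = smooth_manifold A
  for A :: "('m::{t2_space, second_countable_topology}, 'e::euclidean_space) chart set" +
  fixes g :: "('m, 'e) metric_tensor"
  assumes metric: "riemannian_metric A g" and connected: "connected (UNIV :: 'm set)"
begin

text \<open>The coordinate expression of the metric as a bilinear form: on basis vectors
  \<open>i\<close>, \<open>j\<close> it is the matrix entry \<open>g_ij\<close> at
  \<open>y\<close>.\<close>

definition gram :: "('m, 'e) chart \<Rightarrow> 'e \<Rightarrow> 'e \<Rightarrow> 'e \<Rightarrow> real" where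
  "gram c y \<xi> \<eta> = g (chart_inv c y) (coord_vector A c (chart_inv c y) \<xi>) (coord_vector A c (chart_inv c y) \<eta>)"

lemma metric_commute: "u \<in> tangent_space A p \<Longrightarrow> v \<in> tangent_space A p \<Longrightarrow> g p u v = g p v u"
  using metric unfolding riemannian_metric_def by blast

lemma metric_linear:
  assumes "u \<in> tangent_space A p" "v \<in> tangent_space A p" "w \<in> tangent_space A p"
  shows "g p (\<lambda>c. r *\<^sub>R u c + s *\<^sub>R v c) w = r * g p u w + s * g p v w"
  using metric assms unfolding riemannian_metric_def by blast

lemma metric_scale:
  assumes "u \<in> tangent_space A p" "w \<in> tangent_space A p"
  shows "g p (\<lambda>c. r *\<^sub>R u c) w = r * g p u w"
  using metric_linear[OF assms(1,1,2), of r 0] by simp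

lemma metric_pos: "u \<in> tangent_space A p \<Longrightarrow> u \<noteq> (\<lambda>c. 0) \<Longrightarrow> 0 < g p u u"
  using metric unfolding riemannian_metric_def by blast

lemma metric_zero: "u \<in> tangent_space A p \<Longrightarrow> g p (\<lambda>c. 0) u = 0"
  using metric_scale[of u p u 0] by simp

lemma tnorm_nonneg: "u \<in> tangent_space A p \<Longrightarrow> 0 \<le> tnorm g p u"
  using metric_pos[of u p] metric_zero[of u p] unfolding tnorm_def by (cases "u = (\<lambda>c. 0)") auto

lemma tnorm_scale:
  assumes "u \<in> tangent_space A p" shows "tnorm g p (\<lambda>c. r *\<^sub>R u c) = \<bar>r\<bar> * tnorm g p u"
proof -
  have ru: "(\<lambda>c. r *\<^sub>R u c) \<in> tangent_space A p" by (rule tangent_space_scale[OF assms])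
  have "g p (\<lambda>c. r *\<^sub>R u c) (\<lambda>c. r *\<^sub>R u c) = r * (r * g p u u)"
    using metric_scale[OF assms ru, of r] metric_scale[OF assms assms, of r] metric_commute[OF assms ru] by simp
  then show ?thesis by (simp add: tnorm_def real_sqrt_mult flip: mult.assoc power2_eq_square)
qed

context
  fixes c assumes c: "c \<in> A"
begin

lemma chart_inv_charts_at: "y \<in> snd c ` fst c \<Longrightarrow> c \<in> charts_at A (chart_inv c y)"
  using c chart_inv_in_domain[OF c] by (intro charts_atI)

lemma linear_gram: assumes y: "y \<in> snd c ` fst c" shows "linear (\<lambda>\<xi>. gram c y \<xi> \<eta>)"
proof -
  note ch = chart_inv_charts_at[OF y]
  note cs = coord_vector_in_tangent_space[OF ch]
  have "gram c y (r *\<^sub>R \<xi> + s *\<^sub>R \<zeta>) \<eta> = r * gram c y \<xi> \<eta> + s * gram c y \<zeta> \<eta>" for r s \<xi> \<zeta>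
    unfolding gram_def coord_vector_linear[OF ch] by (rule metric_linear[OF cs cs cs])
  from this[of 1 _ 1] this[of _ _ 0 0] show ?thesis
    by (intro linearI) auto
qed

lemma gram_commute: "y \<in> snd c ` fst c \<Longrightarrow> gram c y \<xi> \<eta> = gram c y \<eta> \<xi>"
  unfolding gram_def by (intro metric_commute coord_vector_in_tangent_space chart_inv_charts_at)

lemma gram_pos:
  assumes y: "y \<in> snd c ` fst c" and "\<xi> \<noteq> 0" shows "0 < gram c y \<xi> \<xi>"
proof -
  note ch = chart_inv_charts_at[OF y]
  show ?thesis unfolding gram_def
  proof (rule metric_pos[OF coord_vector_in_tangent_space[OF ch]])
    show "coord_vector A c (chart_inv c y) \<xi> \<noteq> (\<lambda>c. 0)"
      using coord_vector_self[OF ch, of \<xi>] assms(2) by (auto dest: fun_cong[of _ _ c])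
  qed
qed

lemma gram_scale:
  assumes y: "y \<in> snd c ` fst c" shows "gram c y (r *\<^sub>R \<xi>) (r *\<^sub>R \<xi>) = r\<^sup>2 * gram c y \<xi> \<xi>"
  using linear_scale[OF linear_gram[OF y], of r \<xi>] gram_commute[OF y]
  by (simp add: power2_eq_square)

lemma gram_expand:
  assumes y: "y \<in> snd c ` fst c"
  shows "gram c y \<xi> \<xi> = (\<Sum>i\<in>Basis. \<Sum>j\<in>Basis. (\<xi> \<bullet> i) * ((\<xi> \<bullet> j) * gram c y i j))"
proof -
  have 1: "gram c y \<xi> \<eta> = (\<Sum>i\<in>Basis. (\<xi> \<bullet> i) * gram c y i \<eta>)" for \<xi> \<eta>
    using linear_sum[OF linear_gram[OF y, of \<eta>], of "\<lambda>i. (\<xi> \<bullet> i) *\<^sub>R i" Basis]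
    by (simp add: euclidean_representation linear_scale[OF linear_gram[OF y]])
  have "gram c y \<xi> \<xi> = (\<Sum>i\<in>Basis. (\<xi> \<bullet> i) * gram c y \<xi> i)"
    unfolding 1[of \<xi> \<xi>] by (intro sum.cong refl) (simp add: gram_commute[OF y])
  also have "\<dots> = (\<Sum>i\<in>Basis. \<Sum>j\<in>Basis. (\<xi> \<bullet> i) * ((\<xi> \<bullet> j) * gram c y i j))"
    unfolding 1[of \<xi>] sum_distrib_left by (simp add: gram_commute[OF y])
  finally show ?thesis .
qed

text \<open>The metric is given as smooth in the point for fixed vectors only. Joint continuity in
  point and vector follows by expanding into the finitely many matrix entries.\<close>

lemma continuous_on_gram: "continuous_on (snd c ` fst c \<times> UNIV) (\<lambda>z. gram c (fst z) (snd z) (snd z))"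
proof -
  have "Ck_on 0 (\<lambda>y. gram c y i j) (snd c ` fst c)" for i j
    using metric c unfolding riemannian_metric_def smooth_on_def gram_def by blast
  then have "continuous_on (snd c ` fst c) (\<lambda>y. gram c y i j)" for i j by simp
  then have "continuous_on (snd c ` fst c \<times> UNIV) (\<lambda>z. gram c (fst z) i j)" for i j
    by (rule continuous_on_compose2) (auto intro: continuous_intros)
  then have "continuous_on (snd c ` fst c \<times> UNIV)
      (\<lambda>z. \<Sum>i\<in>Basis. \<Sum>j\<in>Basis. (snd z \<bullet> i) * ((snd z \<bullet> j) * gram c (fst z) i j))"
    by (intro continuous_intros)
  then show ?thesis by (rule continuous_on_eq) (auto simp: gram_expand)
qed

lemma tnorm_gram:
  assumes "p \<in> fst c" "v \<in> tangent_space A p"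
  shows "tnorm g p v = sqrt (gram c (snd c p) (v c) (v c))"
  using assms c by (simp add: tnorm_def gram_def coord_vector_tangent charts_atI)

text \<open>The quadratic form of the metric is continuous and positive on the compact set
  \<open>K \<times> sphere 0 1\<close>, so it lies between two positive constants there; homogeneity
  extends this to all vectors. Square roots appear because \<open>gram\<close> is the square of the
  norm.\<close>

lemma tnorm_comparison:
  assumes "compact K" "K \<subseteq> snd c ` fst c"
  obtains \<alpha> \<beta> where "\<alpha> > 0" "\<beta> > 0"
    "\<And>p v. \<lbrakk>p \<in> fst c; snd c p \<in> K; v \<in> tangent_space A p\<rbrakk> \<Longrightarrow> \<alpha> * norm (v c) \<le> tnorm g p v"
    "\<And>p v. \<lbrakk>p \<in> fst c; snd c p \<in> K; v \<in> tangent_space A p\<rbrakk> \<Longrightarrow> tnorm g p v \<le> \<beta> * norm (v c)"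
proof (cases "K = {}")
  case True
  then show ?thesis by (intro that[of 1 1]) auto
next
  case False
  define S where "S = K \<times> sphere (0::'e) 1"
  have S: "compact S" "S \<noteq> {}" "S \<subseteq> snd c ` fst c \<times> UNIV"
    using assms False unfolding S_def by (auto intro: compact_Times)
  note cont = continuous_on_subset[OF continuous_on_gram S(3)]
  obtain z where z: "z \<in> S" "\<And>w. w \<in> S \<Longrightarrow> gram c (fst z) (snd z) (snd z) \<le> gram c (fst w) (snd w) (snd w)"
    using continuous_attains_inf[OF S(1,2) cont] by auto
  obtain z' where z': "z' \<in> S" "\<And>w. w \<in> S \<Longrightarrow> gram c (fst w) (snd w) (snd w) \<le> gram c (fst z') (snd z') (snd z')"
    using continuous_attains_sup[OF S(1,2) cont] by auto
  define \<alpha> \<beta> where "\<alpha> = gram c (fst z) (snd z) (snd z)" and "\<beta> = gram c (fst z') (snd z') (snd z')"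
  have \<alpha>: "\<alpha> > 0" using z(1) assms(2) unfolding \<alpha>_def S_def by (intro gram_pos) auto
  have \<beta>: "\<beta> > 0" using z'(1) assms(2) unfolding \<beta>_def S_def by (intro gram_pos) auto
  have bounds: "\<alpha> * (norm \<xi>)\<^sup>2 \<le> gram c y \<xi> \<xi> \<and> gram c y \<xi> \<xi> \<le> \<beta> * (norm \<xi>)\<^sup>2" if y: "y \<in> K" for y \<xi>
  proof (cases "\<xi> = 0")
    case True
    then show ?thesis using gram_scale[of y 0 \<xi>] assms(2) y by auto
  next
    case False
    define u where "u = (1 / norm \<xi>) *\<^sub>R \<xi>"
    have "(y, u) \<in> S" using y False by (auto simp: S_def u_def)
    then have "\<alpha> \<le> gram c y u u" "gram c y u u \<le> \<beta>" using z(2) z'(2) unfolding \<alpha>_def \<beta>_def by force+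
    moreover have "gram c y \<xi> \<xi> = (norm \<xi>)\<^sup>2 * gram c y u u"
      using gram_scale[of y "norm \<xi>" u] assms(2) y False by (auto simp: u_def)
    ultimately show ?thesis
      using mult_left_mono[of \<alpha> "gram c y u u" "(norm \<xi>)\<^sup>2"] mult_left_mono[of "gram c y u u" \<beta> "(norm \<xi>)\<^sup>2"]
      by (simp add: mult.commute)
  qed
  show ?thesis
  proof (rule that[of "sqrt \<alpha>" "sqrt \<beta>"])
    fix p v assume p: "p \<in> fst c" "snd c p \<in> K" "v \<in> tangent_space A p"
    have "sqrt \<alpha> * norm (v c) = sqrt (\<alpha> * (norm (v c))\<^sup>2)" "sqrt \<beta> * norm (v c) = sqrt (\<beta> * (norm (v c))\<^sup>2)"
      by (simp_all add: real_sqrt_mult)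
    then show "sqrt \<alpha> * norm (v c) \<le> tnorm g p v" "tnorm g p v \<le> sqrt \<beta> * norm (v c)"
      unfolding tnorm_gram[OF p(1,3)] using bounds[OF p(2)] by simp_all
  qed (use \<alpha> \<beta> in auto)
qed

end

abbreviation speed where "speed \<gamma> t \<equiv> tnorm g (\<gamma> t) (velocity A \<gamma> t)"

text \<open>\<open>F\<close> uses one-sided derivatives at the endpoints, where the two-sided velocity need not exist.\<close>

lemma C1_curve_on_speed:
  assumes "C1_curve_on A a b \<gamma>"
  obtains F where "continuous_on {a..b} F"
    "\<And>t. t \<in> {a<..<b} \<Longrightarrow> isCont \<gamma> t \<and> (\<exists>v. has_velocity A \<gamma> t v) \<and> speed \<gamma> t = F t"
proof (cases "a < b")
  case False
  then show ?thesis by (intro that[of "\<lambda>_. 0"]) auto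
next
  case ab: True
  have cont: "continuous_on {a..b} \<gamma>" using assms by (simp add: C1_curve_on_def)
  have "\<exists>c. c \<in> charts_at A (\<gamma> t)" for t using ex_chart_at by blast
  \<comment> \<open>A chart is chosen at each time separately, without any regularity in time. The
    fact \<open>local\<close> below shows that \<open>w\<close> does not depend on these
    choices.\<close>
  then obtain ch where ch: "\<And>t. ch t \<in> charts_at A (\<gamma> t)" by metis
  define w where "w t = coord_vector A (ch t) (\<gamma> t) (vector_derivative (snd (ch t) \<circ> \<gamma>) (at t within {a..b}))" for t
  define F where "F t = tnorm g (\<gamma> t) (w t)" for t
  have w: "w t \<in> tangent_space A (\<gamma> t)" for t
    unfolding w_def by (rule coord_vector_in_tangent_space[OF ch])
  have local: "((snd c \<circ> \<gamma>) has_vector_derivative w t c) (at t within {a..b})"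
    if c: "c \<in> charts_at A (\<gamma> t)" and t: "t \<in> {a..b}" for c t
  proof -
    obtain \<gamma>' where \<gamma>': "((snd c \<circ> \<gamma>) has_vector_derivative \<gamma>') (at t within {a..b})"
      using assms charts_atD[OF c] t unfolding C1_curve_on_def by blast
    have ct: "continuous (at t within {a..b}) \<gamma>"
      using cont t by (simp add: continuous_on_eq_continuous_within)
    define v where "v = coord_vector A c (\<gamma> t) \<gamma>'"
    have "((snd (ch t) \<circ> \<gamma>) has_vector_derivative v (ch t)) (at t within {a..b})"
      unfolding v_def by (rule chart_change_derivative[OF c ch t ct \<gamma>'])
    then have "vector_derivative (snd (ch t) \<circ> \<gamma>) (at t within {a..b}) = v (ch t)"
      using vector_derivative_within_cbox[of a b t] ab t by (auto simp: box_real)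
    then have "w t = v"
      unfolding w_def using coord_vector_tangent[OF ch coord_vector_in_tangent_space[OF c]] by (simp add: v_def)
    then show ?thesis using \<gamma>' coord_vector_self[OF c] by (simp add: v_def)
  qed
  show ?thesis
  proof (rule that[of F])
    show "continuous_on {a..b} F"
      unfolding continuous_on_eq_continuous_within
    proof
      fix t assume t: "t \<in> {a..b}"
      \<comment> \<open>Continuity at \<open>t\<close> is checked in one fixed chart, in which
        \<open>F\<close> becomes a continuous expression in \<open>gram\<close> and the one-sided
        coordinate derivative.\<close>
      define c where "c = ch t"
      have c: "c \<in> A" "\<gamma> t \<in> fst c" using charts_atD[OF ch] unfolding c_def by auto
      define U where "U = {s \<in> {a..b}. \<gamma> s \<in> fst c}"
      obtain \<gamma>' where \<gamma>': "\<And>s. s \<in> U \<Longrightarrow> ((snd c \<circ> \<gamma>) has_vector_derivative \<gamma>' s) (at s within {a..b})"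
        "continuous_on U \<gamma>'"
        using assms c(1) unfolding C1_curve_on_def U_def by blast
      have "w s c = \<gamma>' s" if "s \<in> U" for s
        using local[of c s] \<gamma>'(1)[OF that] that ab c(1)
          vector_derivative_unique_within[of s "{a..b}" "snd c \<circ> \<gamma>" "w s c" "\<gamma>' s"]
        by (auto simp: U_def trivial_limit_within islimpt_Icc charts_atI)
      then have Feq: "F s = sqrt (gram c (snd c (\<gamma> s)) (\<gamma>' s) (\<gamma>' s))" if "s \<in> U" for s
        unfolding F_def using tnorm_gram[OF c(1) _ w, of s] that by (simp add: U_def)
      have U1: "continuous_on U (snd c \<circ> \<gamma>)"
        by (intro continuous_on_compose continuous_on_subset[OF cont]
            continuous_on_subset[OF continuous_on_chart[OF c(1)]]) (auto simp: U_def)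
      have "continuous_on U (\<lambda>s. gram c (fst ((snd c \<circ> \<gamma>) s, \<gamma>' s)) (snd ((snd c \<circ> \<gamma>) s, \<gamma>' s)) (snd ((snd c \<circ> \<gamma>) s, \<gamma>' s)))"
        by (rule continuous_on_compose2[OF continuous_on_gram[OF c(1)] continuous_on_Pair[OF U1 \<gamma>'(2)]])
          (auto simp: U_def)
      then have "continuous_on U (\<lambda>s. sqrt (gram c (snd c (\<gamma> s)) (\<gamma>' s) (\<gamma>' s)))"
        by (intro continuous_on_real_sqrt) simp
      then have "continuous_on U F" by (rule continuous_on_eq) (simp add: Feq)
      moreover have "t \<in> U" using t c by (simp add: U_def)
      ultimately have "continuous (at t within U) F" by (simp add: continuous_on_eq_continuous_within)
      \<comment> \<open>By continuity of \<open>\<gamma>\<close> the set \<open>U\<close> is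
        relatively open in the interval, so restricting to it does not affect limits at
        \<open>t\<close>.\<close>
      moreover have "at t within U = at t within {a..b}"
      proof -
        obtain V where V: "open V" "V \<inter> {a..b} = \<gamma> -` fst c \<inter> {a..b}"
          using cont open_chart_domain[OF c(1)] unfolding continuous_on_open_invariant by blast
        have "t \<in> V" "U = {a..b} \<inter> V" using V(2) t c unfolding U_def by blast+
        then show ?thesis
          by (intro at_within_nhd[OF _ V(1)]) auto
      qed
      ultimately show "continuous (at t within {a..b}) F" by simp
    qed
    fix t assume t: "t \<in> {a<..<b}"
    then have ct: "isCont \<gamma> t"
      using cont by (intro continuous_on_interior[of "{a..b}"]) auto
    have "has_velocity A \<gamma> t (w t)"
      using local[OF ch, of t] t has_velocity_iff_chart[OF ct ch] w at_within_interior[of t "{a..b}"] by auto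
    then show "isCont \<gamma> t \<and> (\<exists>v. has_velocity A \<gamma> t v) \<and> speed \<gamma> t = F t"
      using ct velocity_eq[OF ct] by (auto simp: F_def)
  qed
qed

section \<open>Piecewise smooth curves and their length\<close>

lemma C1_curve_on_cong:
  assumes "C1_curve_on A a b \<gamma>" "\<And>t. t \<in> {a..b} \<Longrightarrow> \<delta> t = \<gamma> t"
  shows "C1_curve_on A a b \<delta>"
proof -
  have dom: "{t \<in> {a..b}. \<delta> t \<in> fst c} = {t \<in> {a..b}. \<gamma> t \<in> fst c}" for c :: "('m, 'e) chart"
    using assms(2) by auto
  have der: "((snd c \<circ> \<delta>) has_vector_derivative v) (at t within {a..b})"
    if "((snd c \<circ> \<gamma>) has_vector_derivative v) (at t within {a..b})" "t \<in> {a..b}"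
    for c :: "('m, 'e) chart" and v t
    using has_vector_derivative_transform[OF that(2) _ that(1), of "snd c \<circ> \<delta>"] assms(2) by auto
  show ?thesis
    unfolding C1_curve_on_def
  proof (intro conjI ballI)
    show "continuous_on {a..b} \<delta>"
      using assms by (auto simp: C1_curve_on_def elim: continuous_on_eq)
    fix c assume "c \<in> A"
    then obtain \<gamma>' where "\<And>t. t \<in> {t \<in> {a..b}. \<gamma> t \<in> fst c} \<Longrightarrow>
        ((snd c \<circ> \<gamma>) has_vector_derivative \<gamma>' t) (at t within {a..b})"
      "continuous_on {t \<in> {a..b}. \<gamma> t \<in> fst c} \<gamma>'"
      using assms(1) unfolding C1_curve_on_def by blast
    then show "\<exists>\<gamma>'. (\<forall>t\<in>{t \<in> {a..b}. \<delta> t \<in> fst c}.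
        ((snd c \<circ> \<delta>) has_vector_derivative \<gamma>' t) (at t within {a..b})) \<and>
        continuous_on {t \<in> {a..b}. \<delta> t \<in> fst c} \<gamma>'"
      unfolding dom using der by (intro exI[of _ \<gamma>']) auto
  qed
qed

lemma piecewise_C1_curve_onE:
  assumes "piecewise_C1_curve_on A a b \<gamma>"
  obtains P where "finite P" "{a, b} \<subseteq> P" "P \<subseteq> {a..b}"
    "\<forall>s\<in>P. \<forall>t\<in>P. s < t \<and> {s<..<t} \<inter> P = {} \<longrightarrow> C1_curve_on A s t \<gamma>"
  using assms unfolding piecewise_C1_curve_on_def by (elim exE conjE)

lemma piecewise_C1_curve_on_cong:
  assumes "piecewise_C1_curve_on A a b \<gamma>" "\<And>t. t \<in> {a..b} \<Longrightarrow> \<delta> t = \<gamma> t"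
  shows "piecewise_C1_curve_on A a b \<delta>"
proof -
  obtain P where P: "finite P" "{a, b} \<subseteq> P" "P \<subseteq> {a..b}"
    "\<forall>s\<in>P. \<forall>t\<in>P. s < t \<and> {s<..<t} \<inter> P = {} \<longrightarrow> C1_curve_on A s t \<gamma>"
    using assms(1) by (rule piecewise_C1_curve_onE)
  have "C1_curve_on A s t \<delta>" if "s \<in> P" "t \<in> P" "s < t" "{s<..<t} \<inter> P = {}" for s t
  proof (rule C1_curve_on_cong[OF P(4)[rule_format, OF that(1,2) conjI[OF that(3,4)]]])
    fix r assume "r \<in> {s..t}"
    then have "r \<in> {a..b}" using subsetD[OF P(3) that(1)] subsetD[OF P(3) that(2)] by auto
    then show "\<delta> r = \<gamma> r" by (rule assms(2))
  qed
  then show ?thesis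
    unfolding piecewise_C1_curve_on_def using P(1-3) by (intro exI[of _ P]) simp
qed

lemma C1_imp_piecewise_C1_curve_on:
  assumes "a < b" "C1_curve_on A a b \<gamma>" shows "piecewise_C1_curve_on A a b \<gamma>"
  unfolding piecewise_C1_curve_on_def using assms by (intro exI[of _ "{a, b}"]) auto

text \<open>As \<open>b\<close> is a node of both partitions, no cell of the union of the node sets
  straddles it, and each cell belongs to one of the two pieces.\<close>

lemma piecewise_C1_curve_on_combine:
  assumes "piecewise_C1_curve_on A a b \<gamma>" "piecewise_C1_curve_on A b c \<gamma>"
  shows "piecewise_C1_curve_on A a c \<gamma>"
proof -
  obtain P where P: "finite P" "{a, b} \<subseteq> P" "P \<subseteq> {a..b}"
    "\<forall>s\<in>P. \<forall>t\<in>P. s < t \<and> {s<..<t} \<inter> P = {} \<longrightarrow> C1_curve_on A s t \<gamma>"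
    using assms(1) by (rule piecewise_C1_curve_onE)
  obtain R where R: "finite R" "{b, c} \<subseteq> R" "R \<subseteq> {b..c}"
    "\<forall>s\<in>R. \<forall>t\<in>R. s < t \<and> {s<..<t} \<inter> R = {} \<longrightarrow> C1_curve_on A s t \<gamma>"
    using assms(2) by (rule piecewise_C1_curve_onE)
  have "C1_curve_on A s t \<gamma>" if st: "s \<in> P \<union> R" "t \<in> P \<union> R" "s < t" "{s<..<t} \<inter> (P \<union> R) = {}" for s t
  proof (cases "t \<le> b")
    case True
    have "s \<in> P" "t \<in> P" using st True P R by force+
    then show ?thesis using st by (intro P(4)[rule_format]) auto
  next
    case False
    have "b \<in> P" using P by auto
    then have "b \<le> s" using st(3,4) False by force
    then have "s \<in> R" "t \<in> R" using st False P R by force+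
    then show ?thesis using st by (intro R(4)[rule_format]) auto
  qed
  moreover have "P \<union> R \<subseteq> {a..c}" using P R by force
  ultimately show ?thesis
    unfolding piecewise_C1_curve_on_def using P R by (intro exI[of _ "P \<union> R"]) auto
qed

lemma C1_curve_on_affine:
  fixes m k :: real
  defines "T \<equiv> \<lambda>t. m * t + k"
  assumes "C1_curve_on A (min (T a) (T b)) (max (T a) (T b)) \<gamma>" "a \<le> b"
  shows "C1_curve_on A a b (\<gamma> \<circ> T)"
proof -
  let ?I = "{min (T a) (T b)..max (T a) (T b)}"
  have "T t \<in> ?I" if t: "a \<le> t" "t \<le> b" for t
  proof (cases "m \<ge> 0")
    case True
    then have "T a \<le> T t" "T t \<le> T b" using t by (auto simp: T_def mult_left_mono)
    then show ?thesis by auto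
  next
    case False
    then have "T b \<le> T t" "T t \<le> T a" using t by (auto simp: T_def mult_left_mono_neg)
    then show ?thesis by auto
  qed
  then have TI: "T ` {a..b} \<subseteq> ?I" by auto
  have Tc: "continuous_on S T" for S unfolding T_def by (intro continuous_intros)
  have Td: "(T has_vector_derivative m) (at t within S)" for t S
    unfolding T_def by (auto intro!: derivative_eq_intros simp flip: has_real_derivative_iff_has_vector_derivative)
  show ?thesis
    unfolding C1_curve_on_def
  proof (intro conjI ballI)
    show "continuous_on {a..b} (\<gamma> \<circ> T)"
      using assms(2) TI Tc by (intro continuous_on_compose) (auto simp: C1_curve_on_def elim: continuous_on_subset)
    fix c assume "c \<in> A"
    then obtain \<gamma>' where \<gamma>': "\<And>t. t \<in> ?I \<Longrightarrow> \<gamma> t \<in> fst c \<Longrightarrow> ((snd c \<circ> \<gamma>) has_vector_derivative \<gamma>' t) (at t within ?I)"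
      "continuous_on {t \<in> ?I. \<gamma> t \<in> fst c} \<gamma>'"
      using assms(2) unfolding C1_curve_on_def by (metis (no_types, lifting) mem_Collect_eq)
    show "\<exists>\<gamma>'. (\<forall>t\<in>{t \<in> {a..b}. (\<gamma> \<circ> T) t \<in> fst c}.
        ((snd c \<circ> (\<gamma> \<circ> T)) has_vector_derivative \<gamma>' t) (at t within {a..b})) \<and>
        continuous_on {t \<in> {a..b}. (\<gamma> \<circ> T) t \<in> fst c} \<gamma>'"
    proof (intro exI[of _ "\<lambda>t. m *\<^sub>R \<gamma>' (T t)"] conjI ballI)
      fix t assume t: "t \<in> {t \<in> {a..b}. (\<gamma> \<circ> T) t \<in> fst c}"
      then have "((snd c \<circ> \<gamma>) has_vector_derivative \<gamma>' (T t)) (at (T t) within T ` {a..b})"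
        by (intro has_vector_derivative_within_subset[OF \<gamma>'(1) TI] subsetD[OF TI] imageI) auto
      from vector_diff_chain_within[OF Td this]
      show "((snd c \<circ> (\<gamma> \<circ> T)) has_vector_derivative m *\<^sub>R \<gamma>' (T t)) (at t within {a..b})"
        by (simp only: o_assoc)
    next
      show "continuous_on {t \<in> {a..b}. (\<gamma> \<circ> T) t \<in> fst c} (\<lambda>t. m *\<^sub>R \<gamma>' (T t))"
        by (intro continuous_intros continuous_on_compose2[OF \<gamma>'(2) Tc]) (use TI in force)
    qed
  qed
qed

text \<open>The set equation on the endpoints covers increasing and decreasing substitutions at
  once. Decreasing ones yield the symmetry of the distance, increasing ones the concatenation of
  curves.\<close>

lemma piecewise_C1_curve_on_affine:
  fixes m k :: real
  defines "T \<equiv> \<lambda>t. m * t + k"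
  assumes m: "m \<noteq> 0" and ends: "{T a', T b'} = {a, b}" "a' \<le> b'" and \<gamma>: "piecewise_C1_curve_on A a b \<gamma>"
  shows "piecewise_C1_curve_on A a' b' (\<gamma> \<circ> T)"
proof -
  obtain P where P: "finite P" "{a, b} \<subseteq> P" "P \<subseteq> {a..b}"
    "\<forall>s\<in>P. \<forall>t\<in>P. s < t \<and> {s<..<t} \<inter> P = {} \<longrightarrow> C1_curve_on A s t \<gamma>"
    using \<gamma> by (rule piecewise_C1_curve_onE)
  have "a \<le> b" using P by auto
  have inj: "inj T" unfolding T_def using m by (auto simp: inj_def)
  have mono: "t \<in> {a'..b'}" if "T t \<in> {a..b}" for t
  proof (cases "m > 0")
    case True
    then have "T a' \<le> T b'" unfolding T_def using ends(2) by simp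
    then have "T a' = a" "T b' = b" using ends \<open>a \<le> b\<close> by (auto simp: doubleton_eq_iff)
    then show ?thesis using that True unfolding T_def by auto
  next
    case False
    then have neg: "m < 0" using m by auto
    then have "T b' \<le> T a'" unfolding T_def using ends(2) by simp
    then have "T a' = b" "T b' = a" using ends \<open>a \<le> b\<close> by (auto simp: doubleton_eq_iff)
    then show ?thesis using that neg unfolding T_def by auto
  qed
  show ?thesis
    unfolding piecewise_C1_curve_on_def
  proof (intro exI[of _ "T -` P"] conjI ballI impI)
    show "finite (T -` P)" using P(1) inj by (intro finite_vimageI)
    show "{a', b'} \<subseteq> T -` P" using ends P(2) by auto
    show "T -` P \<subseteq> {a'..b'}" using P(3) mono by auto
    fix s t assume st: "s \<in> T -` P" "t \<in> T -` P" "s < t \<and> {s<..<t} \<inter> T -` P = {}"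
    have "C1_curve_on A (min (T s) (T t)) (max (T s) (T t)) \<gamma>"
    proof (rule P(4)[rule_format, OF _ _ conjI])
      show "min (T s) (T t) \<in> P" "max (T s) (T t) \<in> P" using st by (auto simp: min_def max_def)
      have "T s \<noteq> T t" using st(3) injD[OF inj, of s t] by auto
      then show "min (T s) (T t) < max (T s) (T t)" by auto
      have inner: "u \<in> {s<..<t}" if "T u \<in> {min (T s) (T t)<..<max (T s) (T t)}" for u
        using that st(3) m unfolding T_def by (cases "m > 0") (auto simp: min_def max_def split: if_splits)
      show "{min (T s) (T t)<..<max (T s) (T t)} \<inter> P = {}"
      proof (rule equals0I)
        fix r assume r: "r \<in> {min (T s) (T t)<..<max (T s) (T t)} \<inter> P"
        have "r = T ((r - k) / m)" unfolding T_def using m by auto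
        then show False using inner[of "(r - k) / m"] r st(3) by auto
      qed
    qed
    then show "C1_curve_on A s t (\<gamma> \<circ> T)"
      unfolding T_def using st(3) by (intro C1_curve_on_affine) auto
  qed
qed

lemma piecewise_C1_curve_on_le: "piecewise_C1_curve_on A a b \<gamma> \<Longrightarrow> a \<le> b"
  unfolding piecewise_C1_curve_on_def by auto

lemma piecewise_C1_curve_on_continuous:
  assumes "piecewise_C1_curve_on A a b \<gamma>" shows "continuous_on {a..b} \<gamma>"
proof -
  obtain P where P: "finite P" "{a, b} \<subseteq> P" "P \<subseteq> {a..b}"
    "\<forall>s\<in>P. \<forall>t\<in>P. s < t \<and> {s<..<t} \<inter> P = {} \<longrightarrow> C1_curve_on A s t \<gamma>"
    using assms(1) by (rule piecewise_C1_curve_onE)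
  show ?thesis
  proof (rule partition_chain[OF P(1-3)])
    show "continuous_on {s..t} \<gamma>" if "s \<in> P" "t \<in> P" "s < t" "{s<..<t} \<inter> P = {}" for s t
      using P(4)[rule_format, OF that(1,2) conjI[OF that(3,4)]] by (simp add: C1_curve_on_def)
    show "continuous_on {s..u} \<gamma>" if "s \<le> t" "t \<le> u" "continuous_on {s..t} \<gamma>" "continuous_on {t..u} \<gamma>" for s t u
      using continuous_on_closed_Un[OF _ _ that(3,4)] that by (simp add: ivl_disj_un)
  qed simp
qed

lemma piecewise_C1_curve_on_velocity:
  assumes "piecewise_C1_curve_on A a b \<gamma>"
  obtains P where "finite P"
    "\<And>t. t \<in> {a<..<b} - P \<Longrightarrow> isCont \<gamma> t \<and> has_velocity A \<gamma> t (velocity A \<gamma> t)"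
    "\<And>t. t \<in> {a<..<b} - P \<Longrightarrow> velocity A \<gamma> t \<in> tangent_space A (\<gamma> t)"
proof -
  obtain P where P: "finite P" "{a, b} \<subseteq> P" "P \<subseteq> {a..b}"
    "\<forall>s\<in>P. \<forall>t\<in>P. s < t \<and> {s<..<t} \<inter> P = {} \<longrightarrow> C1_curve_on A s t \<gamma>"
    using assms(1) by (rule piecewise_C1_curve_onE)
  have *: "isCont \<gamma> t \<and> has_velocity A \<gamma> t (velocity A \<gamma> t)" if t: "t \<in> {a<..<b} - P" for t
  proof -
    obtain s u where su: "s \<in> P" "u \<in> P" "s < t" "t < u" "{s<..<u} \<inter> P = {}"
      by (rule partition_cell[OF P(1,2) t])
    then have "C1_curve_on A s u \<gamma>" by (intro P(4)[rule_format]) auto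
    then obtain F where "\<And>t. t \<in> {s<..<u} \<Longrightarrow> isCont \<gamma> t \<and> (\<exists>v. has_velocity A \<gamma> t v) \<and> speed \<gamma> t = F t"
      by (rule C1_curve_on_speed) blast
    then obtain v where "isCont \<gamma> t" "has_velocity A \<gamma> t v" using su by force
    then show ?thesis using velocity_eq by simp
  qed
  have "velocity A \<gamma> t \<in> tangent_space A (\<gamma> t)" if t: "t \<in> {a<..<b} - P" for t
    using *[OF t] ex_chart_at has_velocity_iff_chart by metis
  with * P(1) show ?thesis by (intro that[of P])
qed

lemma piecewise_C1_curve_on_speed_integrable:
  assumes "piecewise_C1_curve_on A a b \<gamma>" shows "speed \<gamma> absolutely_integrable_on {a..b}"
proof -
  obtain P where P: "finite P" "{a, b} \<subseteq> P" "P \<subseteq> {a..b}"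
    "\<forall>s\<in>P. \<forall>t\<in>P. s < t \<and> {s<..<t} \<inter> P = {} \<longrightarrow> C1_curve_on A s t \<gamma>"
    using assms(1) by (rule piecewise_C1_curve_onE)
  show ?thesis
  proof (rule partition_chain[OF P(1-3)])
    fix s t assume st: "s \<in> P" "t \<in> P" "s < t" "{s<..<t} \<inter> P = {}"
    from P(4)[rule_format, OF st(1,2) conjI[OF st(3,4)]] obtain F where F: "continuous_on {s..t} F" "\<And>\<tau>. \<tau> \<in> {s<..<t} \<Longrightarrow> speed \<gamma> \<tau> = F \<tau>"
      by (rule C1_curve_on_speed) blast
    show "speed \<gamma> absolutely_integrable_on {s..t}"
      by (rule absolutely_integrable_spike[OF absolutely_integrable_continuous_real[OF F(1)], of "{s, t}"])
        (use F(2) in auto)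
  next
    show "speed \<gamma> absolutely_integrable_on {s..s}" for s
      by (rule absolutely_integrable_negligible) simp
  qed (rule absolutely_integrable_on_combine)
qed

text \<open>The passage from the Lebesgue integral of the definition to the gauge integral, with
  which lengths are combined, compared and substituted.\<close>

lemma curve_length_eq_integral:
  "piecewise_C1_curve_on A a b \<gamma> \<Longrightarrow> curve_length A g a b \<gamma> = integral {a..b} (speed \<gamma>)"
  unfolding curve_length_def
  by (rule set_lebesgue_integral_eq_integral) (rule piecewise_C1_curve_on_speed_integrable)

lemma speed_integrable:
  "piecewise_C1_curve_on A a b \<gamma> \<Longrightarrow> a \<le> s \<Longrightarrow> t \<le> b \<Longrightarrow> speed \<gamma> integrable_on {s..t}"
  using piecewise_C1_curve_on_speed_integrable set_lebesgue_integral_eq_integral(1)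
  by (meson atLeastatMost_subset_iff integrable_on_subinterval)

lemma integral_speed_nonneg:
  assumes "piecewise_C1_curve_on A a b \<gamma>" "a \<le> s" "t \<le> b" shows "0 \<le> integral {s..t} (speed \<gamma>)"
proof -
  obtain P where P: "finite P" "\<And>t. t \<in> {a<..<b} - P \<Longrightarrow> velocity A \<gamma> t \<in> tangent_space A (\<gamma> t)"
    using piecewise_C1_curve_on_velocity[OF assms(1)] by metis
  show ?thesis
    by (rule integral_nonneg_off_finite[OF P(1)]) (use P(2) assms tnorm_nonneg in auto)
qed

lemma curve_length_nonneg: "piecewise_C1_curve_on A a b \<gamma> \<Longrightarrow> 0 \<le> curve_length A g a b \<gamma>"
  using integral_speed_nonneg curve_length_eq_integral by simp

lemma integral_speed_le_length:
  assumes "piecewise_C1_curve_on A a b \<gamma>" "a \<le> s" "s \<le> t" "t \<le> b"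
  shows "integral {s..t} (speed \<gamma>) \<le> curve_length A g a b \<gamma>"
proof -
  have "integral {a..s} (speed \<gamma>) + integral {s..b} (speed \<gamma>) = integral {a..b} (speed \<gamma>)"
    "integral {s..t} (speed \<gamma>) + integral {t..b} (speed \<gamma>) = integral {s..b} (speed \<gamma>)"
    using assms by (intro Henstock_Kurzweil_Integration.integral_combine speed_integrable[OF assms(1)]; simp)+
  then show ?thesis
    using integral_speed_nonneg[OF assms(1), of a s] integral_speed_nonneg[OF assms(1), of t b] assms
    by (simp add: curve_length_eq_integral)
qed

lemma curve_length_combine:
  assumes "piecewise_C1_curve_on A a b \<gamma>" "piecewise_C1_curve_on A b c \<gamma>"
  shows "curve_length A g a c \<gamma> = curve_length A g a b \<gamma> + curve_length A g b c \<gamma>"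
  using assms piecewise_C1_curve_on_combine[OF assms] piecewise_C1_curve_on_le[OF assms(1)]
    piecewise_C1_curve_on_le[OF assms(2)]
  by (simp add: curve_length_eq_integral Henstock_Kurzweil_Integration.integral_combine speed_integrable)

text \<open>The two predicates under \<open>SOME\<close> coincide, so the values agree even at times
  without a velocity.\<close>

lemma velocity_cong:
  assumes "open S" "t \<in> S" "\<And>s. s \<in> S \<Longrightarrow> \<delta> s = \<gamma> s" shows "velocity A \<delta> t = velocity A \<gamma> t"
proof -
  have "has_velocity A \<delta> t v \<longleftrightarrow> has_velocity A \<gamma> t v" for v
    using has_velocity_transform[OF _ assms(1,2), of \<delta> v \<gamma>] has_velocity_transform[OF _ assms(1,2), of \<gamma> v \<delta>]
      assms(3) by metis
  then have "has_velocity A \<delta> t = has_velocity A \<gamma> t" by blast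
  then show ?thesis unfolding velocity_def by simp
qed

lemma curve_length_cong:
  assumes "piecewise_C1_curve_on A a b \<gamma>" "\<And>t. t \<in> {a..b} \<Longrightarrow> \<delta> t = \<gamma> t"
  shows "curve_length A g a b \<delta> = curve_length A g a b \<gamma>"
proof -
  have "integral {a..b} (speed \<delta>) = integral {a..b} (speed \<gamma>)"
  proof (rule integral_spike[of "{a, b}"])
    fix t assume "t \<in> {a..b} - {a, b}"
    then show "speed \<gamma> t = speed \<delta> t"
      using velocity_cong[of "{a<..<b}" t \<delta> \<gamma>] assms(2) by auto
  qed auto
  then show ?thesis using assms(1) piecewise_C1_curve_on_cong[OF assms] by (simp add: curve_length_eq_integral)
qed

text \<open>The substitution contributes \<open>1 / \<bar>m\<bar>\<close> and the velocity is
  multiplied by \<open>m\<close>, so the factors cancel for either orientation.\<close>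

lemma curve_length_affine:
  fixes m k :: real
  defines "T \<equiv> \<lambda>t. m * t + k"
  assumes m: "m \<noteq> 0" and ends: "{T a', T b'} = {a, b}" "a' \<le> b'" and \<gamma>: "piecewise_C1_curve_on A a b \<gamma>"
  shows "curve_length A g a' b' (\<gamma> \<circ> T) = curve_length A g a b \<gamma>"
proof -
  have \<gamma>T: "piecewise_C1_curve_on A a' b' (\<gamma> \<circ> T)"
    unfolding T_def using assms by (intro piecewise_C1_curve_on_affine) auto
  have "a \<le> b" using \<gamma> by (rule piecewise_C1_curve_on_le)
  have inj: "inj T" unfolding T_def using m by (auto simp: inj_def)
  \<comment> \<open>The substitution rule \<open>has_integral_affinity\<close> delivers the new
    domain as this image of \<open>cbox a b\<close>.\<close>
  have img: "(\<lambda>x. (1 / m) *\<^sub>R x + - ((1 / m) *\<^sub>R k)) ` cbox a b = {a'..b'}" (is "?f ` _ = _")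
    and Tint: "\<And>t. t \<in> {a'<..<b'} \<Longrightarrow> T t \<in> {a<..<b}"
  proof -
    have f: "?f x \<in> {a'..b'} \<longleftrightarrow> x \<in> {a..b}" "T (?f x) = x" "?f (T t) = t"
      "t \<in> {a'<..<b'} \<Longrightarrow> T t \<in> {a<..<b}" for x t
    proof -
      show "T (?f x) = x" "?f (T t) = t" using m by (auto simp: T_def field_simps)
      have "(?f x \<in> {a'..b'} \<longleftrightarrow> x \<in> {a..b}) \<and> (t \<in> {a'<..<b'} \<longrightarrow> T t \<in> {a<..<b})"
      proof (cases "m > 0")
        case True
        then have "T a' \<le> T b'" unfolding T_def using ends(2) by simp
        then have "a = m * a' + k" "b = m * b' + k" using ends \<open>a \<le> b\<close> by (auto simp: doubleton_eq_iff T_def)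
        then show ?thesis using True by (auto simp: T_def field_simps)
      next
        case False
        then have neg: "m < 0" using m by auto
        then have "T b' \<le> T a'" unfolding T_def using ends(2) by simp
        then have "b = m * a' + k" "a = m * b' + k" using ends \<open>a \<le> b\<close> by (auto simp: doubleton_eq_iff T_def)
        then show ?thesis using neg by (auto simp: T_def field_simps)
      qed
      then show "?f x \<in> {a'..b'} \<longleftrightarrow> x \<in> {a..b}" "t \<in> {a'<..<b'} \<Longrightarrow> T t \<in> {a<..<b}" by auto
    qed
    show "?f ` cbox a b = {a'..b'}"
    proof (intro equalityI subsetI)
      fix t assume "t \<in> {a'..b'}"
      then show "t \<in> ?f ` cbox a b" using f(1)[of "T t"] f(3)[of t] unfolding box_real by (metis image_eqI)
    next
      fix t assume "t \<in> ?f ` cbox a b"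
      then obtain x where "x \<in> {a..b}" "t = ?f x" unfolding box_real by blast
      then show "t \<in> {a'..b'}" using f(1)[of x] by simp
    qed
    show "\<And>t. t \<in> {a'<..<b'} \<Longrightarrow> T t \<in> {a<..<b}" by (rule f(4))
  qed
  obtain P where P: "finite P" "\<And>t. t \<in> {a<..<b} - P \<Longrightarrow> isCont \<gamma> t \<and> has_velocity A \<gamma> t (velocity A \<gamma> t)"
    "\<And>t. t \<in> {a<..<b} - P \<Longrightarrow> velocity A \<gamma> t \<in> tangent_space A (\<gamma> t)"
    using piecewise_C1_curve_on_velocity[OF \<gamma>] by metis
  have "(speed \<gamma> has_integral integral {a..b} (speed \<gamma>)) (cbox a b)"
    using speed_integrable[OF \<gamma>, of a b] by (simp add: box_real integrable_integral)
  from has_integral_affinity[OF this m, of k]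
  have "((\<lambda>t. speed \<gamma> (T t)) has_integral (1 / \<bar>m\<bar>) * integral {a..b} (speed \<gamma>)) {a'..b'}"
    unfolding img by (simp add: T_def)
  from has_integral_mult_right[OF this, of "\<bar>m\<bar>"]
  have scaled: "((\<lambda>t. \<bar>m\<bar> * speed \<gamma> (T t)) has_integral integral {a..b} (speed \<gamma>)) {a'..b'}"
    using m by simp
  have spd: "speed (\<gamma> \<circ> T) t = \<bar>m\<bar> * speed \<gamma> (T t)" if t: "t \<in> {a'..b'} - (T -` P \<union> {a', b'})" for t
  proof -
    have Tt: "T t \<in> {a<..<b} - P" using Tint[of t] t by auto
    have "isCont (\<gamma> \<circ> T) t"
      using P(2)[OF Tt] by (intro continuous_at_compose) (auto simp: T_def)
    moreover have "has_velocity A (\<gamma> \<circ> T) t (\<lambda>c. m *\<^sub>R velocity A \<gamma> (T t) c)"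
      using has_velocity_affine[of \<gamma> m t k] P(2)[OF Tt] m by (simp add: T_def o_def)
    ultimately have "velocity A (\<gamma> \<circ> T) t = (\<lambda>c. m *\<^sub>R velocity A \<gamma> (T t) c)" by (rule velocity_eq)
    then show ?thesis using tnorm_scale[OF P(3)[OF Tt], of m] by simp
  qed
  have neg: "negligible (T -` P \<union> {a', b'})"
    using P(1) inj by (intro negligible_finite) (simp add: finite_vimageI)
  have "(speed (\<gamma> \<circ> T) has_integral integral {a..b} (speed \<gamma>)) {a'..b'}"
    by (rule has_integral_spike[OF neg spd scaled])
  then show ?thesis using \<gamma> \<gamma>T by (simp add: curve_length_eq_integral integral_unique)
qed

section \<open>The Riemannian distance\<close>

text \<open>The curve that is a straight segment in the coordinates of \<open>c\<close>. Seen in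
  another chart, its derivative is the differential of the transition applied to a constant vector,
  and so it depends continuously on time.\<close>

lemma chart_segment:
  assumes c: "c \<in> A" and C: "convex C" "C \<subseteq> snd c ` fst c"
    and p: "p \<in> fst c" "snd c p \<in> C" and q: "q \<in> fst c" "snd c q \<in> C"
  defines "\<gamma> \<equiv> \<lambda>t. chart_inv c (snd c p + t *\<^sub>R (snd c q - snd c p))"
  shows "C1_curve_on A 0 1 \<gamma>" "\<gamma> 0 = p" "\<gamma> 1 = q"
    "\<And>t. t \<in> {0..1} \<Longrightarrow> \<gamma> t \<in> fst c \<and> snd c (\<gamma> t) \<in> C"
    "\<And>t. t \<in> {0<..<1} \<Longrightarrow> velocity A \<gamma> t \<in> tangent_space A (\<gamma> t) \<and> velocity A \<gamma> t c = snd c q - snd c p"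
proof -
  let ?\<xi> = "snd c q - snd c p"
  define l where "l t = snd c p + t *\<^sub>R ?\<xi>" for t
  have l_C: "l t \<in> C" if "t \<in> {0..1}" for t
    using convexD_alt[OF C(1) p(2) q(2), of t] that by (simp add: l_def algebra_simps)
  then have l: "l t \<in> snd c ` fst c" if "t \<in> {0..1}" for t using C(2) that by blast
  have \<gamma>l: "\<gamma> t = chart_inv c (l t)" for t by (simp add: \<gamma>_def l_def)
  have \<gamma>: "\<gamma> t \<in> fst c" "snd c (\<gamma> t) = l t" if "t \<in> {0..1}" for t
    unfolding \<gamma>l using l[OF that] chart_inv_in_domain[OF c] chart_chart_inv[OF c] by auto
  have lcont: "continuous_on S l" for S unfolding l_def by (intro continuous_intros)
  have \<gamma>cont: "continuous_on {0..1} \<gamma>"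
    unfolding \<gamma>l by (rule continuous_on_compose2[OF continuous_on_chart_inv[OF c] lcont]) (use l in auto)
  have der: "((snd c \<circ> \<gamma>) has_vector_derivative ?\<xi>) (at t within {0..1})" if t: "t \<in> {0..1}" for t
  proof (rule has_vector_derivative_transform[OF t])
    show "(l has_vector_derivative ?\<xi>) (at t within {0..1})"
      unfolding l_def by (auto intro!: derivative_eq_intros)
  qed (use \<gamma> in auto)
  show "\<gamma> 0 = p" "\<gamma> 1 = q" using c p q by (auto simp: \<gamma>_def)
  show "\<gamma> t \<in> fst c \<and> snd c (\<gamma> t) \<in> C" if "t \<in> {0..1}" for t using \<gamma>[OF that] l_C[OF that] by simp
  show "C1_curve_on A 0 1 \<gamma>"
    unfolding C1_curve_on_def
  proof (intro conjI ballI \<gamma>cont)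
    fix c' assume c': "c' \<in> A"
    let ?d = "\<lambda>t. coord_vector A c (\<gamma> t) ?\<xi> c'"
    show "\<exists>\<gamma>'. (\<forall>t\<in>{t \<in> {0..1}. \<gamma> t \<in> fst c'}. ((snd c' \<circ> \<gamma>) has_vector_derivative \<gamma>' t) (at t within {0..1})) \<and>
       continuous_on {t \<in> {0..1}. \<gamma> t \<in> fst c'} \<gamma>'"
    proof (intro exI[of _ ?d] conjI ballI)
      fix t assume t: "t \<in> {t \<in> {0..1}. \<gamma> t \<in> fst c'}"
      then show "((snd c' \<circ> \<gamma>) has_vector_derivative ?d t) (at t within {0..1})"
        using \<gamma>cont \<gamma>(1) c c' der
        by (intro chart_change_derivative) (auto simp: charts_atI continuous_on_eq_continuous_within)
    next
      let ?S = "{t \<in> {0..1}. \<gamma> t \<in> fst c'}"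
      have "continuous_on ?S (\<lambda>t. frechet_derivative (transition c c') (at (l t)) ?\<xi>)"
      proof (rule continuous_on_compose2[OF continuous_on_tmap[OF c c'] lcont])
        show "l ` ?S \<subseteq> snd c ` (fst c \<inter> fst c')" using \<gamma> by (auto intro!: image_eqI[of _ _ "\<gamma> _"])
      qed
      then show "continuous_on ?S ?d"
        by (rule continuous_on_eq) (use c c' \<gamma> in \<open>auto simp: coord_vector_def charts_atI\<close>)
    qed
  qed
  fix t :: real assume t: "t \<in> {0<..<1}"
  then have "isCont \<gamma> t" using \<gamma>cont by (intro continuous_on_interior[of "{0..1}"]) auto
  moreover have ch: "c \<in> charts_at A (\<gamma> t)" using c \<gamma>(1)[of t] t by (auto intro: charts_atI)
  moreover have "((snd c \<circ> \<gamma>) has_vector_derivative ?\<xi>) (at t)"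
    using der[of t] t at_within_interior[of t "{0..1}"] by auto
  ultimately have "velocity A \<gamma> t = coord_vector A c (\<gamma> t) ?\<xi>"
    by (intro velocity_eq) (auto simp: has_velocity_def)
  then show "velocity A \<gamma> t \<in> tangent_space A (\<gamma> t) \<and> velocity A \<gamma> t c = ?\<xi>"
    using coord_vector_in_tangent_space[OF ch] coord_vector_self[OF ch] by simp
qed

text \<open>The second curve is shifted to \<open>{1..2}\<close> and the concatenation rescaled from
  \<open>{0..2}\<close>. The junction becomes a node, so the derivatives of the two pieces need not
  match there.\<close>

lemma piecewise_C1_curve_join:
  assumes "piecewise_C1_curve_on A 0 1 \<gamma>1" "piecewise_C1_curve_on A 0 1 \<gamma>2" "\<gamma>1 1 = \<gamma>2 0"
  obtains \<gamma> where "piecewise_C1_curve_on A 0 1 \<gamma>" "\<gamma> 0 = \<gamma>1 0" "\<gamma> 1 = \<gamma>2 1"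
    "curve_length A g 0 1 \<gamma> = curve_length A g 0 1 \<gamma>1 + curve_length A g 0 1 \<gamma>2"
proof -
  define \<gamma>2' where "\<gamma>2' = \<gamma>2 \<circ> (\<lambda>t. 1 * t + (- 1))"
  define \<delta> where "\<delta> t = (if t \<le> 1 then \<gamma>1 t else \<gamma>2 (t - 1))" for t :: real
  have \<gamma>2': "piecewise_C1_curve_on A 1 2 \<gamma>2'" "curve_length A g 1 2 \<gamma>2' = curve_length A g 0 1 \<gamma>2"
    unfolding \<gamma>2'_def using assms(2)
    by (intro piecewise_C1_curve_on_affine curve_length_affine; simp)+
  have eq: "\<delta> t = \<gamma>1 t" if "t \<in> {0..1}" for t using that by (simp add: \<delta>_def)
  have eq': "\<delta> t = \<gamma>2' t" if "t \<in> {1..2}" for t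
    using that assms(3) by (cases "t = 1") (auto simp: \<delta>_def \<gamma>2'_def)
  note \<delta>1 = piecewise_C1_curve_on_cong[OF assms(1) eq] and \<delta>2 = piecewise_C1_curve_on_cong[OF \<gamma>2'(1) eq']
  note \<delta> = piecewise_C1_curve_on_combine[OF \<delta>1 \<delta>2]
  have len: "curve_length A g 0 2 \<delta> = curve_length A g 0 1 \<gamma>1 + curve_length A g 0 1 \<gamma>2"
    using curve_length_combine[OF \<delta>1 \<delta>2] curve_length_cong[OF assms(1) eq] curve_length_cong[OF \<gamma>2'(1) eq']
      \<gamma>2'(2) by simp
  show ?thesis
  proof (rule that[of "\<delta> \<circ> (\<lambda>t. 2 * t + 0)"])
    show "piecewise_C1_curve_on A 0 1 (\<delta> \<circ> (\<lambda>t. 2 * t + 0))"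
      by (rule piecewise_C1_curve_on_affine[OF _ _ _ \<delta>]) auto
    have "curve_length A g 0 1 (\<delta> \<circ> (\<lambda>t. 2 * t + 0)) = curve_length A g 0 2 \<delta>"
      by (rule curve_length_affine[OF _ _ _ \<delta>]) auto
    then show "curve_length A g 0 1 (\<delta> \<circ> (\<lambda>t. 2 * t + 0)) = curve_length A g 0 1 \<gamma>1 + curve_length A g 0 1 \<gamma>2"
      using len by simp
  qed (auto simp: \<delta>_def)
qed

text \<open>Connectedness enters only here: between points in different components \<^const>\<open>riem_dist\<close> would be the
  unspecified real number \<open>Inf {}\<close>.\<close>

lemma piecewise_C1_curve_exists:
  obtains \<gamma> where "piecewise_C1_curve_on A 0 1 \<gamma>" "\<gamma> 0 = p" "\<gamma> 1 = q"
proof -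
  have near: "\<exists>\<gamma>. piecewise_C1_curve_on A 0 1 \<gamma> \<and> \<gamma> 0 = x \<and> \<gamma> 1 = y"
    if "c \<in> A" "cball z r \<subseteq> snd c ` fst c" "x \<in> fst c" "snd c x \<in> cball z r" "y \<in> fst c" "snd c y \<in> cball z r"
    for c z r x y
    using chart_segment(1-3)[OF that(1) convex_cball that(2-6)] C1_imp_piecewise_C1_curve_on[OF zero_less_one]
    by blast
  have "\<exists>\<gamma>. piecewise_C1_curve_on A 0 1 \<gamma> \<and> \<gamma> 0 = p \<and> \<gamma> 1 = q"
  proof (rule connected_induction_simple[OF connected, of p q])
    fix a :: 'm
    obtain c where c: "c \<in> A" "a \<in> fst c" using ex_chart_at charts_atD by metis
    obtain r where r: "r > 0" "cball (snd c a) r \<subseteq> snd c ` (fst c \<inter> UNIV)"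
      using chart_ball[OF c open_UNIV] by auto
    define T where "T = {x \<in> fst c. snd c x \<in> ball (snd c a) r}"
    have T: "open T" unfolding T_def by (rule open_chart_vimage[OF c(1)]) simp
    have a: "a \<in> T" using c r by (simp add: T_def)
    have reach: "\<exists>\<gamma>. piecewise_C1_curve_on A 0 1 \<gamma> \<and> \<gamma> 0 = p \<and> \<gamma> 1 = y"
      if xy: "x \<in> T" "y \<in> T" and x: "\<exists>\<gamma>. piecewise_C1_curve_on A 0 1 \<gamma> \<and> \<gamma> 0 = p \<and> \<gamma> 1 = x" for x y
    proof -
      obtain \<gamma>1 where \<gamma>1: "piecewise_C1_curve_on A 0 1 \<gamma>1" "\<gamma>1 0 = p" "\<gamma>1 1 = x" using x by blast
      obtain \<gamma>2 where \<gamma>2: "piecewise_C1_curve_on A 0 1 \<gamma>2" "\<gamma>2 0 = x" "\<gamma>2 1 = y"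
        using near[of c "snd c a" r x y] xy c r unfolding T_def by auto
      show ?thesis using piecewise_C1_curve_join[OF \<gamma>1(1) \<gamma>2(1)] \<gamma>1 \<gamma>2 by metis
    qed
    show "\<exists>T. openin (top_of_set UNIV) T \<and> a \<in> T \<and> (\<forall>x\<in>T. \<forall>y\<in>T.
        (\<exists>\<gamma>. piecewise_C1_curve_on A 0 1 \<gamma> \<and> \<gamma> 0 = p \<and> \<gamma> 1 = x) \<longrightarrow>
        (\<exists>\<gamma>. piecewise_C1_curve_on A 0 1 \<gamma> \<and> \<gamma> 0 = p \<and> \<gamma> 1 = y))"
    proof (intro exI[of _ T] conjI ballI impI a)
      show "openin (top_of_set UNIV) T" using T by simp
    qed (rule reach)
  next
    obtain c where c: "c \<in> A" "p \<in> fst c" using ex_chart_at charts_atD by metis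
    \<comment> \<open>Radius \<open>0\<close> suffices: the segment from \<open>p\<close> to itself
      is a constant curve.\<close>
    then have "cball (snd c p) 0 \<subseteq> snd c ` fst c" by auto
    then show "\<exists>\<gamma>. piecewise_C1_curve_on A 0 1 \<gamma> \<and> \<gamma> 0 = p \<and> \<gamma> 1 = p"
      by (rule near[OF c(1) _ c(2) _ c(2)]) auto
  qed auto
  then show ?thesis using that by blast
qed

section \<open>The distance as an infimum, and its comparison with coordinate distance\<close>

abbreviation \<rho> where "\<rho> \<equiv> riem_dist A g"

abbreviation lengths where
  "lengths p q \<equiv> {curve_length A g 0 1 \<gamma> |\<gamma>. piecewise_C1_curve_on A 0 1 \<gamma> \<and> \<gamma> 0 = p \<and> \<gamma> 1 = q}"

lemma lengths_nonempty: "lengths p q \<noteq> {}"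
  using piecewise_C1_curve_exists[of p q] by blast

lemma lengths_bdd_below: "bdd_below (lengths p q)"
  by (rule bdd_belowI[of _ 0]) (auto intro: curve_length_nonneg)

lemma riem_dist_le_length:
  "piecewise_C1_curve_on A 0 1 \<gamma> \<Longrightarrow> \<gamma> 0 = p \<Longrightarrow> \<gamma> 1 = q \<Longrightarrow> \<rho> p q \<le> curve_length A g 0 1 \<gamma>"
  unfolding riem_dist_def by (rule cInf_lower[OF _ lengths_bdd_below]) blast

lemma riem_dist_greatest:
  assumes "\<And>\<gamma>. \<lbrakk>piecewise_C1_curve_on A 0 1 \<gamma>; \<gamma> 0 = p; \<gamma> 1 = q\<rbrakk> \<Longrightarrow> r \<le> curve_length A g 0 1 \<gamma>"
  shows "r \<le> \<rho> p q"
  unfolding riem_dist_def by (rule cInf_greatest[OF lengths_nonempty]) (use assms in blast)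

lemma riem_dist_nonneg: "0 \<le> \<rho> p q"
  by (rule riem_dist_greatest) (rule curve_length_nonneg)

lemma riem_dist_triangle: "\<rho> p r \<le> \<rho> p q + \<rho> q r"
proof -
  have "\<rho> p r - \<rho> q r \<le> \<rho> p q"
  proof (rule riem_dist_greatest)
    fix \<gamma>1 assume \<gamma>1: "piecewise_C1_curve_on A 0 1 \<gamma>1" "\<gamma>1 0 = p" "\<gamma>1 1 = q"
    have "\<rho> p r - curve_length A g 0 1 \<gamma>1 \<le> \<rho> q r"
    proof (rule riem_dist_greatest)
      fix \<gamma>2 assume \<gamma>2: "piecewise_C1_curve_on A 0 1 \<gamma>2" "\<gamma>2 0 = q" "\<gamma>2 1 = r"
      obtain \<gamma> where "piecewise_C1_curve_on A 0 1 \<gamma>" "\<gamma> 0 = p" "\<gamma> 1 = r"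
        "curve_length A g 0 1 \<gamma> = curve_length A g 0 1 \<gamma>1 + curve_length A g 0 1 \<gamma>2"
        using piecewise_C1_curve_join[OF \<gamma>1(1) \<gamma>2(1)] \<gamma>1 \<gamma>2 by metis
      then show "\<rho> p r - curve_length A g 0 1 \<gamma>1 \<le> curve_length A g 0 1 \<gamma>2"
        using riem_dist_le_length by fastforce
    qed
    then show "\<rho> p r - \<rho> q r \<le> curve_length A g 0 1 \<gamma>1" by simp
  qed
  then show ?thesis by simp
qed

lemma riem_dist_commute_le: "\<rho> q p \<le> \<rho> p q"
proof (rule riem_dist_greatest)
  fix \<gamma> assume \<gamma>: "piecewise_C1_curve_on A 0 1 \<gamma>" "\<gamma> 0 = p" "\<gamma> 1 = q"
  let ?\<delta> = "\<gamma> \<circ> (\<lambda>t. (- 1) * t + 1)"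
  have "piecewise_C1_curve_on A 0 1 ?\<delta>"
    by (rule piecewise_C1_curve_on_affine[OF _ _ _ \<gamma>(1)]) auto
  moreover have "curve_length A g 0 1 ?\<delta> = curve_length A g 0 1 \<gamma>"
    by (rule curve_length_affine[OF _ _ _ \<gamma>(1)]) auto
  ultimately show "\<rho> q p \<le> curve_length A g 0 1 \<gamma>"
    using riem_dist_le_length[of ?\<delta> q p] \<gamma>(2,3) by simp
qed

lemma riem_dist_commute: "\<rho> p q = \<rho> q p"
  by (intro antisym riem_dist_commute_le)

text \<open>The coordinate segment competes in the infimum. Convexity keeps it where
  \<open>\<beta>\<close> is valid, and its coordinate velocity has the constant norm on the
  right.\<close>

lemma riem_dist_le_chart:
  assumes c: "c \<in> A" and C: "convex C" "C \<subseteq> snd c ` fst c"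
    and p: "p \<in> fst c" "snd c p \<in> C" and q: "q \<in> fst c" "snd c q \<in> C"
    and \<beta>: "\<And>p v. \<lbrakk>p \<in> fst c; snd c p \<in> C; v \<in> tangent_space A p\<rbrakk> \<Longrightarrow> tnorm g p v \<le> \<beta> * norm (v c)"
  shows "\<rho> p q \<le> \<beta> * norm (snd c q - snd c p)"
proof -
  define \<gamma> where "\<gamma> t = chart_inv c (snd c p + t *\<^sub>R (snd c q - snd c p))" for t
  note \<gamma> = chart_segment[OF c C p q, folded \<gamma>_def]
  have pw: "piecewise_C1_curve_on A 0 1 \<gamma>" by (rule C1_imp_piecewise_C1_curve_on[OF _ \<gamma>(1)]) simp
  have "norm (integral {0..1} (speed \<gamma>)) \<le> integral {0..1} (\<lambda>t::real. \<beta> * norm (snd c q - snd c p))"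
  proof (rule integral_norm_bound_off_negligible[of "{0, 1}"])
    show "norm (speed \<gamma> t) \<le> \<beta> * norm (snd c q - snd c p)" if "t \<in> {0..1} - {0, 1}" for t
      using \<beta>[of "\<gamma> t" "velocity A \<gamma> t"] \<gamma>(4,5)[of t] that tnorm_nonneg[of "velocity A \<gamma> t" "\<gamma> t"] by auto
  qed (use speed_integrable[OF pw] in auto)
  then have "curve_length A g 0 1 \<gamma> \<le> \<beta> * norm (snd c q - snd c p)"
    by (simp add: curve_length_eq_integral[OF pw])
  then show ?thesis using riem_dist_le_length[OF pw \<gamma>(2,3)] by simp
qed

text \<open>The fundamental theorem of calculus for the coordinates, whose derivative is at most the
  speed divided by \<open>\<alpha>\<close>. A subinterval \<open>{s..t}\<close> is allowed because
  the rest of the curve may lie outside the chart.\<close>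

lemma chart_displacement_le_length:
  assumes \<gamma>: "piecewise_C1_curve_on A a b \<gamma>" and st: "a \<le> s" "s \<le> t" "t \<le> b"
    and c: "c \<in> A" and K: "\<And>\<tau>. \<tau> \<in> {s..t} \<Longrightarrow> \<gamma> \<tau> \<in> fst c \<and> snd c (\<gamma> \<tau>) \<in> K"
    and \<alpha>: "\<alpha> > 0" "\<And>p v. \<lbrakk>p \<in> fst c; snd c p \<in> K; v \<in> tangent_space A p\<rbrakk> \<Longrightarrow> \<alpha> * norm (v c) \<le> tnorm g p v"
  shows "\<alpha> * norm (snd c (\<gamma> t) - snd c (\<gamma> s)) \<le> curve_length A g a b \<gamma>"
proof -
  obtain P where P: "finite P" "\<And>t. t \<in> {a<..<b} - P \<Longrightarrow> isCont \<gamma> t \<and> has_velocity A \<gamma> t (velocity A \<gamma> t)"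
    "\<And>t. t \<in> {a<..<b} - P \<Longrightarrow> velocity A \<gamma> t \<in> tangent_space A (\<gamma> t)"
    using piecewise_C1_curve_on_velocity[OF \<gamma>] by metis
  have "((\<lambda>\<tau>. velocity A \<gamma> \<tau> c) has_integral (snd c \<circ> \<gamma>) t - (snd c \<circ> \<gamma>) s) {s..t}"
  proof (rule fundamental_theorem_of_calculus_interior_strong[OF P(1) st(2)])
    fix \<tau> assume "\<tau> \<in> {s<..<t} - P"
    then have \<tau>: "\<tau> \<in> {a<..<b} - P" "\<tau> \<in> {s..t}" using st by auto
    show "((snd c \<circ> \<gamma>) has_vector_derivative velocity A \<gamma> \<tau> c) (at \<tau>)"
      using P(2)[OF \<tau>(1)] K[OF \<tau>(2)] has_velocity_iff_chart[OF _ charts_atI[OF c]] by blast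
  next
    show "continuous_on {s..t} (snd c \<circ> \<gamma>)"
      using st K by (intro continuous_on_compose continuous_on_subset[OF piecewise_C1_curve_on_continuous[OF \<gamma>]]
          continuous_on_subset[OF continuous_on_chart[OF c]]) auto
  qed
  then have int: "(\<lambda>\<tau>. velocity A \<gamma> \<tau> c) integrable_on {s..t}"
    "integral {s..t} (\<lambda>\<tau>. velocity A \<gamma> \<tau> c) = snd c (\<gamma> t) - snd c (\<gamma> s)"
    by (auto simp: has_integral_iff)
  have "norm (integral {s..t} (\<lambda>\<tau>. velocity A \<gamma> \<tau> c)) \<le> integral {s..t} (\<lambda>\<tau>. (1 / \<alpha>) * speed \<gamma> \<tau>)"
  proof (rule integral_norm_bound_off_negligible[OF _ int(1)])
    show "negligible (P \<union> {s, t})" using P(1) by auto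
    show "(\<lambda>\<tau>. (1 / \<alpha>) * speed \<gamma> \<tau>) integrable_on {s..t}"
      using speed_integrable[OF \<gamma> st(1,3)] by (intro integrable_on_mult_right)
    fix \<tau> assume "\<tau> \<in> {s..t} - (P \<union> {s, t})"
    then have \<tau>: "\<tau> \<in> {a<..<b} - P" "\<tau> \<in> {s..t}" using st by auto
    show "norm (velocity A \<gamma> \<tau> c) \<le> (1 / \<alpha>) * speed \<gamma> \<tau>"
      using \<alpha>(2)[OF _ _ P(3)[OF \<tau>(1)]] K[OF \<tau>(2)] \<alpha>(1) by (simp add: field_simps)
  qed
  then have "norm (snd c (\<gamma> t) - snd c (\<gamma> s)) \<le> (1 / \<alpha>) * integral {s..t} (speed \<gamma>)"
    unfolding int(2) by simp
  then have "\<alpha> * norm (snd c (\<gamma> t) - snd c (\<gamma> s)) \<le> integral {s..t} (speed \<gamma>)"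
    using \<alpha>(1) by (simp add: field_simps)
  then show ?thesis using integral_speed_le_length[OF \<gamma> st] by simp
qed

text \<open>At the first exit time the curve may already be outside the chart domain, so its
  coordinates there need not be meaningful. Instead, every radius \<open>R' < R\<close> is exceeded
  strictly before that time, while the curve is still in the ball.\<close>

lemma chart_exit:
  fixes \<gamma> :: "real \<Rightarrow> 'm"
  assumes c: "c \<in> A" and ball: "cball y R \<subseteq> snd c ` fst c"
    and \<gamma>: "continuous_on {a..b} \<gamma>" and ab: "a \<le> b"
    and start: "\<gamma> a \<in> fst c" "snd c (\<gamma> a) \<in> ball y R" and R': "R' < R"
  obtains "\<And>t. t \<in> {a..b} \<Longrightarrow> \<gamma> t \<in> fst c \<and> snd c (\<gamma> t) \<in> ball y R"
  | t where "t \<in> {a..b}" "\<And>\<tau>. \<tau> \<in> {a..t} \<Longrightarrow> \<gamma> \<tau> \<in> fst c \<and> snd c (\<gamma> \<tau>) \<in> ball y R"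
      "R' < dist y (snd c (\<gamma> t))"
proof -
  define W where "W = {p \<in> fst c. snd c p \<in> ball y R}"
  define E where "E = {t \<in> {a..b}. \<gamma> t \<notin> W}"
  show thesis
  proof (cases "E = {}")
    case True
    then show ?thesis by (intro that(1)) (auto simp: E_def W_def)
  next
    case False
    have "open W" unfolding W_def by (rule open_chart_vimage[OF c]) simp
    then have "closed ({a..b} \<inter> \<gamma> -` (- W))" by (intro continuous_closed_preimage[OF \<gamma>]) auto
    also have "{a..b} \<inter> \<gamma> -` (- W) = E" by (auto simp: E_def)
    finally have "closed E" .
    moreover have "E = {a..b} \<inter> E" by (auto simp: E_def)
    ultimately have "compact E" using compact_Int_closed[OF compact_Icc] by metis
    then obtain T where T: "T \<in> E" "\<And>t. t \<in> E \<Longrightarrow> T \<le> t"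
      using compact_attains_inf[OF _ False] by blast
    have TW: "\<gamma> t \<in> W" if "t \<in> {a..<T}" for t using that T unfolding E_def by force
    have "a < T" using T(1) start by (cases "a = T") (auto simp: E_def W_def)
    have "\<exists>t\<in>{a..<T}. R' < dist y (snd c (\<gamma> t))"
    proof (rule ccontr)
      assume "\<not> ?thesis"
      then have near: "\<gamma> t \<in> {p \<in> fst c. snd c p \<in> cball y R'}" if "t \<in> {a..<T}" for t
        using TW[OF that] that by (auto simp: W_def not_less)
      have "cball y R' \<subseteq> snd c ` fst c" using ball R' by auto
      then have "compact {p \<in> fst c. snd c p \<in> cball y R'}" by (intro compact_chart_vimage[OF c]) auto
      \<comment> \<open>The manifold is Hausdorff, so this compact set is closed in all of it. A
        curve confined to it before \<open>T\<close> is still in it at \<open>T\<close>,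
        contradicting the exit.\<close>
      then have "closed {p \<in> fst c. snd c p \<in> cball y R'}" by (rule compact_imp_closed)
      moreover have "continuous_on (closure {a..<T}) \<gamma>"
        using \<open>a < T\<close> T(1) by (intro continuous_on_subset[OF \<gamma>]) (auto simp: E_def)
      ultimately have "\<gamma> ` closure {a..<T} \<subseteq> {p \<in> fst c. snd c p \<in> cball y R'}"
        using near by (intro image_closure_subset) auto
      moreover have "\<gamma> T \<in> \<gamma> ` closure {a..<T}" using \<open>a < T\<close> by simp
      ultimately have "\<gamma> T \<in> W" using R' by (auto simp: W_def)
      then show False using T(1) by (simp add: E_def)
    qed
    then obtain t where "t \<in> {a..<T}" "R' < dist y (snd c (\<gamma> t))" by blast
    then show ?thesis using TW T(1) by (intro that(2)[of t]) (auto simp: E_def W_def)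
  qed
qed

text \<open>A competing curve either remains in the ball, and then its length controls the
  coordinate displacement, or gets farther than \<open>R'\<close> from the centre, which costs at
  least \<open>\<alpha> * R'\<close>.\<close>

lemma riem_dist_ge_chart:
  assumes c: "c \<in> A" "q \<in> fst c" and ball: "cball (snd c q) R \<subseteq> snd c ` fst c" "R > 0"
    and \<alpha>: "\<alpha> > 0" "\<And>p v. \<lbrakk>p \<in> fst c; snd c p \<in> cball (snd c q) R; v \<in> tangent_space A p\<rbrakk> \<Longrightarrow> \<alpha> * norm (v c) \<le> tnorm g p v"
    and r: "\<rho> q r < \<alpha> * R"
  shows "r \<in> fst c" "\<alpha> * norm (snd c r - snd c q) \<le> \<rho> q r"
proof -
  have len: "\<alpha> * R' \<le> curve_length A g 0 1 \<gamma> \<or>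
      (r \<in> fst c \<and> \<alpha> * norm (snd c r - snd c q) \<le> curve_length A g 0 1 \<gamma>)"
    if \<gamma>: "piecewise_C1_curve_on A 0 1 \<gamma>" "\<gamma> 0 = q" "\<gamma> 1 = r" and R': "R' < R" for \<gamma> R'
  proof -
    have start: "\<gamma> 0 \<in> fst c" "snd c (\<gamma> 0) \<in> ball (snd c q) R" using \<gamma>(2) c ball by auto
    show ?thesis
    proof (cases rule: chart_exit[OF c(1) ball(1) piecewise_C1_curve_on_continuous[OF \<gamma>(1)] zero_le_one start R'])
      case 1
      have inside: "\<gamma> \<tau> \<in> fst c \<and> snd c (\<gamma> \<tau>) \<in> cball (snd c q) R" if "\<tau> \<in> {0..1}" for \<tau>
        using 1[OF that] by auto
      have "\<alpha> * norm (snd c (\<gamma> 1) - snd c (\<gamma> 0)) \<le> curve_length A g 0 1 \<gamma>"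
        by (intro chart_displacement_le_length[OF \<gamma>(1) _ _ _ c(1) inside \<alpha>]) simp_all
      then show ?thesis using \<gamma>(2,3) 1[of 1] by simp
    next
      case (2 t)
      have inside: "\<gamma> \<tau> \<in> fst c \<and> snd c (\<gamma> \<tau>) \<in> cball (snd c q) R" if "\<tau> \<in> {0..t}" for \<tau>
        using 2(2)[OF that] by auto
      have "\<alpha> * norm (snd c (\<gamma> t) - snd c (\<gamma> 0)) \<le> curve_length A g 0 1 \<gamma>"
        using 2(1) by (intro chart_displacement_le_length[OF \<gamma>(1) _ _ _ c(1) inside \<alpha>]) simp_all
      then have "\<alpha> * norm (snd c (\<gamma> t) - snd c q) \<le> curve_length A g 0 1 \<gamma>" using \<gamma>(2) by simp
      moreover have "\<alpha> * R' \<le> \<alpha> * norm (snd c (\<gamma> t) - snd c q)"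
        using 2(3) \<alpha>(1) by (simp add: dist_norm norm_minus_commute)
      ultimately show ?thesis by simp
    qed
  qed
  \<comment> \<open>The midpoint of \<open>\<rho> q r / \<alpha>\<close> and \<open>R\<close>: below
    \<open>R\<close> as \<open>chart_exit\<close> demands, yet large enough for some competitor to
    be shorter than \<open>\<alpha> * R'\<close>. That competitor cannot leave the ball, so
    \<open>r\<close> lies in the chart.\<close>
  define R' where "R' = (\<rho> q r / \<alpha> + R) / 2"
  have R': "R' < R" "\<rho> q r < \<alpha> * R'" using r \<alpha>(1) by (auto simp: R'_def field_simps)
  obtain l where "l \<in> lengths q r" "l < \<alpha> * R'"
    using cInf_lessD[OF lengths_nonempty, of q r "\<alpha> * R'"] R'(2) unfolding riem_dist_def by blast
  then have *: "r \<in> fst c" "\<alpha> * norm (snd c r - snd c q) < \<alpha> * R'"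
    using len[OF _ _ _ R'(1)] by fastforce+
  show "r \<in> fst c" by (rule *)
  show "\<alpha> * norm (snd c r - snd c q) \<le> \<rho> q r"
  proof (rule riem_dist_greatest)
    fix \<gamma> assume "piecewise_C1_curve_on A 0 1 \<gamma>" "\<gamma> 0 = q" "\<gamma> 1 = r"
    \<comment> \<open>If the curve is long, the bound still holds because by \<open>*\<close> the
      displacement is below \<open>R'\<close>.\<close>
    from len[OF this R'(1)] show "\<alpha> * norm (snd c r - snd c q) \<le> curve_length A g 0 1 \<gamma>"
      using *(2) by linarith
  qed
qed

section \<open>Absolutely continuous curves\<close>

text \<open>The bounds hold on the ball of radius \<open>2 * R\<close>, so that points of the ball of radius \<open>R\<close> are centres of
  balls of radius \<open>R\<close> on which they hold.\<close>

definition tame_ball :: "('m, 'e) chart \<Rightarrow> 'e \<Rightarrow> real \<Rightarrow> real \<Rightarrow> real \<Rightarrow> bool" where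
  "tame_ball c y R \<alpha> \<beta> \<longleftrightarrow> c \<in> A \<and> R > 0 \<and> \<alpha> > 0 \<and> \<beta> > 0 \<and> cball y (2 * R) \<subseteq> snd c ` fst c \<and>
     (\<forall>p v. p \<in> fst c \<longrightarrow> snd c p \<in> cball y (2 * R) \<longrightarrow> v \<in> tangent_space A p \<longrightarrow>
        \<alpha> * norm (v c) \<le> tnorm g p v \<and> tnorm g p v \<le> \<beta> * norm (v c))"

lemma tame_ballD:
  assumes "tame_ball c y R \<alpha> \<beta>"
  shows "c \<in> A" "R > 0" "\<alpha> > 0" "\<beta> > 0" "cball y (2 * R) \<subseteq> snd c ` fst c" "cball y R \<subseteq> snd c ` fst c"
    "cball y R \<subseteq> cball y (2 * R)"
    "\<And>p v. \<lbrakk>p \<in> fst c; snd c p \<in> cball y (2 * R); v \<in> tangent_space A p\<rbrakk> \<Longrightarrow> \<alpha> * norm (v c) \<le> tnorm g p v"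
    "\<And>p v. \<lbrakk>p \<in> fst c; snd c p \<in> cball y (2 * R); v \<in> tangent_space A p\<rbrakk> \<Longrightarrow> tnorm g p v \<le> \<beta> * norm (v c)"
proof -
  show "R > 0" using assms by (simp add: tame_ball_def)
  then show *: "cball y R \<subseteq> cball y (2 * R)" by auto
  show "cball y (2 * R) \<subseteq> snd c ` fst c" using assms by (simp add: tame_ball_def)
  then show "cball y R \<subseteq> snd c ` fst c" using * by blast
qed (use assms in \<open>auto simp: tame_ball_def\<close>)

lemma tame_ball_exists:
  assumes "open U" "p \<in> U"
  obtains c R \<alpha> \<beta> where "tame_ball c (snd c p) R \<alpha> \<beta>" "p \<in> fst c" "cball (snd c p) (2 * R) \<subseteq> snd c ` (fst c \<inter> U)"
proof -
  obtain c where c: "c \<in> A" "p \<in> fst c" using ex_chart_at charts_atD by metis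
  obtain r where r: "r > 0" "cball (snd c p) r \<subseteq> snd c ` (fst c \<inter> U)"
    by (rule chart_ball[OF c assms])
  then have sub: "cball (snd c p) r \<subseteq> snd c ` fst c" by blast
  obtain \<alpha> \<beta> where ab: "\<alpha> > 0" "\<beta> > 0"
    "\<And>q v. \<lbrakk>q \<in> fst c; snd c q \<in> cball (snd c p) r; v \<in> tangent_space A q\<rbrakk> \<Longrightarrow> \<alpha> * norm (v c) \<le> tnorm g q v"
    "\<And>q v. \<lbrakk>q \<in> fst c; snd c q \<in> cball (snd c p) r; v \<in> tangent_space A q\<rbrakk> \<Longrightarrow> tnorm g q v \<le> \<beta> * norm (v c)"
    using tnorm_comparison[OF c(1) compact_cball sub] by metis
  show ?thesis
  proof (rule that[of c "r / 2" \<alpha> \<beta>])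
    show "tame_ball c (snd c p) (r / 2) \<alpha> \<beta>"
      unfolding tame_ball_def using c(1) r(1) sub ab by simp
  qed (use c r in auto)
qed

lemma tame_ball_upper:
  assumes tb: "tame_ball c y R \<alpha> \<beta>" and p: "p \<in> fst c" "snd c p \<in> cball y (2 * R)"
    and q: "q \<in> fst c" "snd c q \<in> cball y (2 * R)"
  shows "\<rho> p q \<le> \<beta> * norm (snd c q - snd c p)"
  by (rule riem_dist_le_chart[OF tame_ballD(1)[OF tb] convex_cball tame_ballD(5)[OF tb] p q tame_ballD(9)[OF tb]])

lemma tame_ball_lower:
  assumes tb: "tame_ball c y R \<alpha> \<beta>" and p: "p \<in> fst c" "snd c p \<in> cball y R" and q: "\<rho> p q < \<alpha> * R"
  shows "q \<in> fst c" "\<alpha> * norm (snd c q - snd c p) \<le> \<rho> p q"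
proof -
  have sub: "cball (snd c p) R \<subseteq> cball y (2 * R)"
  proof
    fix z assume "z \<in> cball (snd c p) R"
    then show "z \<in> cball y (2 * R)" using p(2) dist_triangle[of y z "snd c p"] by simp
  qed
  note ge = riem_dist_ge_chart[OF tame_ballD(1)[OF tb] p(1) order_trans[OF sub tame_ballD(5)[OF tb]] tame_ballD(2,3)[OF tb] _ q]
  show "q \<in> fst c" by (rule ge) (use sub tame_ballD(8)[OF tb] in blast)
  show "\<alpha> * norm (snd c q - snd c p) \<le> \<rho> p q" by (rule ge) (use sub tame_ballD(8)[OF tb] in blast)
qed

text \<open>Removes the smallness condition inside the ball. If \<open>\<rho> p q\<close> is at
  least \<open>\<alpha> * R\<close>, it is compared with the diameter \<open>2 * R\<close>; this is
  the origin of the factor 2.\<close>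

lemma tame_ball_lower_global:
  assumes tb: "tame_ball c y R \<alpha> \<beta>" and p: "p \<in> fst c" "snd c p \<in> cball y R"
    and q: "q \<in> fst c" "snd c q \<in> cball y R"
  shows "norm (snd c q - snd c p) \<le> (2 / \<alpha>) * \<rho> p q"
proof (cases "\<rho> p q < \<alpha> * R")
  case True
  then show ?thesis
    using tame_ball_lower(2)[OF tb p True] tame_ballD(3)[OF tb] riem_dist_nonneg[of p q]
    by (simp add: field_simps)
next
  case False
  have "norm (snd c q - snd c p) \<le> 2 * R"
    using p q dist_triangle2[of "snd c q" "snd c p" y] by (simp add: dist_norm dist_commute norm_minus_commute)
  then have "\<alpha> * norm (snd c q - snd c p) \<le> \<alpha> * (2 * R)"
    using tame_ballD(3)[OF tb] by (intro mult_left_mono) auto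
  then have "\<alpha> * norm (snd c q - snd c p) \<le> 2 * \<rho> p q" using False by simp
  then show ?thesis using tame_ballD(3)[OF tb] by (simp add: field_simps)
qed

text \<open>Closeness in \<open>\<rho>\<close> implies closeness in the manifold topology. This is
  what makes absolutely continuous curves continuous.\<close>

lemma riem_dist_neighbourhood:
  assumes "open U" "p \<in> U"
  obtains \<epsilon> where "\<epsilon> > 0" "\<forall>q. \<rho> p q < \<epsilon> \<longrightarrow> q \<in> U"
proof -
  obtain c R \<alpha> \<beta> where tb: "tame_ball c (snd c p) R \<alpha> \<beta>" and p: "p \<in> fst c"
    and sub: "cball (snd c p) (2 * R) \<subseteq> snd c ` (fst c \<inter> U)"
    by (rule tame_ball_exists[OF assms])
  note tbD = tame_ballD[OF tb]
  show ?thesis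
  proof (rule that[of "\<alpha> * R"], goal_cases)
    case 1
    show ?case using tbD by simp
  next
    case 2
    show ?case
    proof (intro allI impI)
    fix q assume q: "\<rho> p q < \<alpha> * R"
    have pc: "snd c p \<in> cball (snd c p) R" using tbD by simp
    note low = tame_ball_lower[OF tb p pc q]
    have "\<alpha> * norm (snd c q - snd c p) < \<alpha> * R" using low(2) q by simp
    then have "snd c q \<in> cball (snd c p) (2 * R)"
      using tbD(2,3) by (simp add: dist_norm norm_minus_commute)
    \<comment> \<open>Only the coordinates of \<open>q\<close> are known to be those of a point of
      \<open>U\<close>; injectivity of the chart identifies the two points.\<close>
    then obtain q' where "q' \<in> fst c" "q' \<in> U" "snd c q = snd c q'" using sub by blast
    then show "q \<in> U" using chart_inv_chart[OF tbD(1)] low(1) by metis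
    qed
  qed
qed

lemma abs_continuous_onI:
  assumes "m absolutely_integrable_on {a..b}"
    "\<And>s t. \<lbrakk>a \<le> s; s \<le> t; t \<le> b\<rbrakk> \<Longrightarrow> \<rho> (x s) (x t) \<le> integral {s..t} m"
  shows "abs_continuous_on A g a b x"
  unfolding abs_continuous_on_def
proof (intro exI[of _ m] conjI allI impI)
  fix s t assume st: "a \<le> s \<and> s \<le> t \<and> t \<le> b"
  then have "m absolutely_integrable_on {s..t}"
    by (intro absolutely_integrable_on_subinterval[OF assms(1)]) auto
  then show "\<rho> (x s) (x t) \<le> (LINT \<tau>:{s..t}|lebesgue. m \<tau>)"
    using assms(2)[of s t] st by (simp add: set_lebesgue_integral_eq_integral)
qed (rule assms(1))

lemma abs_continuous_onE:
  assumes "abs_continuous_on A g a b x"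
  obtains m where "m absolutely_integrable_on {a..b}"
    "\<And>s t. \<lbrakk>a \<le> s; s \<le> t; t \<le> b\<rbrakk> \<Longrightarrow> \<rho> (x s) (x t) \<le> integral {s..t} m"
proof -
  obtain m :: "real \<Rightarrow> real" where m: "m absolutely_integrable_on {a..b}"
    "\<forall>s t. a \<le> s \<and> s \<le> t \<and> t \<le> b \<longrightarrow> \<rho> (x s) (x t) \<le> (LINT \<tau>:{s..t}|lebesgue. m \<tau>)"
    using assms unfolding abs_continuous_on_def by (elim exE conjE)
  have "\<rho> (x s) (x t) \<le> integral {s..t} m" if st: "a \<le> s" "s \<le> t" "t \<le> b" for s t
  proof -
    have "m absolutely_integrable_on {s..t}"
      using st by (intro absolutely_integrable_on_subinterval[OF m(1)]) auto
    then show ?thesis using m(2)[rule_format, of s t] st by (simp add: set_lebesgue_integral_eq_integral)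
  qed
  with m(1) show ?thesis by (rule that)
qed

lemma abs_continuous_on_subinterval:
  assumes "abs_continuous_on A g a b x" "a \<le> a'" "b' \<le> b" shows "abs_continuous_on A g a' b' x"
proof -
  obtain m where m: "m absolutely_integrable_on {a..b}"
    "\<And>s t. \<lbrakk>a \<le> s; s \<le> t; t \<le> b\<rbrakk> \<Longrightarrow> \<rho> (x s) (x t) \<le> integral {s..t} m"
    using assms(1) by (rule abs_continuous_onE) blast
  show ?thesis
  proof (rule abs_continuous_onI)
    show "m absolutely_integrable_on {a'..b'}"
      using assms by (intro absolutely_integrable_on_subinterval[OF m(1)]) auto
    show "\<rho> (x s) (x t) \<le> integral {s..t} m" if "a' \<le> s" "s \<le> t" "t \<le> b'" for s t
      using that assms by (intro m(2)) auto
  qed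
qed

lemma abs_continuous_on_cong:
  assumes "abs_continuous_on A g a b x" "\<And>t. t \<in> {a..b} \<Longrightarrow> y t = x t" shows "abs_continuous_on A g a b y"
proof -
  obtain m where m: "m absolutely_integrable_on {a..b}"
    "\<And>s t. \<lbrakk>a \<le> s; s \<le> t; t \<le> b\<rbrakk> \<Longrightarrow> \<rho> (x s) (x t) \<le> integral {s..t} m"
    using assms(1) by (rule abs_continuous_onE) blast
  show ?thesis
    by (rule abs_continuous_onI[OF m(1)]) (use m(2) assms(2) in simp)
qed

lemma abs_continuous_on_combine:
  assumes "abs_continuous_on A g a b x" "abs_continuous_on A g b c x" "a \<le> b" "b \<le> c"
  shows "abs_continuous_on A g a c x"
proof -
  obtain m1 where m1: "m1 absolutely_integrable_on {a..b}"
    "\<And>s t. \<lbrakk>a \<le> s; s \<le> t; t \<le> b\<rbrakk> \<Longrightarrow> \<rho> (x s) (x t) \<le> integral {s..t} m1"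
    using assms(1) by (rule abs_continuous_onE) blast
  obtain m2 where m2: "m2 absolutely_integrable_on {b..c}"
    "\<And>s t. \<lbrakk>b \<le> s; s \<le> t; t \<le> c\<rbrakk> \<Longrightarrow> \<rho> (x s) (x t) \<le> integral {s..t} m2"
    using assms(2) by (rule abs_continuous_onE) blast
  define m where "m t = (if t \<le> b then m1 t else m2 t)" for t
  have i1: "integral {s..t} m = integral {s..t} m1" if "t \<le> b" for s t
    using that by (intro integral_cong) (auto simp: m_def)
  have i2: "integral {s..t} m = integral {s..t} m2" if "b \<le> s" for s t
    using that by (intro integral_spike[of "{b}"]) (auto simp: m_def)
  have int: "m absolutely_integrable_on {a..c}"
  proof (rule absolutely_integrable_on_combine[OF _ _ assms(3,4)])
    show "m absolutely_integrable_on {a..b}"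
      by (rule absolutely_integrable_spike[OF m1(1), of "{}"]) (auto simp: m_def)
    show "m absolutely_integrable_on {b..c}"
      by (rule absolutely_integrable_spike[OF m2(1), of "{b}"]) (auto simp: m_def)
  qed
  show ?thesis
  proof (rule abs_continuous_onI[OF int])
    fix s t assume st: "a \<le> s" "s \<le> t" "t \<le> c"
    consider "t \<le> b" | "b \<le> s" | "s \<le> b" "b \<le> t" by linarith
    then show "\<rho> (x s) (x t) \<le> integral {s..t} m"
    proof cases
      case 1 then show ?thesis using st m1(2)[of s t] i1 by simp
    next
      case 2 then show ?thesis using st m2(2)[of s t] i2 by simp
    next
      case 3
      have "m integrable_on {s..t}"
        using int st set_lebesgue_integral_eq_integral(1)
        by (meson atLeastatMost_subset_iff integrable_on_subinterval)
      then have "integral {s..b} m + integral {b..t} m = integral {s..t} m"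
        using 3 by (intro Henstock_Kurzweil_Integration.integral_combine)
      then show ?thesis
        using riem_dist_triangle[of "x s" "x t" "x b"] m1(2)[of s b] m2(2)[of b t] i1[of b s] i2[of b t] 3 st
        by simp
    qed
  qed
qed

text \<open>Distances along the curve are bounded by the increments of the indefinite integral of
  \<open>m\<close>, which is a continuous function.\<close>

lemma abs_continuous_on_imp_continuous_on:
  assumes "abs_continuous_on A g a b x" shows "continuous_on {a..b} x"
proof -
  obtain m where m: "m absolutely_integrable_on {a..b}"
    "\<And>s t. \<lbrakk>a \<le> s; s \<le> t; t \<le> b\<rbrakk> \<Longrightarrow> \<rho> (x s) (x t) \<le> integral {s..t} m"
    using assms(1) by (rule abs_continuous_onE) blast
  have mint: "m integrable_on {a..b}" using m(1) by (rule set_lebesgue_integral_eq_integral(1))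
  define H where "H t = integral {a..t} m" for t
  have Hcont: "continuous_on {a..b} H" unfolding H_def by (rule indefinite_integral_continuous_1[OF mint])
  have le: "\<rho> (x s) (x t) \<le> \<bar>H t - H s\<bar>" if "a \<le> s" "s \<le> t" "t \<le> b" for s t
  proof -
    have "m integrable_on {a..t}" using mint that by (meson atLeastatMost_subset_iff order_refl integrable_on_subinterval)
    then have "integral {a..s} m + integral {s..t} m = integral {a..t} m"
      using that by (intro Henstock_Kurzweil_Integration.integral_combine)
    then show ?thesis using m(2)[OF that] by (simp add: H_def)
  qed
  have dist_le: "\<rho> (x s) (x t) \<le> \<bar>H t - H s\<bar>" if "s \<in> {a..b}" "t \<in> {a..b}" for s t
    using le[of s t] le[of t s] that riem_dist_commute[of "x s" "x t"] by (cases "s \<le> t") auto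
  show ?thesis
    unfolding continuous_on_topological
  proof (intro ballI allI impI)
    fix s U assume s: "s \<in> {a..b}" and U: "open U" "x s \<in> U"
    obtain \<epsilon> where \<epsilon>: "\<epsilon> > 0" "\<forall>q. \<rho> (x s) q < \<epsilon> \<longrightarrow> q \<in> U" by (rule riem_dist_neighbourhood[OF U])
    obtain d where d: "d > 0" "\<forall>t\<in>{a..b}. dist t s < d \<longrightarrow> dist (H t) (H s) < \<epsilon>"
      using Hcont[unfolded continuous_on_iff, rule_format, OF s \<epsilon>(1)] by blast
    show "\<exists>V. open V \<and> s \<in> V \<and> (\<forall>t\<in>{a..b}. t \<in> V \<longrightarrow> x t \<in> U)"
    proof (intro exI[of _ "ball s d"] conjI ballI impI)
      fix t assume t: "t \<in> {a..b}" "t \<in> ball s d"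
      then have "dist t s < d" by (simp add: dist_commute)
      then have "dist (H t) (H s) < \<epsilon>" using d(2) t(1) by blast
      then show "x t \<in> U" using dist_le[OF s t(1)] by (intro \<epsilon>(2)[rule_format]) (simp add: dist_real_def)
    qed (use d in auto)
  qed
qed

text \<open>By the lower bound on \<open>\<rho>\<close> the coordinate increments are dominated by
  the integral of \<open>(2 / \<alpha>) * m t\<close>. Hence a velocity given off a negligible set
  integrates to the increment, and its integrability is part of the conclusion.\<close>

lemma abs_continuous_on_chart_integral:
  assumes x: "abs_continuous_on A g a b x" and ab: "a \<le> b" and tb: "tame_ball c y R \<alpha> \<beta>"
    and ball: "\<And>t. t \<in> {a..b} \<Longrightarrow> x t \<in> fst c \<and> snd c (x t) \<in> cball y R"
    and N: "negligible N" and v: "\<And>t. t \<in> {a<..<b} - N \<Longrightarrow> has_velocity A x t (v t)"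
  shows "((\<lambda>t. v t c) has_integral snd c (x b) - snd c (x a)) {a..b}"
proof -
  obtain m where m: "m absolutely_integrable_on {a..b}"
    "\<And>s t. \<lbrakk>a \<le> s; s \<le> t; t \<le> b\<rbrakk> \<Longrightarrow> \<rho> (x s) (x t) \<le> integral {s..t} m"
    using assms(1) by (rule abs_continuous_onE) blast
  have "((\<lambda>t. v t c) has_integral (snd c \<circ> x) b - (snd c \<circ> x) a) {a..b}"
  proof (rule has_integral_absolutely_continuous[OF ab])
    show "(\<lambda>t. (2 / \<alpha>) * m t) integrable_on {a..b}"
      using set_lebesgue_integral_eq_integral(1)[OF m(1)] by (rule integrable_on_mult_right)
    show "norm ((snd c \<circ> x) t - (snd c \<circ> x) s) \<le> integral {s..t} (\<lambda>t. (2 / \<alpha>) * m t)"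
      if st: "a \<le> s" "s \<le> t" "t \<le> b" for s t
    proof -
      have "norm (snd c (x t) - snd c (x s)) \<le> (2 / \<alpha>) * \<rho> (x s) (x t)"
        using ball[of s] ball[of t] st by (intro tame_ball_lower_global[OF tb]) auto
      also have "\<dots> \<le> (2 / \<alpha>) * integral {s..t} m"
        using m(2)[OF st] tame_ballD(3)[OF tb] by (intro mult_left_mono) auto
      finally show ?thesis by simp
    qed
    show "negligible (N \<union> {a, b})" using N by simp
    fix t assume t: "t \<in> {a..b} - (N \<union> {a, b})"
    then have tI: "t \<in> {a<..<b} - N" by auto
    have "isCont x t"
      using abs_continuous_on_imp_continuous_on[OF x] tI by (intro continuous_on_interior[of "{a..b}"]) auto
    moreover have "c \<in> charts_at A (x t)" using ball[of t] t tame_ballD(1)[OF tb] by (auto intro: charts_atI)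
    ultimately have "((snd c \<circ> x) has_vector_derivative v t c) (at t)"
      using v[OF tI] has_velocity_iff_chart by blast
    then show "((snd c \<circ> x) has_vector_derivative v t c) (at t within {a..b})"
      by (rule has_vector_derivative_at_within)
  qed
  then show ?thesis by simp
qed

text \<open>The opposite passage, from coordinates to \<open>\<rho>\<close>, by the length of
  coordinate segments.\<close>

lemma abs_continuous_on_chartI:
  assumes tb: "tame_ball c y R \<alpha> \<beta>" and H: "H absolutely_integrable_on {a..b}"
    and x: "\<And>t. t \<in> {a..b} \<Longrightarrow> x t \<in> fst c \<and> snd c (x t) \<in> cball y R"
    and le: "\<And>s t. \<lbrakk>a \<le> s; s \<le> t; t \<le> b\<rbrakk> \<Longrightarrow> norm (snd c (x t) - snd c (x s)) \<le> integral {s..t} H"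
  shows "abs_continuous_on A g a b x"
proof (rule abs_continuous_onI)
  show "(\<lambda>t. \<beta> * H t) absolutely_integrable_on {a..b}"
    using absolutely_integrable_scaleR_left[OF H, of \<beta>] by simp
  fix s t assume st: "a \<le> s" "s \<le> t" "t \<le> b"
  have "x s \<in> fst c" "x t \<in> fst c" "snd c (x s) \<in> cball y (2 * R)" "snd c (x t) \<in> cball y (2 * R)"
    using x[of s] x[of t] st tame_ballD(7)[OF tb] by auto
  then have "\<rho> (x s) (x t) \<le> \<beta> * norm (snd c (x t) - snd c (x s))"
    by (intro tame_ball_upper[OF tb])
  also have "\<dots> \<le> \<beta> * integral {s..t} H"
    using le[OF st] tame_ballD(4)[OF tb] by (intro mult_left_mono) auto
  finally show "\<rho> (x s) (x t) \<le> integral {s..t} (\<lambda>t. \<beta> * H t)" by simp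
qed

section \<open>Solutions\<close>

lemma is_solutionD:
  assumes "is_solution A g D b t0 x0 I x"
  shows "is_interval I" "t0 \<in> I" "x ` I \<subseteq> D" "locally_abs_continuous_on A g I x" "x t0 = x0"
    "AE t in lebesgue. t \<in> interior I \<longrightarrow> has_velocity A x t (b t (x t))"
  using assms unfolding is_solution_def by auto

lemma is_solution_abs_continuous:
  "is_solution A g D b t0 x0 I x \<Longrightarrow> a \<le> b' \<Longrightarrow> {a..b'} \<subseteq> I \<Longrightarrow> abs_continuous_on A g a b' x"
  using is_solutionD(4) unfolding locally_abs_continuous_on_def by blast

text \<open>Besides restricting the interval, this moves the initial time: a solution can be based
  at a gluing time and afterwards based at \<open>t0\<close> again.\<close>

lemma is_solution_subset:
  assumes "is_solution A g D b t0 x0 I x" "J \<subseteq> I" "is_interval J" "t1 \<in> J"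
  shows "is_solution A g D b t1 (x t1) J x"
  unfolding is_solution_def
proof (intro conjI)
  show "x ` J \<subseteq> D" using is_solutionD(3)[OF assms(1)] assms(2) by blast
  show "locally_abs_continuous_on A g J x"
    using is_solutionD(4)[OF assms(1)] assms(2) unfolding locally_abs_continuous_on_def by blast
  show "AE t in lebesgue. t \<in> interior J \<longrightarrow> has_velocity A x t (b t (x t))"
    using is_solutionD(6)[OF assms(1)] by eventually_elim (use interior_mono[OF assms(2)] in blast)
qed (use assms in auto)

lemma is_solution_glue:
  assumes x: "is_solution A g D b c p I x" and w: "is_solution A g D b c p J w"
    and I: "I \<subseteq> {..c}" and J: "J \<subseteq> {c..}"
  shows "is_solution A g D b c p (I \<union> J) (\<lambda>t. if t \<le> c then x t else w t)"
proof -
  define z where "z t = (if t \<le> c then x t else w t)" for t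
  have zx: "z t = x t" if "t \<le> c" for t using that by (simp add: z_def)
  have zw: "z t = w t" if "c \<le> t" for t
    using that is_solutionD(5)[OF x] is_solutionD(5)[OF w] by (cases "t = c") (auto simp: z_def)
  have c: "c \<in> I" "c \<in> J" using is_solutionD(2)[OF x] is_solutionD(2)[OF w] by auto
  have int: "a \<in> I \<Longrightarrow> b' \<in> I \<Longrightarrow> a \<le> t \<Longrightarrow> t \<le> b' \<Longrightarrow> t \<in> I"
    "a \<in> J \<Longrightarrow> b' \<in> J \<Longrightarrow> a \<le> t \<Longrightarrow> t \<le> b' \<Longrightarrow> t \<in> J" for a b' t
    using is_solutionD(1)[OF x] is_solutionD(1)[OF w] unfolding is_interval_1 by blast+
  have inI: "t \<in> I" if "t \<in> I \<union> J" "t \<le> c" for t using that c J by force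
  have inJ: "t \<in> J" if "t \<in> I \<union> J" "c \<le> t" for t using that c I by force
  have "is_solution A g D b c p (I \<union> J) z"
    unfolding is_solution_def
  proof (intro conjI)
    show "is_interval (I \<union> J)"
      unfolding is_interval_1
    proof (intro ballI allI impI)
      fix a b' t assume a: "a \<in> I \<union> J" "b' \<in> I \<union> J" "a \<le> t \<and> t \<le> b'"
      show "t \<in> I \<union> J"
      proof (cases "t \<le> c")
        case True then show ?thesis using int(1)[of a c t] inI[OF a(1)] a(3) c by auto
      next
        case False then show ?thesis using int(2)[of c b' t] inJ[OF a(2)] a(3) c by auto
      qed
    qed
    show "c \<in> I \<union> J" using c by blast
    show "z ` (I \<union> J) \<subseteq> D"
    proof
      fix q assume "q \<in> z ` (I \<union> J)"
      then obtain t where t: "t \<in> I \<union> J" "q = z t" by blast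
      show "q \<in> D"
      proof (cases "t \<le> c")
        case True then show ?thesis using inI[OF t(1)] t(2) zx is_solutionD(3)[OF x] by auto
      next
        case False then show ?thesis using inJ[OF t(1)] t(2) zw[of t] is_solutionD(3)[OF w] by auto
      qed
    qed
    show "z c = p" using zx is_solutionD(5)[OF x] by simp
    show "locally_abs_continuous_on A g (I \<union> J) z"
      unfolding locally_abs_continuous_on_def
    proof (intro allI impI)
      fix a b' assume ab: "a \<le> b' \<and> {a..b'} \<subseteq> I \<union> J"
      have left: "abs_continuous_on A g a r z" if "a \<le> r" "r \<le> b'" "r \<le> c" for r
      proof (rule abs_continuous_on_cong)
        have "{a..r} \<subseteq> I" using ab that inI by force
        then show "abs_continuous_on A g a r x" using that by (intro is_solution_abs_continuous[OF x])
      qed (use that zx in auto)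
      have right: "abs_continuous_on A g r b' z" if "a \<le> r" "r \<le> b'" "c \<le> r" for r
      proof (rule abs_continuous_on_cong)
        have "{r..b'} \<subseteq> J"
        proof
          fix u assume u: "u \<in> {r..b'}"
          then have "u \<in> {a..b'}" "c \<le> u" using that by auto
          then show "u \<in> J" using ab by (intro inJ subsetD[of "{a..b'}" "I \<union> J" u]) simp_all
        qed
        then show "abs_continuous_on A g r b' w" using that by (intro is_solution_abs_continuous[OF w])
        show "z t = w t" if "t \<in> {r..b'}" for t using that \<open>c \<le> r\<close> by (intro zw) simp
      qed
      consider "b' \<le> c" | "c \<le> a" | "a \<le> c" "c \<le> b'" by linarith
      then show "abs_continuous_on A g a b' z"
      proof cases
        case 1
        then show ?thesis using ab left[of b'] by simp
      next
        case 2
        then show ?thesis using ab right[of a] by simp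
      next
        case 3
        then show ?thesis using abs_continuous_on_combine[OF left[of c] right[of c]] by simp
      qed
    qed
    \<comment> \<open>At the junction the derivatives from the left and from the right may differ,
      so the time \<open>c\<close> is put among the exceptional ones.\<close>
    have "AE t in lebesgue. t \<noteq> c" by (simp add: AE_lebesgue_iff_negligible)
    with is_solutionD(6)[OF x] is_solutionD(6)[OF w]
    show "AE t in lebesgue. t \<in> interior (I \<union> J) \<longrightarrow> has_velocity A z t (b t (z t))"
    proof eventually_elim
      case (elim t)
      show ?case
      proof
        assume t: "t \<in> interior (I \<union> J)"
        show "has_velocity A z t (b t (z t))"
        proof (cases "t < c")
          case True
          \<comment> \<open>Left of \<open>c\<close> the union consists of points of
            \<open>I\<close> only, so an interior time of the union is interior to \<open>I\<close>
            and the velocity of \<open>x\<close> is available.\<close>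
          have "interior (I \<union> J) \<inter> {..<c} \<subseteq> interior I"
          proof (rule interior_maximal)
            show "interior (I \<union> J) \<inter> {..<c} \<subseteq> I" using inI interior_subset[of "I \<union> J"] by force
          qed (intro open_Int open_interior open_lessThan)
          then have "has_velocity A x t (b t (x t))" using elim t True by auto
          then have "has_velocity A z t (b t (x t))"
            by (rule has_velocity_transform[of _ _ _ "{..<c}"]) (use True zx in auto)
          then show ?thesis using zx[of t] True by simp
        next
          case False
          then have tc: "c < t" using elim(3) by simp
          have "interior (I \<union> J) \<inter> {c<..} \<subseteq> interior J"
          proof (rule interior_maximal)
            show "interior (I \<union> J) \<inter> {c<..} \<subseteq> J" using inJ interior_subset[of "I \<union> J"] by force
          qed (intro open_Int open_interior open_greaterThan)
          then have "has_velocity A w t (b t (w t))" using elim t tc by auto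
          then have "has_velocity A z t (b t (w t))"
            by (rule has_velocity_transform[of _ _ _ "{c<..}"]) (use tc zw in auto)
          then show ?thesis using zw[of t] tc by simp
        qed
      qed
    qed
  qed
  then show ?thesis unfolding z_def .
qed

section \<open>Time reversal\<close>

definition reverse_field :: "(real \<Rightarrow> 'm \<Rightarrow> ('m, 'e) tvector) \<Rightarrow> real \<Rightarrow> 'm \<Rightarrow> ('m, 'e) tvector" where
  "reverse_field b t p = (\<lambda>c. - b (- t) p c)"

lemma reverse_reverse_field [simp]: "reverse_field (reverse_field b) = b"
  by (simp add: reverse_field_def fun_eq_iff)

lemma is_solution_reverse:
  assumes x: "is_solution A g D b t0 x0 I x"
  shows "is_solution A g D (reverse_field b) (- t0) x0 (uminus ` I) (\<lambda>t. x (- t))"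
  unfolding is_solution_def
proof (intro conjI)
  show "is_interval (uminus ` I)"
    using is_solutionD(1)[OF x] by (simp add: is_interval_uminus)
  show "- t0 \<in> uminus ` I" using is_solutionD(2)[OF x] by blast
  show "(\<lambda>t. x (- t)) ` uminus ` I \<subseteq> D" using is_solutionD(3)[OF x] by auto
  show "x (- (- t0)) = x0" using is_solutionD(5)[OF x] by simp
  show "locally_abs_continuous_on A g (uminus ` I) (\<lambda>t. x (- t))"
    unfolding locally_abs_continuous_on_def
  proof (intro allI impI)
    fix a b' assume ab: "a \<le> b' \<and> {a..b'} \<subseteq> uminus ` I"
    then have "{- b'..- a} \<subseteq> I" by (auto simp: subset_iff image_iff) (metis add.inverse_inverse minus_le_iff le_minus_iff)
    then have "abs_continuous_on A g (- b') (- a) x" using ab by (intro is_solution_abs_continuous[OF x]) auto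
    then obtain m where m: "m absolutely_integrable_on {- b'..- a}"
      "\<And>s t. \<lbrakk>- b' \<le> s; s \<le> t; t \<le> - a\<rbrakk> \<Longrightarrow> \<rho> (x s) (x t) \<le> integral {s..t} m"
      by (rule abs_continuous_onE) blast
    show "abs_continuous_on A g a b' (\<lambda>t. x (- t))"
    proof (rule abs_continuous_onI)
      show "(\<lambda>t. m (- t)) absolutely_integrable_on {a..b'}"
        using m(1) absolutely_integrable_reflect_real[where f = m and b = "- a" and a = "- b'"] by simp
      show "\<rho> (x (- s)) (x (- t)) \<le> integral {s..t} (\<lambda>t. m (- t))" if "a \<le> s" "s \<le> t" "t \<le> b'" for s t
        using m(2)[of "- t" "- s"] that riem_dist_commute[of "x (- s)"]
          Henstock_Kurzweil_Integration.integral_reflect_real[where f = m and b = "- s" and a = "- t"] by simp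
    qed
  qed
  from AE_lebesgue_reflect[OF is_solutionD(6)[OF x]]
  show "AE t in lebesgue. t \<in> interior (uminus ` I) \<longrightarrow>
      has_velocity A (\<lambda>t. x (- t)) t (reverse_field b t (x (- t)))"
  proof eventually_elim
    case (elim t)
    show ?case
    proof
      assume "t \<in> interior (uminus ` I)"
      then have "- t \<in> interior I" by (auto simp: interior_negations)
      then have "has_velocity A x (- 1 * t + 0) (b (- t) (x (- t)))" using elim by simp
      from has_velocity_affine[OF this] show "has_velocity A (\<lambda>t. x (- t)) t (reverse_field b t (x (- t)))"
        by (simp add: reverse_field_def)
    qed
  qed
qed

end

section \<open>Vector fields of Caratheodory type: local existence, extension and escape from
  compact sets\<close>

locale caratheodory_field = riemannian_manifold A g
  for A :: "('m::{t2_space, second_countable_topology}, 'e::euclidean_space) chart set"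
    and g :: "('m, 'e) metric_tensor" +
  fixes D :: "'m set" and b :: "real \<Rightarrow> 'm \<Rightarrow> ('m, 'e) tvector"
  assumes open_D: "open D"
    and field: "time_dependent_field_on A D b"
    and field_measurable: "x \<in> D \<Longrightarrow> tangent_measurable A x (\<lambda>t. b t x)"
    and field_continuous: "AE t in lebesgue. continuous_field_on A D (b t)"
    and field_bounded: "compact J \<Longrightarrow> J \<subseteq> UNIV \<times> D \<Longrightarrow>
      \<exists>h. locally_integrable h \<and> (AE t in lebesgue. \<forall>x\<in>D. (t, x) \<in> J \<longrightarrow> tnorm g x (b t x) \<le> h t)"
begin

lemma field_tangent: "p \<in> D \<Longrightarrow> b t p \<in> tangent_space A p"
  using field unfolding time_dependent_field_on_def by blast

lemma reverse_caratheodory_field: "caratheodory_field A g D (reverse_field b)"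
proof unfold_locales
  show "open D" by (rule open_D)
  have scale: "reverse_field b t p = (\<lambda>c. (- 1) *\<^sub>R b (- t) p c)" for t p by (simp add: reverse_field_def)
  show "time_dependent_field_on A D (reverse_field b)"
    unfolding time_dependent_field_on_def scale by (intro allI ballI tangent_space_scale field_tangent)
  show "tangent_measurable A x (\<lambda>t. reverse_field b t x)" if x: "x \<in> D" for x
    unfolding tangent_measurable_def reverse_field_def
  proof
    fix c assume "c \<in> charts_at A x"
    then have "(\<lambda>t. b t x c) \<in> borel_measurable lebesgue"
      using field_measurable[OF x] unfolding tangent_measurable_def by blast
    from measurable_compose[OF uminus_lebesgue_measurable this]
    show "(\<lambda>t. - b (- t) x c) \<in> borel_measurable lebesgue" by simp
  qed
  show "AE t in lebesgue. continuous_field_on A D (reverse_field b t)"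
    using AE_lebesgue_reflect[OF field_continuous]
    by eventually_elim (auto simp: continuous_field_on_def reverse_field_def intro: continuous_on_minus)
  fix J :: "(real \<times> 'm) set" assume J: "compact J" "J \<subseteq> UNIV \<times> D"
  \<comment> \<open>The reversed field on \<open>J\<close> is the original one on the reflected set,
    so the reflected majorant serves.\<close>
  define J' where "J' = (\<lambda>z. (- fst z, snd z)) ` J"
  have "compact J'" "J' \<subseteq> UNIV \<times> D"
    using J unfolding J'_def by (auto intro!: compact_continuous_image continuous_intros)
  then obtain h where h: "locally_integrable h"
    "AE t in lebesgue. \<forall>x\<in>D. (t, x) \<in> J' \<longrightarrow> tnorm g x (b t x) \<le> h t"
    using field_bounded by blast
  have "locally_integrable (\<lambda>t. h (- t))"
    unfolding locally_integrable_def
  proof (intro allI)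
    fix a b' :: real
    show "(\<lambda>t. h (- t)) absolutely_integrable_on {a..b'}"
      using h(1) absolutely_integrable_reflect_real[where f = h and b = "- a" and a = "- b'"] by (simp add: locally_integrable_def)
  qed
  moreover have "AE t in lebesgue. \<forall>x\<in>D. (t, x) \<in> J \<longrightarrow> tnorm g x (reverse_field b t x) \<le> h (- t)"
    using AE_lebesgue_reflect[OF h(2)]
  proof eventually_elim
    case (elim t)
    show ?case
    proof (intro ballI impI)
      fix x assume x: "x \<in> D" "(t, x) \<in> J"
      then have "(- t, x) \<in> J'" unfolding J'_def by force
      then have "tnorm g x (b (- t) x) \<le> h (- t)" using elim x by blast
      then show "tnorm g x (reverse_field b t x) \<le> h (- t)"
        unfolding scale tnorm_scale[OF field_tangent[OF x(1)]] by simp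
    qed
  qed
  ultimately show "\<exists>h. locally_integrable h \<and>
      (AE t in lebesgue. \<forall>x\<in>D. (t, x) \<in> J \<longrightarrow> tnorm g x (reverse_field b t x) \<le> h t)" by blast
qed

text \<open>The bound on compact sets is applied to \<open>{a..a'} \<times> Q\<close>, and division
  by \<open>\<alpha>\<close> turns the Riemannian norm into the coordinate norm. The time interval
  is closed, so the majorant is integrable right up to the end time of a solution.\<close>

lemma chart_field_bound:
  assumes tb: "tame_ball c y R \<alpha> \<beta>" and sub: "cball y (2 * R) \<subseteq> snd c ` (fst c \<inter> D)"
  obtains H where "H absolutely_integrable_on {a..a'}" "\<And>t. 0 \<le> H t"
    "AE t in lebesgue. t \<in> {a..a'} \<longrightarrow>
      (\<forall>p. p \<in> fst c \<longrightarrow> snd c p \<in> cball y (2 * R) \<longrightarrow> norm (b t p c) \<le> H t)"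
proof -
  note tbD = tame_ballD[OF tb]
  define Q where "Q = {p \<in> fst c. snd c p \<in> cball y (2 * R)}"
  have QD: "Q \<subseteq> D"
  proof
    fix p assume p: "p \<in> Q"
    then obtain q where "q \<in> fst c" "q \<in> D" "snd c p = snd c q" using sub unfolding Q_def by blast
    then show "p \<in> D" using p chart_inv_chart[OF tbD(1)] unfolding Q_def by (metis mem_Collect_eq)
  qed
  have "compact ({a..a'} \<times> Q)"
    unfolding Q_def by (intro compact_Times compact_Icc compact_chart_vimage[OF tbD(1) _ tbD(5)]) simp
  moreover have "{a..a'} \<times> Q \<subseteq> UNIV \<times> D" using QD by blast
  ultimately obtain h where h: "locally_integrable h"
    "AE t in lebesgue. \<forall>x\<in>D. (t, x) \<in> {a..a'} \<times> Q \<longrightarrow> tnorm g x (b t x) \<le> h t"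
    using field_bounded by blast
  show ?thesis
  \<comment> \<open>The absolute value makes the majorant nonnegative at every time, including the
    exceptional ones.\<close>
  proof (rule that[of "\<lambda>t. (1 / \<alpha>) *\<^sub>R \<bar>h t\<bar>"])
    have "h absolutely_integrable_on {a..a'}" using h(1) by (simp add: locally_integrable_def)
    from absolutely_integrable_scaleR_left[OF absolutely_integrable_norm[OF this], of "1 / \<alpha>"]
    show "(\<lambda>t. (1 / \<alpha>) *\<^sub>R \<bar>h t\<bar>) absolutely_integrable_on {a..a'}" by (simp add: o_def)
    show "0 \<le> (1 / \<alpha>) *\<^sub>R \<bar>h t\<bar>" for t using tbD(3) by simp
    show "AE t in lebesgue. t \<in> {a..a'} \<longrightarrow>
      (\<forall>p. p \<in> fst c \<longrightarrow> snd c p \<in> cball y (2 * R) \<longrightarrow> norm (b t p c) \<le> (1 / \<alpha>) *\<^sub>R \<bar>h t\<bar>)"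
      using h(2)
    proof eventually_elim
      case (elim t)
      show ?case
      proof (intro impI allI)
        fix p assume t: "t \<in> {a..a'}" and p: "p \<in> fst c" "snd c p \<in> cball y (2 * R)"
        have pQ: "p \<in> Q" "p \<in> D" using p QD by (auto simp: Q_def)
        have "\<alpha> * norm (b t p c) \<le> tnorm g p (b t p)" by (rule tbD(8)[OF p field_tangent[OF pQ(2)]])
        also have "\<dots> \<le> h t" using elim t pQ by blast
        finally show "norm (b t p c) \<le> (1 / \<alpha>) *\<^sub>R \<bar>h t\<bar>" using tbD(3) by (simp add: field_simps)
      qed
    qed
  qed
qed

text \<open>This one-sided form serves twice: glued to a reversed copy it gives a two-sided
  solution, and applied at an end time it continues a given solution.\<close>

lemma local_existence_right:
  assumes p: "p \<in> D"
  obtains \<delta> x where "\<delta> > 0" "is_solution A g D b t0 p {t0..t0 + \<delta>} x"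
proof -
  obtain c R \<alpha> \<beta> where tb: "tame_ball c (snd c p) R \<alpha> \<beta>" and pc: "p \<in> fst c"
    and sub: "cball (snd c p) (2 * R) \<subseteq> snd c ` (fst c \<inter> D)"
    by (rule tame_ball_exists[OF open_D p])
  note tbD = tame_ballD[OF tb]
  define y0 where "y0 = snd c p"
  obtain H where H: "H absolutely_integrable_on {t0..t0 + 1}" "\<And>t. 0 \<le> H t"
    and Hb: "AE t in lebesgue. t \<in> {t0..t0 + 1} \<longrightarrow>
      (\<forall>p'. p' \<in> fst c \<longrightarrow> snd c p' \<in> cball (snd c p) (2 * R) \<longrightarrow> norm (b t p' c) \<le> H t)"
    using chart_field_bound[OF tb sub, where a = t0 and a' = "t0 + 1"] by blast
  have Hint: "H integrable_on {t0..t0 + 1}" using H(1) by (rule set_lebesgue_integral_eq_integral(1))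
  \<comment> \<open>The smallness of the integral is what confines the coordinate solution to the
    ball of radius \<open>R\<close>; \<open>\<delta> \<le> 1\<close> keeps to the interval where
    \<open>H\<close> is a bound.\<close>
  obtain \<delta> where \<delta>: "0 < \<delta>" "\<delta> \<le> 1" "integral {t0..t0 + \<delta>} H \<le> R"
  proof -
    have "continuous_on {t0..t0 + 1} (\<lambda>t. integral {t0..t} H)" by (rule indefinite_integral_continuous_1[OF Hint])
    then obtain d where d: "d > 0"
      "\<forall>t\<in>{t0..t0 + 1}. dist t t0 < d \<longrightarrow> dist (integral {t0..t} H) (integral {t0..t0} H) < R"
      using tbD(2) unfolding continuous_on_iff by (metis atLeastAtMost_iff le_add_same_cancel1 order_refl zero_le_one)
    define \<delta> where "\<delta> = min 1 (d / 2)"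
    have "0 < \<delta>" "\<delta> \<le> 1" "\<delta> < d" using d(1) by (auto simp: \<delta>_def)
    moreover from this have "dist (integral {t0..t0 + \<delta>} H) (integral {t0..t0} H) < R"
      using d(2) by (simp add: dist_real_def)
    ultimately show ?thesis by (intro that[of \<delta>]) (simp_all add: dist_real_def)
  qed
  let ?I = "{t0..t0 + \<delta>}"
  have subI: "?I \<subseteq> {t0..t0 + 1}" using \<delta> by auto
  have H\<delta>: "H absolutely_integrable_on ?I" by (rule absolutely_integrable_on_subinterval[OF H(1) subI])
  have H\<delta>int: "H integrable_on ?I" using H\<delta> by (rule set_lebesgue_integral_eq_integral(1))
  define f where "f t y = b t (chart_inv c y) c" for t y
  define B where "B = cball y0 R"
  have B: "y \<in> snd c ` fst c" "chart_inv c y \<in> fst c" "snd c (chart_inv c y) = y" "chart_inv c y \<in> D"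
    "y \<in> cball (snd c p) (2 * R)" if "y \<in> B" for y
  proof -
    show y2: "y \<in> cball (snd c p) (2 * R)" using that tbD(7) unfolding B_def y0_def by blast
    then obtain q where q: "q \<in> fst c" "q \<in> D" "y = snd c q" using sub by blast
    show "y \<in> snd c ` fst c" "chart_inv c y \<in> fst c" "snd c (chart_inv c y) = y" "chart_inv c y \<in> D"
      unfolding q(3) chart_inv_chart[OF tbD(1) q(1)] using q by auto
  qed
  have fH: "AE t in lebesgue. t \<in> ?I \<longrightarrow> (\<forall>y\<in>B. norm (f t y) \<le> H t)"
    using Hb
  proof eventually_elim
    case (elim t)
    then show ?case unfolding f_def using B subI by (metis subsetD)
  qed
  obtain y where y: "continuous_on ?I y" "(\<lambda>t. f t (y t)) integrable_on ?I"
    "\<And>t. t \<in> ?I \<Longrightarrow> y t \<in> B" "\<And>t. t \<in> ?I \<Longrightarrow> y t = y0 + integral {t0..t} (\<lambda>s. f s (y s))"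
  proof (rule caratheodory_existence_cball[of t0 "t0 + \<delta>" R y0 f H, folded B_def])
    show "t0 < t0 + \<delta>" "0 \<le> R" using \<delta> tbD(2) by auto
    show "(\<lambda>t. f t y) \<in> borel_measurable lebesgue" if "y \<in> B" for y
      using field_measurable[OF B(4)[OF that]] charts_atI[OF tbD(1) B(2)[OF that]]
      unfolding tangent_measurable_def f_def by blast
    show "AE t in lebesgue. t \<in> ?I \<longrightarrow> continuous_on B (f t)"
      using field_continuous
    proof eventually_elim
      case (elim t)
      then have 1: "continuous_on (D \<inter> fst c) (\<lambda>x. b t x c)" using tbD(1) unfolding continuous_field_on_def by blast
      have 2: "continuous_on B (chart_inv c)"
        by (rule continuous_on_subset[OF continuous_on_chart_inv[OF tbD(1)]]) (use B(1) in blast)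
      have "continuous_on B (f t)"
        unfolding f_def by (rule continuous_on_compose2[OF 1 2]) (use B in blast)
      then show ?case by simp
    qed
  qed (use fH H\<delta>int \<delta> in auto)
  define x where "x t = chart_inv c (y t)" for t
  have x: "x t \<in> fst c" "snd c (x t) = y t" "x t \<in> D" if "t \<in> ?I" for t
    unfolding x_def using B[OF y(3)[OF that]] by auto
  have incr: "norm (y t - y s) \<le> integral {s..t} H" if st: "t0 \<le> s" "s \<le> t" "t \<le> t0 + \<delta>" for s t
  proof -
    have sub: "F integrable_on {r..t}" if "F integrable_on ?I" "t0 \<le> r" for F :: "real \<Rightarrow> 'b::euclidean_space" and r
      using that st by (intro integrable_on_subinterval[OF that(1)]) auto
    have "integral {t0..s} (\<lambda>s. f s (y s)) + integral {s..t} (\<lambda>s. f s (y s)) = integral {t0..t} (\<lambda>s. f s (y s))"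
      using st by (intro Henstock_Kurzweil_Integration.integral_combine sub y) auto
    then have "y t - y s = integral {s..t} (\<lambda>s. f s (y s))"
      using y(4)[of s] y(4)[of t] st by (simp add: algebra_simps)
    moreover have "norm (integral {s..t} (\<lambda>s. f s (y s))) \<le> integral {s..t} H"
    proof (rule integral_norm_bound_off_negligible)
      show "negligible {t. \<not> (t \<in> ?I \<longrightarrow> (\<forall>y\<in>B. norm (f t y) \<le> H t))}"
        using fH by (simp only: AE_lebesgue_iff_negligible)
      show "norm (f r (y r)) \<le> H r" if "r \<in> {s..t} - {t. \<not> (t \<in> ?I \<longrightarrow> (\<forall>y\<in>B. norm (f t y) \<le> H t))}" for r
      proof -
        have "r \<in> ?I" using that st by auto
        then show ?thesis using that y(3) by blast
      qed
    qed (use st in \<open>auto intro: sub y H\<delta>int\<close>)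
    ultimately show ?thesis by simp
  qed
  have "is_solution A g D b t0 p ?I x"
    unfolding is_solution_def
  proof (intro conjI)
    show "is_interval ?I" by simp
    show "t0 \<in> ?I" using \<delta> by simp
    show "x ` ?I \<subseteq> D" using x(3) by blast
    show "x t0 = p" unfolding x_def using y(4)[of t0] \<delta> chart_inv_chart[OF tbD(1) pc] by (simp add: y0_def)
    have AC: "abs_continuous_on A g t0 (t0 + \<delta>) x"
    proof (rule abs_continuous_on_chartI[OF tb H\<delta>])
      show "x t \<in> fst c \<and> snd c (x t) \<in> cball (snd c p) R" if "t \<in> ?I" for t
        using x[OF that] y(3)[OF that] unfolding B_def y0_def by simp
      show "norm (snd c (x t) - snd c (x s)) \<le> integral {s..t} H" if "t0 \<le> s" "s \<le> t" "t \<le> t0 + \<delta>" for s t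
        using incr[OF that] x(2)[of s] x(2)[of t] that by simp
    qed
    then show "locally_abs_continuous_on A g ?I x"
      unfolding locally_abs_continuous_on_def by (auto intro: abs_continuous_on_subinterval)
    obtain N where N: "negligible N" "\<And>t. t \<in> {t0<..<t0 + \<delta>} - N \<Longrightarrow>
        ((\<lambda>u. integral {t0..u} (\<lambda>s. f s (y s))) has_vector_derivative f t (y t)) (at t)"
      using indefinite_integral_has_vector_derivative_ae[OF y(2)] by blast
    have "AE t in lebesgue. t \<notin> N" using N(1) by (simp add: AE_lebesgue_iff_negligible)
    then show "AE t in lebesgue. t \<in> interior ?I \<longrightarrow> has_velocity A x t (b t (x t))"
    proof eventually_elim
      case (elim t)
      show ?case
      proof
        assume "t \<in> interior ?I"
        then have t: "t \<in> {t0<..<t0 + \<delta>}" by simp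
        then have tI: "t \<in> ?I" by auto
        have "((\<lambda>u. y0 + integral {t0..u} (\<lambda>s. f s (y s))) has_vector_derivative 0 + f t (y t)) (at t)"
          using N(2)[of t] t elim by (intro has_vector_derivative_add has_vector_derivative_const) auto
        then have "((snd c \<circ> x) has_vector_derivative 0 + f t (y t)) (at t)"
          by (rule has_vector_derivative_transform_within_open[of _ _ _ "{t0<..<t0 + \<delta>}"])
            (use t x(2) y(4) in auto)
        then have der: "((snd c \<circ> x) has_vector_derivative b t (x t) c) (at t)"
          by (simp add: f_def x_def)
        have ch: "c \<in> charts_at A (x t)" by (rule charts_atI[OF tbD(1) x(1)[OF tI]])
        have "b t (x t) = coord_vector A c (x t) (b t (x t) c)"
          using coord_vector_tangent[OF ch field_tangent[OF x(3)[OF tI]]] by simp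
        then show "has_velocity A x t (b t (x t))"
          unfolding has_velocity_def using ch der by blast
      qed
    qed
  qed
  with \<delta>(1) show ?thesis by (rule that)
qed

text \<open>The hypothesis \<open>return\<close> says that \<open>p\<close> is a cluster point of
  \<open>x\<close> at the time \<open>c\<close>. The limit \<open>q\<close> constructed below is
  never identified with \<open>p\<close>; what matters is that it lies in \<open>D\<close>.\<close>

lemma extend_beyond_right:
  assumes x: "is_solution A g D b t0 x0 {t0..<c} x" and tc: "t0 < c" and p: "p \<in> D"
    and return: "\<And>U \<tau>. \<lbrakk>open U; p \<in> U; \<tau> < c\<rbrakk> \<Longrightarrow> \<exists>t. t0 \<le> t \<and> \<tau> < t \<and> t < c \<and> x t \<in> U"
  obtains \<delta> x' where "\<delta> > 0" "is_solution A g D b t0 x0 {t0..c + \<delta>} x'" "\<And>t. t \<in> {t0..<c} \<Longrightarrow> x' t = x t"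
proof -
  obtain ch R \<alpha> \<beta> where tb: "tame_ball ch (snd ch p) R \<alpha> \<beta>" and pc: "p \<in> fst ch"
    and sub: "cball (snd ch p) (2 * R) \<subseteq> snd ch ` (fst ch \<inter> D)"
    by (rule tame_ball_exists[OF open_D p])
  note tbD = tame_ballD[OF tb]
  define y where "y = snd ch p"
  obtain H where H: "H absolutely_integrable_on {t0..c}" "\<And>t. 0 \<le> H t"
    and Hb: "AE t in lebesgue. t \<in> {t0..c} \<longrightarrow>
      (\<forall>p'. p' \<in> fst ch \<longrightarrow> snd ch p' \<in> cball (snd ch p) (2 * R) \<longrightarrow> norm (b t p' ch) \<le> H t)"
    using chart_field_bound[OF tb sub, where a = t0 and a' = c] by blast
  have Hint: "H integrable_on {t0..c}" using H(1) by (rule set_lebesgue_integral_eq_integral(1))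
  define G where "G t = integral {t0..t} H" for t
  have Gcont: "continuous_on {t0..c} G" unfolding G_def by (rule indefinite_integral_continuous_1[OF Hint])
  have GH: "G t - G s = integral {s..t} H" if "t0 \<le> s" "s \<le> t" "t \<le> c" for s t
  proof -
    have "H integrable_on {t0..t}" using that by (intro integrable_on_subinterval[OF Hint]) auto
    then have "integral {t0..s} H + integral {s..t} H = integral {t0..t} H"
      using that by (intro Henstock_Kurzweil_Integration.integral_combine)
    then show ?thesis by (simp add: G_def)
  qed
  have Gmono: "G s \<le> G t" if "t0 \<le> s" "s \<le> t" "t \<le> c" for s t
  proof -
    have "H integrable_on {s..t}" using that by (intro integrable_on_subinterval[OF Hint]) auto
    then have "0 \<le> integral {s..t} H" using H(2) by (intro integral_nonneg) auto
    then show ?thesis using GH[OF that] by simp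
  qed
  \<comment> \<open>The times at which the bound on the field or the differential equation may fail,
    gathered in one negligible set.\<close>
  define Bad where "Bad = {t. \<not> (t \<in> {t0..c} \<longrightarrow>
      (\<forall>p'. p' \<in> fst ch \<longrightarrow> snd ch p' \<in> cball (snd ch p) (2 * R) \<longrightarrow> norm (b t p' ch) \<le> H t))} \<union>
    {t. \<not> (t \<in> interior {t0..<c} \<longrightarrow> has_velocity A x t (b t (x t)))}"
  have Bad: "negligible Bad"
    using Hb is_solutionD(6)[OF x] unfolding Bad_def by (intro negligible_Un) (simp_all only: AE_lebesgue_iff_negligible)
  have good: "norm (b t q ch) \<le> H t" if "t \<notin> Bad" "t \<in> {t0..c}" "q \<in> fst ch" "snd ch q \<in> cball y (2 * R)" for t q
    using that unfolding Bad_def y_def by blast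
  have vel: "has_velocity A x t (b t (x t))" if "t \<notin> Bad" "t0 < t" "t < c" for t
    using that unfolding Bad_def by auto
  \<comment> \<open>\<open>G\<close> is a travel budget for the coordinates, valid only while the
    curve remains in the ball.\<close>
  have step: "norm (snd ch (x t) - snd ch (x s)) \<le> G t - G s"
    if st: "t0 \<le> s" "s \<le> t" "t < c" and ball: "\<And>r. r \<in> {s..t} \<Longrightarrow> x r \<in> fst ch \<and> snd ch (x r) \<in> ball y R" for s t
  proof -
    have ball': "x r \<in> fst ch \<and> snd ch (x r) \<in> cball (snd ch p) R" if "r \<in> {s..t}" for r
      using ball[OF that] unfolding y_def by auto
    have "abs_continuous_on A g s t x" using st by (intro is_solution_abs_continuous[OF x]) auto
    then have int: "((\<lambda>r. b r (x r) ch) has_integral snd ch (x t) - snd ch (x s)) {s..t}"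
      by (rule abs_continuous_on_chart_integral[OF _ st(2) tb ball' Bad]) (use st in \<open>auto intro!: vel\<close>)
    then have "norm (integral {s..t} (\<lambda>r. b r (x r) ch)) \<le> integral {s..t} H"
    proof (intro integral_norm_bound_off_negligible[OF Bad])
      show "H integrable_on {s..t}" using st by (intro integrable_on_subinterval[OF Hint]) auto
      show "norm (b r (x r) ch) \<le> H r" if r: "r \<in> {s..t} - Bad" for r
        using ball'[of r] r st tbD(7) unfolding y_def[symmetric] by (intro good) auto
    qed (auto simp: has_integral_iff)
    then show ?thesis using int GH[of s t] st by (simp add: has_integral_iff)
  qed
  \<comment> \<open>After \<open>\<tau>\<close> the remaining budget is less than
    \<open>R / 2\<close>, so a visit to the half ball at a later time \<open>t1\<close> cannot be
    followed by a departure from the full ball.\<close>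
  obtain \<tau> where \<tau>: "t0 \<le> \<tau>" "\<tau> < c" "G c - G \<tau> < R / 2"
  proof -
    obtain d where d: "d > 0" "\<forall>t\<in>{t0..c}. dist t c < d \<longrightarrow> dist (G t) (G c) < R / 2"
      using Gcont[unfolded continuous_on_iff, rule_format, of c "R / 2"] tc tbD(2) by auto
    define \<tau> where "\<tau> = max t0 (c - d / 2)"
    have "t0 \<le> \<tau>" "\<tau> < c" "dist \<tau> c < d" using d(1) tc by (auto simp: \<tau>_def dist_real_def)
    moreover from this have "dist (G \<tau>) (G c) < R / 2" using d(2) by auto
    then have "G c - G \<tau> < R / 2" unfolding dist_real_def by linarith
    ultimately show ?thesis by (intro that[of \<tau>])
  qed
  have "open {q \<in> fst ch. snd ch q \<in> ball y (R / 2)}" by (rule open_chart_vimage[OF tbD(1)]) simp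
  moreover have "p \<in> {q \<in> fst ch. snd ch q \<in> ball y (R / 2)}" using pc tbD(2) by (simp add: y_def)
  ultimately obtain t1 where t1: "t0 \<le> t1" "\<tau> < t1" "t1 < c" "x t1 \<in> fst ch" "snd ch (x t1) \<in> ball y (R / 2)"
    using return[of _ \<tau>] \<tau>(2) by blast
  have start: "x t1 \<in> fst ch" "snd ch (x t1) \<in> ball y R" using t1(4,5) tbD(2) by auto
  have stay: "x t \<in> fst ch \<and> snd ch (x t) \<in> ball y R" if t: "t1 \<le> t" "t < c" for t
  proof -
    have cont: "continuous_on {t1..t} x"
      using t t1 by (intro abs_continuous_on_imp_continuous_on is_solution_abs_continuous[OF x]) auto
    have ball: "cball y R \<subseteq> snd ch ` fst ch" using tbD(6) by (simp add: y_def)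
    \<comment> \<open>The largest radius that the budget permits. It is strictly below
      \<open>R\<close>, so the exit alternative of \<open>chart_exit\<close> would exceed the
      budget.\<close>
    have R': "R / 2 + (G c - G \<tau>) < R" using \<tau>(3) by simp
    show ?thesis
    proof (cases rule: chart_exit[OF tbD(1) ball cont t(1) start R'])
      case 1
      then show ?thesis using t(1) by simp
    next
      case (2 s)
      have "norm (snd ch (x s) - snd ch (x t1)) \<le> G s - G t1"
        using 2(1) t t1 by (intro step 2(2)) auto
      also have "\<dots> \<le> G c - G \<tau>"
        using Gmono[of s c] Gmono[of \<tau> t1] 2(1) t t1 \<tau> by auto
      finally have "dist y (snd ch (x s)) \<le> R / 2 + (G c - G \<tau>)"
        using dist_triangle[of y "snd ch (x s)" "snd ch (x t1)"] t1(5) by (simp add: dist_norm norm_minus_commute)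
      then show ?thesis using 2(3) by simp
    qed
  qed
  define e where "e t = snd ch (x t)" for t
  have e_le: "norm (e t - e s) \<le> G t - G s" if "t1 \<le> s" "s \<le> t" "t < c" for s t
    unfolding e_def using that t1(1) stay by (intro step) auto
  \<comment> \<open>The coordinates inherit the modulus of continuity of \<open>G\<close>, which is
    uniform on the compact interval \<open>{t0..c}\<close>; so they extend continuously to
    \<open>c\<close>.\<close>
  have "uniformly_continuous_on {t1..<c} e"
    unfolding uniformly_continuous_on_def
  proof (intro allI impI)
    fix \<epsilon> :: real assume "\<epsilon> > 0"
    moreover have "uniformly_continuous_on {t0..c} G" by (rule compact_uniformly_continuous[OF Gcont]) simp
    ultimately obtain d where d: "d > 0" "\<forall>s\<in>{t0..c}. \<forall>t\<in>{t0..c}. dist t s < d \<longrightarrow> dist (G t) (G s) < \<epsilon>"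
      unfolding uniformly_continuous_on_def by blast
    have "dist (e t) (e s) < \<epsilon>" if st: "s \<in> {t1..<c}" "t \<in> {t1..<c}" "dist t s < d" for s t
    proof -
      have "dist (G t) (G s) < \<epsilon>" using d(2) st t1(1) by auto
      moreover have "dist (e t) (e s) \<le> dist (G t) (G s)"
        using e_le[of s t] e_le[of t s] st by (cases "s \<le> t") (auto simp: dist_norm norm_minus_commute)
      ultimately show ?thesis by simp
    qed
    then show "\<exists>d>0. \<forall>s\<in>{t1..<c}. \<forall>t\<in>{t1..<c}. dist t s < d \<longrightarrow> dist (e t) (e s) < \<epsilon>" using d(1) by blast
  qed
  then obtain E where E: "uniformly_continuous_on (closure {t1..<c}) E" "\<And>t. t \<in> {t1..<c} \<Longrightarrow> e t = E t"
    by (rule uniformly_continuous_on_extension_on_closure) blast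
  have clos: "closure {t1..<c} = {t1..c}" using t1(3) by simp
  have Econt: "continuous_on {t1..c} E" using uniformly_continuous_imp_continuous[OF E(1)] clos by simp
  \<comment> \<open>The increment bound passes to the end time by continuity; this gives absolute
    continuity on the closed interval.\<close>
  have E_le: "norm (E t - E s) \<le> G t - G s" if st: "t1 \<le> s" "s \<le> t" "t \<le> c" for s t
  proof (cases "s < c")
    case True
    have cl: "closure {s..<c} = {s..c}" using True by simp
    have "norm (E t - E s) - (G t - G s) \<le> 0"
    proof (rule continuous_le_on_closure[where S = "{s..<c}" and x = t and f = "\<lambda>t. norm (E t - E s) - (G t - G s)"])
      show "continuous_on (closure {s..<c}) (\<lambda>t. norm (E t - E s) - (G t - G s))"
        unfolding cl using st t1(1)
        by (intro continuous_intros continuous_on_subset[OF Econt] continuous_on_subset[OF Gcont]) auto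
      show "t \<in> closure {s..<c}" unfolding cl using st by auto
      show "norm (E r - E s) - (G r - G s) \<le> 0" if "r \<in> {s..<c}" for r
        using e_le[of s r] E(2)[of r] E(2)[of s] that st True by auto
    qed
    then show ?thesis by simp
  next
    case False
    then have "t = s" using st by simp
    then show ?thesis by simp
  qed
  have E_ball: "E t \<in> cball y R" if "t \<in> {t1..c}" for t
  proof -
    have "norm (E t - y) \<le> R"
    proof (rule continuous_le_on_closure[where S = "{t1..<c}" and x = t and f = "\<lambda>t. norm (E t - y)"])
      show "continuous_on (closure {t1..<c}) (\<lambda>t. norm (E t - y))"
        unfolding clos by (intro continuous_intros Econt)
      show "norm (E r - y) \<le> R" if "r \<in> {t1..<c}" for r
        using stay[of r] E(2)[OF that] that by (auto simp: e_def dist_norm norm_minus_commute)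
    qed (use that clos in auto)
    then show ?thesis by (simp add: dist_norm norm_minus_commute)
  qed
  define q where "q = chart_inv ch (E c)"
  have "E c \<in> cball (snd ch p) (2 * R)" using E_ball[of c] t1(3) tbD(7) by (auto simp: y_def)
  then obtain q' where "q' \<in> fst ch" "q' \<in> D" "E c = snd ch q'" using sub by blast
  then have q: "q \<in> fst ch" "q \<in> D" "snd ch q = E c"
    unfolding q_def using chart_inv_chart[OF tbD(1)] by auto
  \<comment> \<open>The solution completed by its limit at \<open>c\<close>, so that it can be
    restarted there.\<close>
  define z where "z t = (if t < c then x t else q)" for t
  have zx: "z t = x t" if "t < c" for t using that by (simp add: z_def)
  have zE: "z t \<in> fst ch \<and> snd ch (z t) = E t" if "t \<in> {t1..c}" for t
    using that q stay[of t] E(2)[of t] by (cases "t < c") (auto simp: z_def e_def)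
  have z: "is_solution A g D b t0 x0 {t0..c} z"
    unfolding is_solution_def
  proof (intro conjI)
    show "is_interval {t0..c}" "t0 \<in> {t0..c}" using tc by auto
    show "z ` {t0..c} \<subseteq> D" using q(2) is_solutionD(3)[OF x] by (auto simp: z_def)
    show "z t0 = x0" using zx[OF tc] is_solutionD(5)[OF x] by simp
    have "abs_continuous_on A g t1 c z"
    proof (rule abs_continuous_on_chartI[OF tb])
      show "H absolutely_integrable_on {t1..c}"
        using t1(1) by (intro absolutely_integrable_on_subinterval[OF H(1)]) auto
      show "z t \<in> fst ch \<and> snd ch (z t) \<in> cball (snd ch p) R" if "t \<in> {t1..c}" for t
        using zE[OF that] E_ball[OF that] by (simp add: y_def)
      show "norm (snd ch (z t) - snd ch (z s)) \<le> integral {s..t} H" if "t1 \<le> s" "s \<le> t" "t \<le> c" for s t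
        using zE[of s] zE[of t] E_le[OF that] GH[of s t] that t1(1) by auto
    qed
    moreover have "abs_continuous_on A g t0 t1 z"
    proof (rule abs_continuous_on_cong)
      show "abs_continuous_on A g t0 t1 x" using t1 by (intro is_solution_abs_continuous[OF x]) auto
      show "z t = x t" if "t \<in> {t0..t1}" for t using that t1(3) by (intro zx) simp
    qed
    ultimately have "abs_continuous_on A g t0 c z"
      using t1 by (intro abs_continuous_on_combine[of t0 t1 z c]) auto
    then show "locally_abs_continuous_on A g {t0..c} z"
      unfolding locally_abs_continuous_on_def by (auto intro: abs_continuous_on_subinterval)
    show "AE t in lebesgue. t \<in> interior {t0..c} \<longrightarrow> has_velocity A z t (b t (z t))"
      using is_solutionD(6)[OF x]
    proof eventually_elim
      case (elim t)
      show ?case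
      proof
        assume "t \<in> interior {t0..c}"
        then have t: "t \<in> {t0<..<c}" by simp
        then have "has_velocity A x t (b t (x t))" using elim by simp
        then have "has_velocity A z t (b t (x t))"
          by (rule has_velocity_transform[of _ _ _ "{..<c}"]) (use t zx in auto)
        then show "has_velocity A z t (b t (z t))" using zx[of t] t by simp
      qed
    qed
  qed
  \<comment> \<open>Gluing requires both pieces to be based at \<open>c\<close>; the initial time is
    moved back to \<open>t0\<close> afterwards.\<close>
  have zc: "is_solution A g D b c q {t0..c} z"
    using is_solution_subset[OF z order_refl, of c] tc by (simp add: z_def)
  obtain \<delta> w where \<delta>: "\<delta> > 0" and w: "is_solution A g D b c q {c..c + \<delta>} w"
    using local_existence_right[OF q(2)] by blast
  define x' where "x' t = (if t \<le> c then z t else w t)" for t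
  have "is_solution A g D b c q ({t0..c} \<union> {c..c + \<delta>}) x'"
    unfolding x'_def by (rule is_solution_glue[OF zc w]) auto
  moreover have "{t0..c} \<union> {c..c + \<delta>} = {t0..c + \<delta>}" using tc \<delta> by auto
  ultimately have "is_solution A g D b c q {t0..c + \<delta>} x'" by simp
  from is_solution_subset[OF this order_refl, of t0]
  have "is_solution A g D b t0 (x' t0) {t0..c + \<delta>} x'" using tc \<delta> by simp
  moreover have "x' t0 = x0" using tc is_solutionD(5)[OF z] by (simp add: x'_def)
  moreover have "x' t = x t" if "t \<in> {t0..<c}" for t using that zx by (simp add: x'_def)
  ultimately show ?thesis using \<delta> by (intro that[of \<delta> x']) auto
qed

lemma escape_right:
  assumes x: "is_solution A g D b t0 x0 {t0..<c} x" and tc: "t0 < c"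
    and maximal: "\<And>\<delta> x'. \<lbrakk>\<delta> > 0; is_solution A g D b t0 x0 {t0..<c + \<delta>} x'; \<And>t. t \<in> {t0..<c} \<Longrightarrow> x' t = x t\<rbrakk> \<Longrightarrow> False"
    and K: "compact K" "K \<subseteq> D"
  obtains \<tau> where "t0 \<le> \<tau>" "\<tau> < c" "\<And>t. \<tau> < t \<Longrightarrow> t < c \<Longrightarrow> x t \<notin> K"
proof -
  have "\<exists>U \<tau>. open U \<and> p \<in> U \<and> \<tau> < c \<and> (\<forall>t. t0 \<le> t \<and> \<tau> < t \<and> t < c \<longrightarrow> x t \<notin> U)" if p: "p \<in> K" for p
  proof (rule ccontr)
    assume contr: "\<not> ?thesis"
    have pD: "p \<in> D" using p K(2) by blast
    obtain \<delta> x' where \<delta>: "\<delta> > 0" and x': "is_solution A g D b t0 x0 {t0..c + \<delta>} x'"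
      and eq: "\<forall>t\<in>{t0..<c}. x' t = x t"
    proof (rule extend_beyond_right[OF x tc pD])
      show "\<exists>t. t0 \<le> t \<and> \<tau> < t \<and> t < c \<and> x t \<in> U" if "open U" "p \<in> U" "\<tau> < c" for U \<tau>
        using contr that by blast
    qed blast
    \<comment> \<open>The extension lives on a closed interval, whereas maximality concerns
      half-open ones.\<close>
    have "is_solution A g D b t0 (x' t0) {t0..<c + \<delta>} x'"
      by (rule is_solution_subset[OF x']) (use tc \<delta> in auto)
    then have "is_solution A g D b t0 x0 {t0..<c + \<delta>} x'" using is_solutionD(5)[OF x'] by simp
    then show False by (rule maximal[OF \<delta>]) (use eq in blast)
  qed
  then obtain U \<tau> where U: "\<And>p. p \<in> K \<Longrightarrow> open (U p)" "\<And>p. p \<in> K \<Longrightarrow> p \<in> U p" "\<And>p. p \<in> K \<Longrightarrow> \<tau> p < c"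
    "\<And>p t. \<lbrakk>p \<in> K; t0 \<le> t; \<tau> p < t; t < c\<rbrakk> \<Longrightarrow> x t \<notin> U p"
    by metis
  obtain C where C: "C \<subseteq> K" "finite C" "K \<subseteq> \<Union> (U ` C)"
    using compactE_image[OF K(1), of K U] U(1,2) by blast
  \<comment> \<open>Inserting \<open>t0\<close> keeps the maximum meaningful when the subcover is
    empty, and places \<open>T\<close> in the interval.\<close>
  define T where "T = Max (insert t0 (\<tau> ` C))"
  have fin: "finite (insert t0 (\<tau> ` C))" using C(2) by simp
  show ?thesis
  proof (rule that[of T])
    show "t0 \<le> T" unfolding T_def using fin by simp
    show "T < c" unfolding T_def using fin tc C(1) U(3) by auto
    fix t assume t: "T < t" "t < c"
    show "x t \<notin> K"
    proof
      assume "x t \<in> K"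
      then obtain p where p: "p \<in> C" "x t \<in> U p" using C(3) by blast
      have "\<tau> p \<le> T" "t0 \<le> T" unfolding T_def using fin p(1) by auto
      then have "x t \<notin> U p" using t p(1) C(1) by (intro U(4)) auto
      then show False using p(2) by simp
    qed
  qed
qed

lemma escape_left:
  assumes x: "is_solution A g D b t0 x0 {c<..t0} x" and tc: "c < t0"
    and maximal: "\<And>\<delta> x'. \<lbrakk>\<delta> > 0; is_solution A g D b t0 x0 {c - \<delta><..t0} x'; \<And>t. t \<in> {c<..t0} \<Longrightarrow> x' t = x t\<rbrakk> \<Longrightarrow> False"
    and K: "compact K" "K \<subseteq> D"
  obtains \<tau> where "c < \<tau>" "\<tau> \<le> t0" "\<And>t. c < t \<Longrightarrow> t < \<tau> \<Longrightarrow> x t \<notin> K"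
proof -
  interpret rev: caratheodory_field A g D "reverse_field b" by (rule reverse_caratheodory_field)
  have img: "uminus ` {c<..t0} = {- t0..<- c}" for c :: real
  proof (intro equalityI subsetI)
    fix t assume "t \<in> {- t0..<- c}"
    then show "t \<in> uminus ` {c<..t0}" by (intro image_eqI[of _ _ "- t"]) auto
  qed auto
  have img': "uminus ` {- t0..<- c} = {c<..t0}" for c :: real
    unfolding img[symmetric] image_image by simp
  have revx: "is_solution A g D (reverse_field b) (- t0) x0 {- t0..<- c} (\<lambda>t. x (- t))"
    using is_solution_reverse[OF x] unfolding img .
  have rc: "- t0 < - c" using tc by simp
  obtain \<tau> where \<tau>: "- t0 \<le> \<tau>" "\<tau> < - c" "\<forall>t. \<tau> < t \<longrightarrow> t < - c \<longrightarrow> x (- t) \<notin> K"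
  proof (rule rev.escape_right[OF revx rc _ K])
    fix \<delta> x' assume \<delta>: "\<delta> > 0" and x': "is_solution A g D (reverse_field b) (- t0) x0 {- t0..<- c + \<delta>} x'"
      and eq: "\<And>t. t \<in> {- t0..<- c} \<Longrightarrow> x' t = x (- t)"
    have "is_solution A g D b t0 x0 {c - \<delta><..t0} (\<lambda>t. x' (- t))"
      using is_solution_reverse[OF x'] img'[of "c - \<delta>"] by simp
    then show False by (rule maximal[OF \<delta>]) (use eq in auto)
  qed blast
  show ?thesis
  proof (rule that[of "- \<tau>"])
    fix t assume "c < t" "t < - \<tau>"
    then show "x t \<notin> K" using \<tau>(3)[rule_format, of "- t"] by simp
  qed (use \<tau> in auto)
qed

text \<open>A forward solution and the reflection of a forward solution for the reversed field share
  the value \<open>x0\<close> at \<open>t0\<close> and are glued there.\<close>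

lemma local_existence:
  assumes "x0 \<in> D"
  obtains \<delta> x where "\<delta> > 0" "is_solution A g D b t0 x0 {t0 - \<delta><..<t0 + \<delta>} x"
proof -
  interpret rev: caratheodory_field A g D "reverse_field b" by (rule reverse_caratheodory_field)
  obtain \<delta>1 w where \<delta>1: "\<delta>1 > 0" and w: "is_solution A g D b t0 x0 {t0..t0 + \<delta>1} w"
    using local_existence_right[OF assms] by blast
  obtain \<delta>2 v where \<delta>2: "\<delta>2 > 0" and v: "is_solution A g D (reverse_field b) (- t0) x0 {- t0..- t0 + \<delta>2} v"
    using rev.local_existence_right[OF assms] by blast
  have "is_solution A g D b t0 x0 {t0 - \<delta>2..t0} (\<lambda>t. v (- t))"
    using is_solution_reverse[OF v] by simp
  from is_solution_glue[OF this w]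
  obtain x where x: "is_solution A g D b t0 x0 ({t0 - \<delta>2..t0} \<union> {t0..t0 + \<delta>1}) x" by fastforce
  define \<delta> where "\<delta> = min \<delta>1 \<delta>2"
  have "is_solution A g D b t0 (x t0) {t0 - \<delta><..<t0 + \<delta>} x"
    by (rule is_solution_subset[OF x]) (use \<delta>1 \<delta>2 in \<open>auto simp: \<delta>_def\<close>)
  then show ?thesis
    using \<delta>1 \<delta>2 is_solutionD(5)[OF x] by (intro that[of \<delta> x]) (auto simp: \<delta>_def)
qed

end

section \<open>The theorem, with extended real end times reduced to real ones\<close>

theorem theorem5p1:
  fixes A :: "('m::{t2_space, second_countable_topology}, 'e::euclidean_space) chart set"
    and g :: "('m, 'e) metric_tensor"
    and D :: "'m set"
    and b :: "real \<Rightarrow> 'm \<Rightarrow> ('m, 'e) tvector"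
    and t0 :: real
    and x0 :: 'm
  assumes "smooth_structure A"
    and "riemannian_metric A g"
    and "connected (UNIV :: 'm set)"
    and "Metric_space.mcomplete UNIV (riem_dist A g)"
    and "open D"
    and "time_dependent_field_on A D b"
    and "\<And>x. x \<in> D \<Longrightarrow> tangent_measurable A x (\<lambda>t. b t x)"
    and "AE t in lebesgue. continuous_field_on A D (b t)"
    and "\<And>J. compact J \<Longrightarrow> J \<subseteq> UNIV \<times> D \<Longrightarrow>
           \<exists>h. locally_integrable h \<and>
               (AE t in lebesgue. \<forall>x\<in>D. (t, x) \<in> J \<longrightarrow> tnorm g x (b t x) \<le> h t)"
    and "x0 \<in> D"
  shows "(\<exists>\<delta>>0. \<exists>x. is_solution A g D b t0 x0 {t0 - \<delta><..<t0 + \<delta>} x) \<and>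
    (\<forall>(c2 :: ereal) x.
       ereal t0 < c2 \<and> is_solution A g D b t0 x0 {t. t0 \<le> t \<and> ereal t < c2} x \<and>
       c2 < \<infinity> \<and>
       \<not> (\<exists>c2' > c2. \<exists>x'. is_solution A g D b t0 x0 {t. t0 \<le> t \<and> ereal t < c2'} x' \<and>
            (\<forall>t. t0 \<le> t \<and> ereal t < c2 \<longrightarrow> x' t = x t))
       \<longrightarrow> (\<forall>K. compact K \<and> K \<subseteq> D \<longrightarrow>
             (\<exists>\<tau>. t0 \<le> \<tau> \<and> ereal \<tau> < c2 \<and> (\<forall>t. \<tau> < t \<and> ereal t < c2 \<longrightarrow> x t \<notin> K)))) \<and>
    (\<forall>(c1 :: ereal) x.
       c1 < ereal t0 \<and> is_solution A g D b t0 x0 {t. c1 < ereal t \<and> t \<le> t0} x \<and>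
       - \<infinity> < c1 \<and>
       \<not> (\<exists>c1' < c1. \<exists>x'. is_solution A g D b t0 x0 {t. c1' < ereal t \<and> t \<le> t0} x' \<and>
            (\<forall>t. c1 < ereal t \<and> t \<le> t0 \<longrightarrow> x' t = x t))
       \<longrightarrow> (\<forall>K. compact K \<and> K \<subseteq> D \<longrightarrow>
             (\<exists>\<tau>. c1 < ereal \<tau> \<and> \<tau> \<le> t0 \<and> (\<forall>t. c1 < ereal t \<and> t < \<tau> \<longrightarrow> x t \<notin> K))))"
proof -
  interpret caratheodory_field A g D b
    by unfold_locales (use assms(1-3,5-9) in auto)
  note x0 = assms(10)
  show ?thesis
  proof (intro conjI allI impI)
    show "\<exists>\<delta>>0. \<exists>x. is_solution A g D b t0 x0 {t0 - \<delta><..<t0 + \<delta>} x"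
      using local_existence[OF x0] by blast
  next
    fix c2 :: ereal and x K
    assume *: "ereal t0 < c2 \<and> is_solution A g D b t0 x0 {t. t0 \<le> t \<and> ereal t < c2} x \<and> c2 < \<infinity> \<and>
      \<not> (\<exists>c2' > c2. \<exists>x'. is_solution A g D b t0 x0 {t. t0 \<le> t \<and> ereal t < c2'} x' \<and>
            (\<forall>t. t0 \<le> t \<and> ereal t < c2 \<longrightarrow> x' t = x t))"
      and K: "compact K \<and> K \<subseteq> D"
    \<comment> \<open>The two strict inequalities on \<open>c2\<close> exclude both infinite
      values.\<close>
    then obtain c where c: "c2 = ereal c" "t0 < c" by (cases c2) auto
    have int: "{t. t0 \<le> t \<and> ereal t < ereal r} = {t0..<r}" for r by auto
    have x: "is_solution A g D b t0 x0 {t0..<c} x" using * unfolding c int by blast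
    have maximal: False if "\<delta> > 0" "is_solution A g D b t0 x0 {t0..<c + \<delta>} x'"
      "\<And>t. t \<in> {t0..<c} \<Longrightarrow> x' t = x t" for \<delta> x'
    proof -
      have "ereal (c + \<delta>) > c2" using that(1) c by simp
      moreover have "is_solution A g D b t0 x0 {t. t0 \<le> t \<and> ereal t < ereal (c + \<delta>)} x'"
        using that(2) unfolding int .
      moreover have "\<forall>t. t0 \<le> t \<and> ereal t < c2 \<longrightarrow> x' t = x t" using that(3) c by simp
      ultimately show False using * by blast
    qed
    obtain \<tau> where "t0 \<le> \<tau>" "\<tau> < c" "\<forall>t. \<tau> < t \<longrightarrow> t < c \<longrightarrow> x t \<notin> K"
      by (rule escape_right[OF x c(2) maximal conjunct1[OF K] conjunct2[OF K]]) blast+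
    then show "\<exists>\<tau>. t0 \<le> \<tau> \<and> ereal \<tau> < c2 \<and> (\<forall>t. \<tau> < t \<and> ereal t < c2 \<longrightarrow> x t \<notin> K)"
      using c by auto
  next
    fix c1 :: ereal and x K
    assume *: "c1 < ereal t0 \<and> is_solution A g D b t0 x0 {t. c1 < ereal t \<and> t \<le> t0} x \<and> - \<infinity> < c1 \<and>
      \<not> (\<exists>c1' < c1. \<exists>x'. is_solution A g D b t0 x0 {t. c1' < ereal t \<and> t \<le> t0} x' \<and>
            (\<forall>t. c1 < ereal t \<and> t \<le> t0 \<longrightarrow> x' t = x t))"
      and K: "compact K \<and> K \<subseteq> D"
    then obtain c where c: "c1 = ereal c" "c < t0" by (cases c1) auto
    have int: "{t. ereal r < ereal t \<and> t \<le> t0} = {r<..t0}" for r by auto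
    have x: "is_solution A g D b t0 x0 {c<..t0} x" using * unfolding c int by blast
    have maximal: False if "\<delta> > 0" "is_solution A g D b t0 x0 {c - \<delta><..t0} x'"
      "\<And>t. t \<in> {c<..t0} \<Longrightarrow> x' t = x t" for \<delta> x'
    proof -
      have "ereal (c - \<delta>) < c1" using that(1) c by simp
      moreover have "is_solution A g D b t0 x0 {t. ereal (c - \<delta>) < ereal t \<and> t \<le> t0} x'"
        using that(2) unfolding int .
      moreover have "\<forall>t. c1 < ereal t \<and> t \<le> t0 \<longrightarrow> x' t = x t" using that(3) c by simp
      ultimately show False using * by blast
    qed
    obtain \<tau> where "c < \<tau>" "\<tau> \<le> t0" "\<forall>t. c < t \<longrightarrow> t < \<tau> \<longrightarrow> x t \<notin> K"
      by (rule escape_left[OF x c(2) maximal conjunct1[OF K] conjunct2[OF K]]) blast+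
    then show "\<exists>\<tau>. c1 < ereal \<tau> \<and> \<tau> \<le> t0 \<and> (\<forall>t. c1 < ereal t \<and> t < \<tau> \<longrightarrow> x t \<notin> K)"
      using c by auto
  qed
qed

end
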